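(* Let $k$ be an algebraically closed field of characteristic $p$, let $G$ be a finite group of order divisible by $p$, and let $w\in\mathrm{mod}(kG)$. Suppose that for every tensor closed thick subcategory $\mathcal{L}'\subseteq\mathrm{stmod}_w(kG)$, with $\mathcal{L}$ denoting the smallest localizing subcategory of $\mathrm{StMod}_w(kG)$ containing $\mathcal{L}'$, and for every object $M$ of $\mathrm{StMod}_w(kG)$, the Bousfield triangle $T_{\mathcal{L}}(M)$ is isomorphic to $M\otimes_k T_{\mathcal{L}}(k)$. Then $\mathrm{StMod}_w(kG)\cong \mathrm{stmod}_w(kG)^{\oplus}$.
   Context: Let $\mathrm{Mod}(kG)$ and $\mathrm{mod}(kG)$ be the categories of all and of finite dimensional $kG$-modules, with $\otimes=\otimes_k$ carrying the diagonal $G$-action, and let $\mathrm{StMod}(kG)$ be the ordinary stable module category (quotient of $\mathrm{Mod}(kG)$ by maps factoring through projectives). For $w\in\mathrm{mod}(kG)$, let $\mathcal{P}(w)$ be the class of all $X\in\mathrm{Mod}(kG)$ such that $X$ is isomorphic to a direct summand of $w\otimes Y$ for some $Y\in\mathrm{Mod}(kG)$. The relatively stable category $\mathrm{StMod}_w(kG)$ has the same objects as $\mathrm{StMod}(kG)$, and its Hom groups are the quotients of those in $\mathrm{StMod}(kG)$ by the morphisms that factor through an object of $\mathcal{P}(w)$. It is a triangulated category with arbitrary direct sums: completing a right $\mathcal{P}(w)$-approximation $P(X)\to X$ to a triangle $\Omega_w(X)\to P(X)\to X\leadsto$ in $\mathrm{StMod}(kG)$ defines $\Omega_w$, which is the inverse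 of the shift $[1]$; the distinguished triangles are (up to isomorphism) the triangles of $\mathrm{StMod}(kG)$ that split on tensoring with $w$. The category $\mathrm{stmod}_w(kG)$ is the full triangulated subcategory of $\mathrm{StMod}_w(kG)$ given by the finite dimensional modules. All subcategories are closed under isomorphism. A full triangulated subcategory is localizing if it is closed under arbitrary direct sums of the ambient category, and thick if it is closed under direct summands. A subcategory $\mathcal{L}'\subseteq\mathrm{stmod}_w(kG)$ is tensor closed (tensor ideal) if $x\in\mathcal{L}'$ and $y\in\mathrm{stmod}_w(kG)$ imply $x\otimes_k y\in\mathcal{L}'$. $\mathrm{stmod}_w(kG)^{\oplus}$ is the smallest localizing subcategory of $\mathrm{StMod}_w(kG)$ containing $\mathrm{stmod}_w(kG)$, and $\mathrm{StMod}_w(kG)\cong\mathrm{stmod}_w(kG)^{\oplus}$ means that the inclusion is an equivalence, i.e. every object of $\mathrm{StMod}_w(kG)$ lies in $\mathrm{stmod}_w(kG)^\oplus$. For $\mathcal{L}$ as in the claim, finite dimensional modules being compact, Bousfield localization gives for each $M$ in $\mathrm{StMod}_w(kG)$ a distinguished triangle (the Bousfield triangle), unique up to isomorphism, $$T_{\mathcal{L}}(M):\quad M_{\mathcal{L}}\to M\to M_{\mathcal{L}^\perp}\leadsto$$ in $\mathrm{StMod}_w(kG)$ with $M_{\mathcal{L}}\in\mathcal{L}$ and $M_{\mathcal{L}^\perp}\in\mathcal{L}^\perp$, where $\mathcal{L}^\perp$ is the class of objects $X$ with $\mathrm{Hom}(L,X)=0$ for all $L\in\mathcal{L}$. $M\otimes_k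 T_{\mathcal{L}}(k)$ is the triangle obtained by tensoring $T_{\mathcal{L}}(k)$ with $M$, where $k$ is the trivial module. *)

theory Defs
  imports "HOL-Algebra.Algebra"
begin

section \<open>Modules over a group algebra\<close>

text \<open>A \<open>kG\<close>-module is a module over the field \<open>K\<close> (in the sense of HOL-Algebra) together with a
  linear action of the group \<open>G\<close>.  The type \<open>'v\<close> plays the role of a universe of sets: the
  carriers of \<open>K\<close> and of all modules are subsets of \<open>'v\<close>, and direct sums are indexed by
  subsets of \<open>'v\<close>.  As \<open>K\<close> itself lives in \<open>'v\<close> and will be infinite, this universe is closed under
  tensor products, direct sums indexed by subsets of \<open>'v\<close>, and kernels and cokernels
  (up to isomorphism of modules).  The \<open>mult\<close> and \<open>one\<close> components which HOL-Algebra's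
  module record inherits from rings are ignored throughout.\<close>

record ('v, 'g) rep = "('v, 'v) module" +
  act :: "'g \<Rightarrow> 'v \<Rightarrow> 'v"

definition lin_maps ::
  "('v, 'y) ring_scheme \<Rightarrow> ('v, 'v, 'a) module_scheme \<Rightarrow> ('v, 'v, 'b) module_scheme \<Rightarrow> ('v \<Rightarrow> 'v) set"
  where "lin_maps K M N = {f \<in> carrier M \<rightarrow> carrier N.
    (\<forall>x\<in>carrier M. \<forall>y\<in>carrier M. f (x \<oplus>\<^bsub>M\<^esub> y) = f x \<oplus>\<^bsub>N\<^esub> f y) \<and>
    (\<forall>c\<in>carrier K. \<forall>x\<in>carrier M. f (c \<odot>\<^bsub>M\<^esub> x) = c \<odot>\<^bsub>N\<^esub> f x)}"

definition kG_Mod :: "('v, 'y) ring_scheme \<Rightarrow> ('g, 'z) monoid_scheme \<Rightarrow> ('v, 'g) rep set"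
  where "kG_Mod K G = {M. module K M \<and>
    (\<forall>g\<in>carrier G. act M g \<in> lin_maps K M M) \<and>
    (\<forall>x\<in>carrier M. act M \<one>\<^bsub>G\<^esub> x = x) \<and>
    (\<forall>g\<in>carrier G. \<forall>h\<in>carrier G. \<forall>x\<in>carrier M. act M (g \<otimes>\<^bsub>G\<^esub> h) x = act M g (act M h x))}"

definition Hom ::
  "('v, 'y) ring_scheme \<Rightarrow> ('g, 'z) monoid_scheme \<Rightarrow> ('v, 'g) rep \<Rightarrow> ('v, 'g) rep \<Rightarrow> ('v \<Rightarrow> 'v) set"
  where "Hom K G M N = {f \<in> lin_maps K M N.
    \<forall>g\<in>carrier G. \<forall>x\<in>carrier M. f (act M g x) = act N g (f x)}"

definition fin_dim :: "('v, 'y) ring_scheme \<Rightarrow> ('v, 'v, 'a) module_scheme \<Rightarrow> bool"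
  where "fin_dim K M \<longleftrightarrow> (\<exists>S. finite S \<and> S \<subseteq> carrier M \<and>
    (\<forall>x\<in>carrier M. \<exists>c\<in>S \<rightarrow> carrier K. x = (\<Oplus>\<^bsub>M\<^esub>s\<in>S. c s \<odot>\<^bsub>M\<^esub> s)))"

definition fd_kG_Mod :: "('v, 'y) ring_scheme \<Rightarrow> ('g, 'z) monoid_scheme \<Rightarrow> ('v, 'g) rep set"
  where "fd_kG_Mod K G = {M \<in> kG_Mod K G. fin_dim K M}"

definition trivial_module :: "('v, 'y) ring_scheme \<Rightarrow> ('v, 'g) rep"
  where "trivial_module K = \<lparr>carrier = carrier K, monoid.mult = monoid.mult K, one = \<one>\<^bsub>K\<^esub>, ring.zero = \<zero>\<^bsub>K\<^esub>,
    ring.add = ring.add K, smult = monoid.mult K, act = (\<lambda>g x. x)\<rparr>"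

definition has_char :: "('v, 'y) ring_scheme \<Rightarrow> nat \<Rightarrow> bool"
  where "has_char K p \<longleftrightarrow> (\<forall>n::nat. [n] \<cdot>\<^bsub>K\<^esub> \<one>\<^bsub>K\<^esub> = \<zero>\<^bsub>K\<^esub> \<longleftrightarrow> p dvd n)"

definition ses ::
  "('v, 'y) ring_scheme \<Rightarrow> ('g, 'z) monoid_scheme \<Rightarrow> ('v, 'g) rep \<Rightarrow> ('v, 'g) rep \<Rightarrow> ('v, 'g) rep \<Rightarrow>
    ('v \<Rightarrow> 'v) \<Rightarrow> ('v \<Rightarrow> 'v) \<Rightarrow> bool"
  where "ses K G A B C f g \<longleftrightarrow> A \<in> kG_Mod K G \<and> B \<in> kG_Mod K G \<and> C \<in> kG_Mod K G \<and>
    f \<in> Hom K G A B \<and> g \<in> Hom K G B C \<and>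
    inj_on f (carrier A) \<and> f ` carrier A = {y \<in> carrier B. g y = \<zero>\<^bsub>C\<^esub>} \<and> g ` carrier B = carrier C"

definition projective ::
  "('v, 'y) ring_scheme \<Rightarrow> ('g, 'z) monoid_scheme \<Rightarrow> ('v, 'g) rep \<Rightarrow> bool"
  where "projective K G P \<longleftrightarrow> P \<in> kG_Mod K G \<and>
    (\<forall>V\<in>kG_Mod K G. \<forall>Y\<in>kG_Mod K G. \<forall>q\<in>Hom K G V Y. \<forall>f\<in>Hom K G P Y.
      q ` carrier V = carrier Y \<longrightarrow> (\<exists>f'\<in>Hom K G P V. \<forall>x\<in>carrier P. q (f' x) = f x))"

subsection \<open>Tensor products\<close>

definition bilinear ::
  "('v, 'y) ring_scheme \<Rightarrow> ('v, 'v, 'a) module_scheme \<Rightarrow> ('v, 'v, 'b) module_scheme \<Rightarrow>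
    ('v, 'v, 'c) module_scheme \<Rightarrow> ('v \<Rightarrow> 'v \<Rightarrow> 'v) \<Rightarrow> bool"
  where "bilinear K M N U \<beta> \<longleftrightarrow>
    (\<forall>x\<in>carrier M. \<beta> x \<in> lin_maps K N U) \<and> (\<forall>y\<in>carrier N. (\<lambda>x. \<beta> x y) \<in> lin_maps K M U)"

text \<open>\<open>T\<close>, with the bilinear map \<open>\<beta>\<close>, is the tensor product over \<open>K\<close> of \<open>M\<close> and \<open>N\<close>, with
  the diagonal action of \<open>G\<close>.  It is unique up to unique isomorphism, and every notion
  below in which it occurs is invariant under such an isomorphism.\<close>

definition is_tensor ::
  "('v, 'y) ring_scheme \<Rightarrow> ('g, 'z) monoid_scheme \<Rightarrow> ('v, 'g) rep \<Rightarrow> ('v, 'g) rep \<Rightarrow> ('v, 'g) rep \<Rightarrow>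
    ('v \<Rightarrow> 'v \<Rightarrow> 'v) \<Rightarrow> bool"
  where "is_tensor K G M N T \<beta> \<longleftrightarrow> T \<in> kG_Mod K G \<and> bilinear K M N T \<beta> \<and>
    (\<forall>g\<in>carrier G. \<forall>x\<in>carrier M. \<forall>y\<in>carrier N. act T g (\<beta> x y) = \<beta> (act M g x) (act N g y)) \<and>
    (\<forall>U b. module K (U :: ('v, 'v) module) \<and> bilinear K M N U b \<longrightarrow>
      (\<exists>h\<in>lin_maps K T U. \<forall>x\<in>carrier M. \<forall>y\<in>carrier N. h (\<beta> x y) = b x y) \<and>
      (\<forall>h\<in>lin_maps K T U. \<forall>h'\<in>lin_maps K T U.
        (\<forall>x\<in>carrier M. \<forall>y\<in>carrier N. h (\<beta> x y) = h' (\<beta> x y)) \<longrightarrow> (\<forall>t\<in>carrier T. h t = h' t)))"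

text \<open>\<open>F\<close> is the map \<open>id \<otimes> f\<close> from \<open>M \<otimes> A\<close> to \<open>M \<otimes> B\<close>, where \<open>\<alpha>\<close> and \<open>\<beta>\<close> are the structure
  maps of these tensor products.\<close>

definition is_tensor_map ::
  "('v, 'g) rep \<Rightarrow> ('v, 'g) rep \<Rightarrow> ('v \<Rightarrow> 'v \<Rightarrow> 'v) \<Rightarrow> ('v \<Rightarrow> 'v \<Rightarrow> 'v) \<Rightarrow> ('v \<Rightarrow> 'v) \<Rightarrow> ('v \<Rightarrow> 'v) \<Rightarrow> bool"
  where "is_tensor_map M A \<alpha> \<beta> f F \<longleftrightarrow>
    (\<forall>x\<in>carrier M. \<forall>y\<in>carrier A. F (\<alpha> x y) = \<beta> x (f y))"

section \<open>Additive quotients of the module category\<close>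

text \<open>The categories \<open>Mod(kG)\<close>, \<open>StMod(kG)\<close> and \<open>StMod\<^sub>w(kG)\<close> have the same objects, and the Hom groups
  of the last two are quotients of those of the first.  Such a quotient is given by
  the ideal \<open>I\<close> of morphisms which become zero; morphisms are represented by module
  homomorphisms, and equality of morphisms is \<open>eq_mod I\<close>.\<close>

type_synonym ('v, 'g) mor_ideal = "('v, 'g) rep \<Rightarrow> ('v, 'g) rep \<Rightarrow> ('v \<Rightarrow> 'v) \<Rightarrow> bool"

definition eq_mod ::
  "('v, 'g) mor_ideal \<Rightarrow> ('v, 'g) rep \<Rightarrow> ('v, 'g) rep \<Rightarrow> ('v \<Rightarrow> 'v) \<Rightarrow> ('v \<Rightarrow> 'v) \<Rightarrow> bool"
  where "eq_mod I V Y f g \<longleftrightarrow> I V Y (\<lambda>x. f x \<ominus>\<^bsub>Y\<^esub> g x)"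

definition is_iso ::
  "('v, 'y) ring_scheme \<Rightarrow> ('g, 'z) monoid_scheme \<Rightarrow> ('v, 'g) mor_ideal \<Rightarrow>
    ('v, 'g) rep \<Rightarrow> ('v, 'g) rep \<Rightarrow> ('v \<Rightarrow> 'v) \<Rightarrow> bool"
  where "is_iso K G I V Y f \<longleftrightarrow> f \<in> Hom K G V Y \<and>
    (\<exists>g\<in>Hom K G Y V. eq_mod I V V (g \<circ> f) id \<and> eq_mod I Y Y (f \<circ> g) id)"

definition isomorphic ::
  "('v, 'y) ring_scheme \<Rightarrow> ('g, 'z) monoid_scheme \<Rightarrow> ('v, 'g) mor_ideal \<Rightarrow>
    ('v, 'g) rep \<Rightarrow> ('v, 'g) rep \<Rightarrow> bool"
  where "isomorphic K G I V Y \<longleftrightarrow> V \<in> kG_Mod K G \<and> Y \<in> kG_Mod K G \<and> (\<exists>f. is_iso K G I V Y f)"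

text \<open>\<open>V\<close> is a direct sum of \<open>Y\<close> and \<open>Z\<close>.\<close>

definition is_biproduct ::
  "('v, 'y) ring_scheme \<Rightarrow> ('g, 'z) monoid_scheme \<Rightarrow> ('v, 'g) mor_ideal \<Rightarrow>
    ('v, 'g) rep \<Rightarrow> ('v, 'g) rep \<Rightarrow> ('v, 'g) rep \<Rightarrow> bool"
  where "is_biproduct K G I Y Z V \<longleftrightarrow> Y \<in> kG_Mod K G \<and> Z \<in> kG_Mod K G \<and> V \<in> kG_Mod K G \<and>
    (\<exists>i\<in>Hom K G Y V. \<exists>j\<in>Hom K G Z V. \<exists>p\<in>Hom K G V Y. \<exists>q\<in>Hom K G V Z.
      eq_mod I Y Y (p \<circ> i) id \<and> eq_mod I Z Z (q \<circ> j) id \<and>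
      I Z Y (p \<circ> j) \<and> I Y Z (q \<circ> i) \<and>
      eq_mod I V V (\<lambda>x. i (p x) \<oplus>\<^bsub>V\<^esub> j (q x)) id)"

text \<open>\<open>S\<close>, with the injections \<open>i\<close>, is a direct sum (coproduct) of the family \<open>V\<close> over \<open>J\<close>.\<close>

definition is_coproduct ::
  "('v, 'y) ring_scheme \<Rightarrow> ('g, 'z) monoid_scheme \<Rightarrow> ('v, 'g) mor_ideal \<Rightarrow>
    'v set \<Rightarrow> ('v \<Rightarrow> ('v, 'g) rep) \<Rightarrow> ('v, 'g) rep \<Rightarrow> ('v \<Rightarrow> 'v \<Rightarrow> 'v) \<Rightarrow> bool"
  where "is_coproduct K G I J V S i \<longleftrightarrow> S \<in> kG_Mod K G \<and>
    (\<forall>j\<in>J. V j \<in> kG_Mod K G \<and> i j \<in> Hom K G (V j) S) \<and>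
    (\<forall>Y\<in>kG_Mod K G. \<forall>f. (\<forall>j\<in>J. f j \<in> Hom K G (V j) Y) \<longrightarrow>
      (\<exists>h\<in>Hom K G S Y. (\<forall>j\<in>J. eq_mod I (V j) Y (h \<circ> i j) (f j)) \<and>
        (\<forall>h'\<in>Hom K G S Y. (\<forall>j\<in>J. eq_mod I (V j) Y (h' \<circ> i j) (f j)) \<longrightarrow> eq_mod I S Y h' h)))"

definition right_orth ::
  "('v, 'y) ring_scheme \<Rightarrow> ('g, 'z) monoid_scheme \<Rightarrow> ('v, 'g) mor_ideal \<Rightarrow>
    ('v, 'g) rep set \<Rightarrow> ('v, 'g) rep set"
  where "right_orth K G I L = {V \<in> kG_Mod K G. \<forall>A\<in>L. \<forall>f\<in>Hom K G A V. I A V f}"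

definition mod_null :: "('v, 'g) mor_ideal"
  where "mod_null V Y f \<longleftrightarrow> (\<forall>x\<in>carrier V. f x = \<zero>\<^bsub>Y\<^esub>)"

definition st_null :: "('v, 'y) ring_scheme \<Rightarrow> ('g, 'z) monoid_scheme \<Rightarrow> ('v, 'g) mor_ideal"
  where "st_null K G V Y f \<longleftrightarrow> (\<exists>P a b. projective K G P \<and> a \<in> Hom K G V P \<and> b \<in> Hom K G P Y \<and>
    (\<forall>x\<in>carrier V. f x = b (a x)))"

definition Pcls ::
  "('v, 'y) ring_scheme \<Rightarrow> ('g, 'z) monoid_scheme \<Rightarrow> ('v, 'g) rep \<Rightarrow> ('v, 'g) rep set"
  where "Pcls K G w = {V \<in> kG_Mod K G. \<exists>Y T \<beta> Z. Y \<in> kG_Mod K G \<and> is_tensor K G w Y T \<beta> \<and>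
    is_biproduct K G mod_null V Z T}"

definition stw_null ::
  "('v, 'y) ring_scheme \<Rightarrow> ('g, 'z) monoid_scheme \<Rightarrow> ('v, 'g) rep \<Rightarrow> ('v, 'g) mor_ideal"
  where "stw_null K G w V Y f \<longleftrightarrow> (\<exists>Q\<in>Pcls K G w. \<exists>a\<in>Hom K G V Q. \<exists>b\<in>Hom K G Q Y.
    eq_mod (st_null K G) V Y f (b \<circ> a))"

section \<open>The triangulated structure of the relatively stable category\<close>

text \<open>A right \<open>\<P>(w)\<close>-approximation \<open>q : P \<rightarrow> V\<close> in \<open>StMod(kG)\<close>.  Since it is going to be completed
  to a triangle by an exact sequence of modules, \<open>P\<close> is only required to be isomorphic in
  \<open>StMod(kG)\<close> to a member of \<open>\<P>(w)\<close>; this matters only for \<open>w = 0\<close>, where the nonzero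
  projective modules are not in \<open>\<P>(w)\<close>.\<close>

definition right_approx ::
  "('v, 'y) ring_scheme \<Rightarrow> ('g, 'z) monoid_scheme \<Rightarrow> ('v, 'g) rep \<Rightarrow>
    ('v, 'g) rep \<Rightarrow> ('v, 'g) rep \<Rightarrow> ('v \<Rightarrow> 'v) \<Rightarrow> bool"
  where "right_approx K G w P V q \<longleftrightarrow> V \<in> kG_Mod K G \<and> q \<in> Hom K G P V \<and>
    (\<exists>Q\<in>Pcls K G w. isomorphic K G (st_null K G) P Q) \<and>
    (\<forall>Q\<in>Pcls K G w. \<forall>f\<in>Hom K G Q V. \<exists>f'\<in>Hom K G Q P. eq_mod (st_null K G) Q V (q \<circ> f') f)"

text \<open>Up to isomorphism, the triangles of \<open>StMod(kG)\<close> are those induced by short exact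
  sequences of modules.  The sequence \<open>A \<rightarrow> P \<rightarrow> S\<close> below thus exhibits \<open>A\<close> as \<open>\<Omega>\<^sub>w(S)\<close>, that is,
  \<open>S\<close> as \<open>A[1]\<close>.  The shift is not made into a function: each triangle carries its own
  sequence of this kind.\<close>

definition shift_model ::
  "('v, 'y) ring_scheme \<Rightarrow> ('g, 'z) monoid_scheme \<Rightarrow> ('v, 'g) rep \<Rightarrow>
    ('v, 'g) rep \<Rightarrow> ('v, 'g) rep \<Rightarrow> ('v, 'g) rep \<Rightarrow> ('v \<Rightarrow> 'v) \<Rightarrow> ('v \<Rightarrow> 'v) \<Rightarrow> bool"
  where "shift_model K G w A P S \<iota> \<pi> \<longleftrightarrow> ses K G A P S \<iota> \<pi> \<and> right_approx K G w P S \<pi>"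

text \<open>The triangle in \<open>StMod(kG)\<close> given by a short exact sequence with first map \<open>f : A \<rightarrow> B\<close>
  splits on tensoring with \<open>w\<close>, that is, \<open>w \<otimes> f\<close> is a split monomorphism in \<open>StMod(kG)\<close>.\<close>

definition splits_on_tensoring ::
  "('v, 'y) ring_scheme \<Rightarrow> ('g, 'z) monoid_scheme \<Rightarrow> ('v, 'g) rep \<Rightarrow>
    ('v, 'g) rep \<Rightarrow> ('v, 'g) rep \<Rightarrow> ('v \<Rightarrow> 'v) \<Rightarrow> bool"
  where "splits_on_tensoring K G w A B f \<longleftrightarrow> (\<exists>T \<alpha> U \<beta>. is_tensor K G w A T \<alpha> \<and> is_tensor K G w B U \<beta> \<and>
    (\<exists>F\<in>Hom K G T U. is_tensor_map w A \<alpha> \<beta> f F \<and>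
      (\<exists>r\<in>Hom K G U T. eq_mod (st_null K G) T T (r \<circ> F) id)))"

text \<open>A diagram \<open>X \<rightarrow> Y \<rightarrow> Z \<rightarrow> S\<close> together with the sequence \<open>X \<rightarrow> P \<rightarrow> S\<close> which makes \<open>S\<close>
  into \<open>X[1]\<close>.\<close>

record ('v, 'g) tri =
  obX :: "('v, 'g) rep"
  obY :: "('v, 'g) rep"
  obZ :: "('v, 'g) rep"
  obP :: "('v, 'g) rep"
  obS :: "('v, 'g) rep"
  morXY :: "'v \<Rightarrow> 'v"
  morYZ :: "'v \<Rightarrow> 'v"
  morZS :: "'v \<Rightarrow> 'v"
  inc :: "'v \<Rightarrow> 'v"
  quo :: "'v \<Rightarrow> 'v"

definition is_triangle ::
  "('v, 'y) ring_scheme \<Rightarrow> ('g, 'z) monoid_scheme \<Rightarrow> ('v, 'g) rep \<Rightarrow> ('v, 'g) tri \<Rightarrow> bool"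
  where "is_triangle K G w T \<longleftrightarrow>
    obX T \<in> kG_Mod K G \<and> obY T \<in> kG_Mod K G \<and> obZ T \<in> kG_Mod K G \<and>
    morXY T \<in> Hom K G (obX T) (obY T) \<and> morYZ T \<in> Hom K G (obY T) (obZ T) \<and>
    morZS T \<in> Hom K G (obZ T) (obS T) \<and>
    shift_model K G w (obX T) (obP T) (obS T) (inc T) (quo T)"

text \<open>\<open>d\<close> represents \<open>a[1]\<close> for \<open>a : obX T \<rightarrow> obX T'\<close>.\<close>

definition shift_map ::
  "('v, 'y) ring_scheme \<Rightarrow> ('g, 'z) monoid_scheme \<Rightarrow> ('v, 'g) tri \<Rightarrow> ('v, 'g) tri \<Rightarrow>
    ('v \<Rightarrow> 'v) \<Rightarrow> ('v \<Rightarrow> 'v) \<Rightarrow> bool"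
  where "shift_map K G T T' a d \<longleftrightarrow> d \<in> Hom K G (obS T) (obS T') \<and>
    (\<exists>e\<in>Hom K G (obP T) (obP T'). (\<forall>x\<in>carrier (obX T). e (inc T x) = inc T' (a x)) \<and>
      (\<forall>x\<in>carrier (obP T). d (quo T x) = quo T' (e x)))"

definition triangle_iso ::
  "('v, 'y) ring_scheme \<Rightarrow> ('g, 'z) monoid_scheme \<Rightarrow> ('v, 'g) rep \<Rightarrow> ('v, 'g) tri \<Rightarrow> ('v, 'g) tri \<Rightarrow> bool"
  where "triangle_iso K G w T T' \<longleftrightarrow> is_triangle K G w T \<and> is_triangle K G w T' \<and>
    (let I = stw_null K G w in \<exists>a b c d.
      is_iso K G I (obX T) (obX T') a \<and> is_iso K G I (obY T) (obY T') b \<and>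
      is_iso K G I (obZ T) (obZ T') c \<and> shift_map K G T T' a d \<and>
      eq_mod I (obX T) (obY T') (b \<circ> morXY T) (morXY T' \<circ> a) \<and>
      eq_mod I (obY T) (obZ T') (c \<circ> morYZ T) (morYZ T' \<circ> b) \<and>
      eq_mod I (obZ T) (obS T') (d \<circ> morZS T) (morZS T' \<circ> c))"

text \<open>The triangle in \<open>StMod\<^sub>w(kG)\<close> induced by a triangle of \<open>StMod(kG)\<close> (given by a short exact
  sequence) that splits on tensoring with \<open>w\<close>.  Its third map is the last component of a
  morphism, with first component the identity, from this sequence to \<open>X \<rightarrow> P \<rightarrow> S\<close>.\<close>

definition standard_triangle ::
  "('v, 'y) ring_scheme \<Rightarrow> ('g, 'z) monoid_scheme \<Rightarrow> ('v, 'g) rep \<Rightarrow> ('v, 'g) tri \<Rightarrow> bool"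
  where "standard_triangle K G w T \<longleftrightarrow> is_triangle K G w T \<and>
    ses K G (obX T) (obY T) (obZ T) (morXY T) (morYZ T) \<and>
    splits_on_tensoring K G w (obX T) (obY T) (morXY T) \<and>
    (\<exists>\<phi>\<in>Hom K G (obY T) (obP T). (\<forall>x\<in>carrier (obX T). \<phi> (morXY T x) = inc T x) \<and>
      (\<forall>y\<in>carrier (obY T). morZS T (morYZ T y) = quo T (\<phi> y)))"

definition dist_triangle ::
  "('v, 'y) ring_scheme \<Rightarrow> ('g, 'z) monoid_scheme \<Rightarrow> ('v, 'g) rep \<Rightarrow> ('v, 'g) tri \<Rightarrow> bool"
  where "dist_triangle K G w T \<longleftrightarrow> (\<exists>T0. standard_triangle K G w T0 \<and> triangle_iso K G w T0 T)"

text \<open>\<open>T'\<close> is \<open>M \<otimes> T\<close>.  As \<open>M \<otimes> (X \<rightarrow> P \<rightarrow> S)\<close> exhibits \<open>M \<otimes> S\<close> as \<open>(M \<otimes> X)[1]\<close>, it is part of the data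
  to be tensored.\<close>

definition is_tensor_triangle ::
  "('v, 'y) ring_scheme \<Rightarrow> ('g, 'z) monoid_scheme \<Rightarrow> ('v, 'g) rep \<Rightarrow> ('v, 'g) tri \<Rightarrow> ('v, 'g) tri \<Rightarrow> bool"
  where "is_tensor_triangle K G M T T' \<longleftrightarrow> (\<exists>\<beta>X \<beta>Y \<beta>Z \<beta>P \<beta>S.
    is_tensor K G M (obX T) (obX T') \<beta>X \<and> is_tensor K G M (obY T) (obY T') \<beta>Y \<and>
    is_tensor K G M (obZ T) (obZ T') \<beta>Z \<and> is_tensor K G M (obP T) (obP T') \<beta>P \<and>
    is_tensor K G M (obS T) (obS T') \<beta>S \<and>
    morXY T' \<in> Hom K G (obX T') (obY T') \<and> is_tensor_map M (obX T) \<beta>X \<beta>Y (morXY T) (morXY T') \<and>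
    morYZ T' \<in> Hom K G (obY T') (obZ T') \<and> is_tensor_map M (obY T) \<beta>Y \<beta>Z (morYZ T) (morYZ T') \<and>
    morZS T' \<in> Hom K G (obZ T') (obS T') \<and> is_tensor_map M (obZ T) \<beta>Z \<beta>S (morZS T) (morZS T') \<and>
    inc T' \<in> Hom K G (obX T') (obP T') \<and> is_tensor_map M (obX T) \<beta>X \<beta>P (inc T) (inc T') \<and>
    quo T' \<in> Hom K G (obP T') (obS T') \<and> is_tensor_map M (obP T) \<beta>P \<beta>S (quo T) (quo T'))"

subsection \<open>Thick and localizing subcategories\<close>

text \<open>Full triangulated subcategories, closed under isomorphism, of the full triangulated
  subcategory of \<open>StMod\<^sub>w(kG)\<close> with objects \<open>\<A>\<close>; here \<open>\<A>\<close> is \<open>kG_Mod K G\<close> for \<open>StMod\<^sub>w(kG)\<close>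
  itself, and \<open>fd_kG_Mod K G\<close> for \<open>stmod\<^sub>w(kG)\<close>.\<close>

definition triangulated_subcat ::
  "('v, 'y) ring_scheme \<Rightarrow> ('g, 'z) monoid_scheme \<Rightarrow> ('v, 'g) rep \<Rightarrow>
    ('v, 'g) rep set \<Rightarrow> ('v, 'g) rep set \<Rightarrow> bool"
  where "triangulated_subcat K G w \<A> S \<longleftrightarrow> S \<noteq> {} \<and> S \<subseteq> \<A> \<and>
    (\<forall>V\<in>S. \<forall>Y\<in>\<A>. isomorphic K G (stw_null K G w) V Y \<longrightarrow> Y \<in> S) \<and>
    (\<forall>A\<in>\<A>. \<forall>B\<in>\<A>. (\<exists>P \<iota> \<pi>. shift_model K G w A P B \<iota> \<pi>) \<longrightarrow> (A \<in> S \<longleftrightarrow> B \<in> S)) \<and>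
    (\<forall>T. dist_triangle K G w T \<and> obX T \<in> \<A> \<and> obY T \<in> \<A> \<and> obZ T \<in> \<A> \<longrightarrow>
      (obX T \<in> S \<and> obY T \<in> S \<longrightarrow> obZ T \<in> S) \<and>
      (obY T \<in> S \<and> obZ T \<in> S \<longrightarrow> obX T \<in> S) \<and>
      (obX T \<in> S \<and> obZ T \<in> S \<longrightarrow> obY T \<in> S))"

definition thick ::
  "('v, 'y) ring_scheme \<Rightarrow> ('g, 'z) monoid_scheme \<Rightarrow> ('v, 'g) rep \<Rightarrow>
    ('v, 'g) rep set \<Rightarrow> ('v, 'g) rep set \<Rightarrow> bool"
  where "thick K G w \<A> S \<longleftrightarrow> triangulated_subcat K G w \<A> S \<and>
    (\<forall>V\<in>S. \<forall>Y\<in>\<A>. \<forall>Z\<in>\<A>. is_biproduct K G (stw_null K G w) Y Z V \<longrightarrow> Y \<in> S)"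

definition localizing ::
  "('v, 'y) ring_scheme \<Rightarrow> ('g, 'z) monoid_scheme \<Rightarrow> ('v, 'g) rep \<Rightarrow> ('v, 'g) rep set \<Rightarrow> bool"
  where "localizing K G w S \<longleftrightarrow> triangulated_subcat K G w (kG_Mod K G) S \<and>
    (\<forall>J V Y i. (\<forall>j\<in>J. V j \<in> S) \<and> is_coproduct K G (stw_null K G w) J V Y i \<longrightarrow> Y \<in> S)"

definition localizing_closure ::
  "('v, 'y) ring_scheme \<Rightarrow> ('g, 'z) monoid_scheme \<Rightarrow> ('v, 'g) rep \<Rightarrow>
    ('v, 'g) rep set \<Rightarrow> ('v, 'g) rep set"
  where "localizing_closure K G w C = \<Inter>{S. localizing K G w S \<and> C \<subseteq> S}"

definition tensor_closed ::
  "('v, 'y) ring_scheme \<Rightarrow> ('g, 'z) monoid_scheme \<Rightarrow> ('v, 'g) rep set \<Rightarrow> bool"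
  where "tensor_closed K G S \<longleftrightarrow>
    (\<forall>x\<in>S. \<forall>y\<in>fd_kG_Mod K G. \<forall>T \<beta>. is_tensor K G x y T \<beta> \<longrightarrow> T \<in> S)"

definition bousfield_triangle ::
  "('v, 'y) ring_scheme \<Rightarrow> ('g, 'z) monoid_scheme \<Rightarrow> ('v, 'g) rep \<Rightarrow>
    ('v, 'g) rep set \<Rightarrow> ('v, 'g) rep \<Rightarrow> ('v, 'g) tri \<Rightarrow> bool"
  where "bousfield_triangle K G w L M T \<longleftrightarrow> dist_triangle K G w T \<and> obY T = M \<and>
    obX T \<in> L \<and> obZ T \<in> right_orth K G (stw_null K G w) L"

end

theory Submission
  imports Defs
begin

text \<open>Apply the hypothesis to \<open>L' = stmod\<^sub>w(kG)\<close>, which is thick and tensor closed. As \<open>k\<close> lies in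
  \<open>L\<close>, the identity triangle \<open>k \<rightarrow> k \<rightarrow> 0 \<leadsto>\<close> is a Bousfield triangle of \<open>k\<close>. Tensoring it with \<open>M\<close>
  shows that \<open>M\<^sub>L\<close> is isomorphic to \<open>M \<otimes> k\<close>, hence to \<open>M\<close>, and therefore \<open>M\<close> lies in \<open>L\<close>.

  The work lies in exhibiting the shift of \<open>k\<close> inside the universe \<open>'v\<close>, that is, an embedding of
  \<open>k\<close> into some \<open>P\<close> whose quotient map is a right \<open>\<P>(w)\<close>-approximation. If \<open>w \<noteq> 0\<close> take
  \<open>P = End(w)\<close>, which is \<open>w \<otimes> w\<^sup>*\<close>, with \<open>k\<close> embedded as the scalars: maps from \<open>w \<otimes> Y\<close> to the
  quotient lift because a lift can be normalised by a trace condition. If \<open>w = 0\<close> take for \<open>P\<close> the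
  functions on \<open>G\<close>, which form a projective module. Both function spaces embed into
  \<open>'v\<close> because an algebraically closed field is infinite.\<close>

section \<open>Linear maps and homomorphisms\<close>

text \<open>Why End(w) approximates: maps from w \<otimes> Y lift through P \<rightarrow> P/k as
  soon as k \<rightarrow> P becomes split injective after tensoring with the dual of w. The
  splitting contracts the argument u of h(u \<otimes> y), not that of the endomorphism: if h(u
  \<otimes> y) is the scalar \<lambda>(u), then u \<mapsto> \<lambda>(u) v has trace \<lambda>(v).
  The trace of the identity itself would be dim w, which may vanish in characteristic p. The lifts
  exist already in Mod(kG), and no averaging over G occurs. The second obstacle is that all objects
  live in \<open>'v\<close>. Cosets do not, so P/k is modelled as a hyperplane of P with a corrected
  action. Tensor products are not constructed in general either: End(w) is shown to have the
  universal property of w tensored with its dual. The hypothesis speaks about Bousfield triangles of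
  k as records that carry their own shift sequence, so it yields nothing until one such sequence has
  been exhibited.\<close>

lemma lin_mapsI:
  assumes "\<And>x. x \<in> carrier M \<Longrightarrow> f x \<in> carrier N"
    and "\<And>x y. \<lbrakk>x \<in> carrier M; y \<in> carrier M\<rbrakk> \<Longrightarrow> f (x \<oplus>\<^bsub>M\<^esub> y) = f x \<oplus>\<^bsub>N\<^esub> f y"
    and "\<And>c x. \<lbrakk>c \<in> carrier K; x \<in> carrier M\<rbrakk> \<Longrightarrow> f (c \<odot>\<^bsub>M\<^esub> x) = c \<odot>\<^bsub>N\<^esub> f x"
  shows "f \<in> lin_maps K M N"
  using assms by (auto simp: lin_maps_def)

lemma lin_mapsD:
  assumes "f \<in> lin_maps K M N"
  shows lin_maps_closed: "x \<in> carrier M \<Longrightarrow> f x \<in> carrier N"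
    and lin_maps_add: "\<lbrakk>x \<in> carrier M; y \<in> carrier M\<rbrakk> \<Longrightarrow> f (x \<oplus>\<^bsub>M\<^esub> y) = f x \<oplus>\<^bsub>N\<^esub> f y"
    and lin_maps_smult: "\<lbrakk>c \<in> carrier K; x \<in> carrier M\<rbrakk> \<Longrightarrow> f (c \<odot>\<^bsub>M\<^esub> x) = c \<odot>\<^bsub>N\<^esub> f x"
  using assms by (auto simp: lin_maps_def)

lemma HomI:
  assumes "f \<in> lin_maps K M N"
    and "\<And>g x. \<lbrakk>g \<in> carrier G; x \<in> carrier M\<rbrakk> \<Longrightarrow> f (act M g x) = act N g (f x)"
  shows "f \<in> Hom K G M N"
  using assms by (auto simp: Hom_def)

lemma HomD:
  assumes "f \<in> Hom K G M N"
  shows Hom_lin: "f \<in> lin_maps K M N"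
    and Hom_act: "\<lbrakk>g \<in> carrier G; x \<in> carrier M\<rbrakk> \<Longrightarrow> f (act M g x) = act N g (f x)"
  using assms by (auto simp: Hom_def)

lemma id_Hom: "id \<in> Hom K G M M"
  by (auto simp: Hom_def lin_maps_def)

lemma lin_maps_comp: "\<lbrakk>f \<in> lin_maps K L M; g \<in> lin_maps K M N\<rbrakk> \<Longrightarrow> (\<lambda>x. g (f x)) \<in> lin_maps K L N"
  by (auto simp: lin_maps_def Pi_iff)

lemma Hom_comp: "\<lbrakk>f \<in> Hom K G L M; g \<in> Hom K G M N\<rbrakk> \<Longrightarrow> (\<lambda>x. g (f x)) \<in> Hom K G L N"
  by (auto simp: Hom_def lin_maps_def Pi_iff)

lemma lin_maps_zero_eq:
  assumes "module K M" and "module K N" and "f \<in> lin_maps K M N"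
  shows "f \<zero>\<^bsub>M\<^esub> = \<zero>\<^bsub>N\<^esub>"
proof -
  interpret M: module K M by fact
  interpret N: module K N by fact
  have "f (\<zero>\<^bsub>K\<^esub> \<odot>\<^bsub>M\<^esub> \<zero>\<^bsub>M\<^esub>) = \<zero>\<^bsub>K\<^esub> \<odot>\<^bsub>N\<^esub> f \<zero>\<^bsub>M\<^esub>"
    by (rule lin_maps_smult[OF assms(3)]) simp_all
  then show ?thesis
    using lin_maps_closed[OF assms(3)] by simp
qed

lemma lin_maps_finsum:
  assumes "module K M" and "module K N" and "f \<in> lin_maps K M N"
    and "finite A" and "h \<in> A \<rightarrow> carrier M"
  shows "f (\<Oplus>\<^bsub>M\<^esub>a\<in>A. h a) = (\<Oplus>\<^bsub>N\<^esub>a\<in>A. f (h a))"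
proof -
  interpret M: module K M by fact
  interpret N: module K N by fact
  show ?thesis
    using assms(4,5)
  proof (induction A rule: finite_induct)
    case empty
    show ?case using lin_maps_zero_eq[OF assms(1-3)] by simp
  next
    case (insert a A)
    then have "h a \<in> carrier M" "h \<in> A \<rightarrow> carrier M" by auto
    moreover from this have "f (h a) \<in> carrier N" "(\<lambda>a. f (h a)) \<in> A \<rightarrow> carrier N"
      using lin_maps_closed[OF assms(3)] by auto
    ultimately show ?case
      using insert lin_maps_add[OF assms(3)] by simp
  qed
qed

lemma (in module) finsum_in_submodule:
  assumes "\<zero>\<^bsub>M\<^esub> \<in> H" and "\<And>x y. \<lbrakk>x \<in> H; y \<in> H\<rbrakk> \<Longrightarrow> x \<oplus>\<^bsub>M\<^esub> y \<in> H" and "H \<subseteq> carrier M"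
    and "finite A" and "h \<in> A \<rightarrow> H"
  shows "(\<Oplus>\<^bsub>M\<^esub>a\<in>A. h a) \<in> H"
  using assms(4,5)
proof (induction A rule: finite_induct)
  case (insert a A)
  then have "h a \<in> carrier M" "h \<in> A \<rightarrow> carrier M" using assms(3) by auto
  then show ?case using insert assms(2) by simp
qed (simp add: assms(1))

section \<open>Tensor products through their universal property\<close>

text \<open>The module axioms see only these four fields. This moves them between record types: from
  a \<open>rep\<close> to its truncation, and to a module whose \<open>act\<close> field has been
  replaced.\<close>

lemma module_cong:
  assumes "module K M"
    and eq: "carrier N = carrier M" "\<zero>\<^bsub>N\<^esub> = \<zero>\<^bsub>M\<^esub>" "add N = add M" "smult N = smult M"
  shows "module K N"
proof -
  interpret M: module K M by fact
  show ?thesis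
  proof (intro moduleI abelian_groupI)
    show "\<exists>y\<in>carrier N. y \<oplus>\<^bsub>N\<^esub> x = \<zero>\<^bsub>N\<^esub>" if "x \<in> carrier N" for x
      using that by (auto simp: eq intro!: bexI[of _ "\<ominus>\<^bsub>M\<^esub> x"] M.M.l_neg)
  qed (auto simp: eq M.R.is_cring M.M.a_ac M.smult_l_distr M.smult_r_distr M.smult_assoc1)
qed

lemma module_truncate: "module K M \<Longrightarrow> module K (module.truncate M)"
  by (erule module_cong) (simp_all add: module.truncate_def)

lemma lin_maps_truncate: "lin_maps K L (module.truncate M) = lin_maps K L M"
  by (simp add: lin_maps_def module.truncate_def)

lemma bilinear_truncate: "bilinear K L M (module.truncate N) b = bilinear K L M N b"
  unfolding bilinear_def lin_maps_def by (simp add: module.truncate_def)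

text \<open>The universal property in \<open>is_tensor\<close> quantifies over bare
  \<open>module\<close> records. A target with further fields, such as a \<open>rep\<close>, is
  truncated first, which linear and bilinear maps do not notice.\<close>

lemma is_tensor_lift:
  assumes "is_tensor K G M N T \<beta>" and "module K U" and "bilinear K M N U b"
  obtains h where "h \<in> lin_maps K T U" "\<And>x y. \<lbrakk>x \<in> carrier M; y \<in> carrier N\<rbrakk> \<Longrightarrow> h (\<beta> x y) = b x y"
proof -
  have "\<exists>h\<in>lin_maps K T (module.truncate U). \<forall>x\<in>carrier M. \<forall>y\<in>carrier N. h (\<beta> x y) = b x y"
    using assms module_truncate[of K U] unfolding is_tensor_def by (simp add: bilinear_truncate)
  then show ?thesis using that by (auto simp: lin_maps_truncate)
qed

lemma is_tensor_unique:
  assumes "is_tensor K G M N T \<beta>" and "module K U" and "h \<in> lin_maps K T U" and "h' \<in> lin_maps K T U"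
    and "\<And>x y. \<lbrakk>x \<in> carrier M; y \<in> carrier N\<rbrakk> \<Longrightarrow> h (\<beta> x y) = h' (\<beta> x y)"
    and "t \<in> carrier T"
  shows "h t = h' t"
proof -
  \<comment> \<open>Uniqueness in \<open>is_tensor\<close> is guarded by the presence of a bilinear
    map into the target; \<open>h\<close> composed with \<beta> serves as one.\<close>
  have b: "bilinear K M N U (\<lambda>x y. h (\<beta> x y))"
    using assms(1,3) unfolding is_tensor_def bilinear_def
    by (auto intro: lin_maps_comp)
  have "\<forall>h\<in>lin_maps K T (module.truncate U). \<forall>h'\<in>lin_maps K T (module.truncate U).
      (\<forall>x\<in>carrier M. \<forall>y\<in>carrier N. h (\<beta> x y) = h' (\<beta> x y)) \<longrightarrow> (\<forall>t\<in>carrier T. h t = h' t)"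
    using assms(1) module_truncate[OF assms(2)] b unfolding is_tensor_def bilinear_truncate[symmetric, of K M N U] by blast
  then show ?thesis using assms(3-) by (simp add: lin_maps_truncate)
qed

lemma is_tensorD:
  assumes "is_tensor K G M N T \<beta>"
  shows is_tensor_module: "T \<in> kG_Mod K G"
    and is_tensor_bilinear: "bilinear K M N T \<beta>"
    and is_tensor_act: "\<lbrakk>g \<in> carrier G; x \<in> carrier M; y \<in> carrier N\<rbrakk> \<Longrightarrow>
      act T g (\<beta> x y) = \<beta> (act M g x) (act N g y)"
  using assms by (auto simp: is_tensor_def)

lemma bilinearD:
  assumes "bilinear K M N U b"
  shows bilinear_lin1: "y \<in> carrier N \<Longrightarrow> (\<lambda>x. b x y) \<in> lin_maps K M U"
    and bilinear_lin2: "x \<in> carrier M \<Longrightarrow> b x \<in> lin_maps K N U"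
  using assms by (auto simp: bilinear_def)

lemma kG_ModD:
  assumes "M \<in> kG_Mod K G"
  shows kG_Mod_module: "module K M"
    and act_lin: "g \<in> carrier G \<Longrightarrow> act M g \<in> lin_maps K M M"
    and act_one: "x \<in> carrier M \<Longrightarrow> act M \<one>\<^bsub>G\<^esub> x = x"
    and act_mult: "\<lbrakk>g \<in> carrier G; h \<in> carrier G; x \<in> carrier M\<rbrakk> \<Longrightarrow>
      act M (g \<otimes>\<^bsub>G\<^esub> h) x = act M g (act M h x)"
  using assms by (auto simp: kG_Mod_def)

section \<open>Infinite carriers and the coding of functions\<close>

text \<open>The map x \<mapsto> x^2 + x takes 0 and -1 to the same value. On a finite carrier it is
  then not surjective, and for a missed value c the polynomial X^2 + X - c has no root. Squaring
  alone would fail in characteristic 2, where it is injective.\<close>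

lemma (in algebraically_closed) infinite_carrier: "infinite (carrier L)"
proof
  assume fin: "finite (carrier L)"
  let ?f = "\<lambda>x. x \<otimes>\<^bsub>L\<^esub> x \<oplus>\<^bsub>L\<^esub> x"
  have img: "?f ` carrier L \<subseteq> carrier L" by auto
  have "?f \<zero>\<^bsub>L\<^esub> = ?f (\<ominus>\<^bsub>L\<^esub> \<one>\<^bsub>L\<^esub>)" by (simp add: l_minus r_neg)
  moreover have "\<zero>\<^bsub>L\<^esub> \<noteq> \<ominus>\<^bsub>L\<^esub> \<one>\<^bsub>L\<^esub>"
    by (metis minus_equality minus_zero one_closed one_not_zero r_neg r_zero zero_closed)
  ultimately have "\<not> inj_on ?f (carrier L)"
    by (meson a_inv_closed inj_onD one_closed zero_closed)
  then have "?f ` carrier L \<noteq> carrier L"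
    using fin eq_card_imp_inj_on by metis
  then obtain c where c: "c \<in> carrier L" "c \<notin> ?f ` carrier L" using img by blast
  let ?p = "[\<one>\<^bsub>L\<^esub>, \<one>\<^bsub>L\<^esub>, \<ominus>\<^bsub>L\<^esub> c]"
  have p: "?p \<in> carrier (poly_ring L)"
    using c(1) by (simp add: sym[OF univ_poly_carrier] polynomial_def)
  have "size (roots ?p) = 2"
    using roots_over_carrier[OF p] by (simp add: splitted_def)
  then have "roots ?p \<noteq> {#}" by auto
  then obtain a where "a \<in># roots ?p" by blast
  then have "is_root ?p a" using roots_mem_iff_is_root[OF p] by simp
  then have a: "a \<in> carrier L" "eval ?p a = \<zero>\<^bsub>L\<^esub>" by (auto simp: is_root_def)
  then have "?f a \<ominus>\<^bsub>L\<^esub> c = \<zero>\<^bsub>L\<^esub>"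
    using c(1) by (simp add: numeral_2_eq_2 a_minus_def a_assoc)
  then have "?f a = c" using a(1) c(1) by (simp add: r_right_minus_eq)
  then show False using a(1) c(2) by auto
qed

text \<open>An infinite set is equinumerous with its square, so one argument after another can be
  absorbed by pairing. The induction carries the stronger claim that the codes lie in
  \<open>A\<close>, which allows them to be paired again.\<close>

lemma embed_funcset:
  assumes "infinite A" and "finite D"
  obtains e :: "('d \<Rightarrow> 'v) \<Rightarrow> 'v" where "inj_on e (D \<rightarrow>\<^sub>E A)"
proof -
  obtain pr where pr: "bij_betw pr (A \<times> A) A"
    using card_of_Times_same_infinite[OF assms(1)] card_of_ordIso by blast
  have "\<exists>e. inj_on e (D \<rightarrow>\<^sub>E A) \<and> e ` (D \<rightarrow>\<^sub>E A) \<subseteq> A"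
    using assms(2)
  proof (induction D rule: finite_induct)
    case empty
    obtain a where "a \<in> A" using assms(1) by fastforce
    then show ?case by (intro exI[of _ "\<lambda>_. a"]) auto
  next
    case (insert d D)
    then obtain e where e: "inj_on e (D \<rightarrow>\<^sub>E A)" "e ` (D \<rightarrow>\<^sub>E A) \<subseteq> A" by blast
    let ?e = "\<lambda>F. pr (F d, e (restrict F D))"
    have mem: "F d \<in> A" "restrict F D \<in> D \<rightarrow>\<^sub>E A" "e (restrict F D) \<in> A"
      if "F \<in> insert d D \<rightarrow>\<^sub>E A" for F
    proof -
      show "F d \<in> A" and 1: "restrict F D \<in> D \<rightarrow>\<^sub>E A" using that by auto
      show "e (restrict F D) \<in> A" using 1 e(2) by blast
    qed
    have "inj_on ?e (insert d D \<rightarrow>\<^sub>E A)"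
    proof (rule inj_onI)
      fix F F' assume F: "F \<in> insert d D \<rightarrow>\<^sub>E A" "F' \<in> insert d D \<rightarrow>\<^sub>E A" and eq: "?e F = ?e F'"
      then have "(F d, e (restrict F D)) = (F' d, e (restrict F' D))"
        using pr mem[OF F(1)] mem[OF F(2)] unfolding bij_betw_def by (auto dest!: inj_onD)
      then have *: "F d = F' d" "restrict F D = restrict F' D"
        using inj_onD[OF e(1) _ mem(2)[OF F(1)] mem(2)[OF F(2)]] by auto
      then show "F = F'"
        using F by (intro PiE_ext[OF F]) (metis insert_iff restrict_apply')
    qed
    moreover have "?e ` (insert d D \<rightarrow>\<^sub>E A) \<subseteq> A"
    proof (rule image_subsetI)
      fix F assume "F \<in> insert d D \<rightarrow>\<^sub>E A"
      from mem[OF this] show "?e F \<in> A"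
        using bij_betwE[OF pr] by auto
    qed
    ultimately show ?case by (intro exI[of _ ?e]) blast
  qed
  then show ?thesis using that by blast
qed

section \<open>The relatively stable category\<close>

locale kG_modules = K: algebraically_closed K + G: group G
  for K :: "('v, 'y) ring_scheme" and G :: "('g, 'z) monoid_scheme"
begin

abbreviation unit_rep :: "('v, 'g) rep"
  where "unit_rep \<equiv> trivial_module K"

definition zero_rep :: "('v, 'g) rep"
  where "zero_rep = unit_rep\<lparr>carrier := {\<zero>\<^bsub>K\<^esub>}\<rparr>"

lemma act_closed: "\<lbrakk>M \<in> kG_Mod K G; g \<in> carrier G; x \<in> carrier M\<rbrakk> \<Longrightarrow> act M g x \<in> carrier M"
  by (meson act_lin lin_maps_closed)

lemma act_inv:
  assumes "M \<in> kG_Mod K G" and "g \<in> carrier G" and "x \<in> carrier M"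
  shows "act M g (act M (inv\<^bsub>G\<^esub> g) x) = x" and "act M (inv\<^bsub>G\<^esub> g) (act M g x) = x"
  using act_mult[OF assms(1), of g "inv\<^bsub>G\<^esub> g" x] act_mult[OF assms(1), of "inv\<^bsub>G\<^esub> g" g x]
    act_one[OF assms(1)] assms by simp_all

lemma unit_rep_simps [simp]:
  "carrier unit_rep = carrier K" "\<zero>\<^bsub>unit_rep\<^esub> = \<zero>\<^bsub>K\<^esub>" "add unit_rep = add K"
  "smult unit_rep = monoid.mult K" "act unit_rep g = (\<lambda>x. x)"
  by (simp_all add: trivial_module_def)

lemma zero_rep_simps [simp]:
  "carrier zero_rep = {\<zero>\<^bsub>K\<^esub>}" "\<zero>\<^bsub>zero_rep\<^esub> = \<zero>\<^bsub>K\<^esub>" "add zero_rep = add K"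
  "smult zero_rep = monoid.mult K" "act zero_rep g = (\<lambda>x. x)"
  by (simp_all add: zero_rep_def)

lemma module_unit_rep: "module K unit_rep"
proof (intro moduleI abelian_groupI)
  show "\<exists>y\<in>carrier unit_rep. y \<oplus>\<^bsub>unit_rep\<^esub> x = \<zero>\<^bsub>unit_rep\<^esub>" if "x \<in> carrier unit_rep" for x
    using that by (auto intro!: bexI[of _ "\<ominus>\<^bsub>K\<^esub> x"] K.l_neg)
qed (auto simp: K.is_cring K.a_ac K.l_distr K.r_distr K.m_assoc)

lemma unit_rep: "unit_rep \<in> kG_Mod K G"
  using module_unit_rep by (auto simp: kG_Mod_def intro: lin_mapsI)

lemma unit_rep_fd: "unit_rep \<in> fd_kG_Mod K G"
proof -
  interpret k: module K unit_rep by (rule module_unit_rep)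
  have "\<exists>c\<in>{\<one>\<^bsub>K\<^esub>} \<rightarrow> carrier K. x = (\<Oplus>\<^bsub>unit_rep\<^esub>s\<in>{\<one>\<^bsub>K\<^esub>}. c s \<odot>\<^bsub>unit_rep\<^esub> s)" if "x \<in> carrier K" for x
    using that by (intro bexI[of _ "\<lambda>_. x"]) auto
  then show ?thesis
    unfolding fd_kG_Mod_def fin_dim_def using unit_rep
    by (auto intro!: exI[of _ "{\<one>\<^bsub>K\<^esub>}"])
qed

lemma zero_rep: "zero_rep \<in> kG_Mod K G"
proof -
  have "module K zero_rep"
    by (intro moduleI abelian_groupI) (auto simp: K.is_cring)
  then show ?thesis by (auto simp: kG_Mod_def intro: lin_mapsI)
qed

lemma zero_Hom:
  assumes "M \<in> kG_Mod K G" and "N \<in> kG_Mod K G"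
  shows "(\<lambda>_. \<zero>\<^bsub>N\<^esub>) \<in> Hom K G M N"
proof -
  interpret N: module K N using assms(2) by (rule kG_Mod_module)
  show ?thesis
    using lin_maps_zero_eq[OF kG_Mod_module[OF assms(2)] kG_Mod_module[OF assms(2)] act_lin[OF assms(2)]]
    by (auto intro!: HomI lin_mapsI)
qed

lemma Hom_zero_eq:
  assumes "M \<in> kG_Mod K G" and "N \<in> kG_Mod K G" and "f \<in> Hom K G M N"
  shows "f \<zero>\<^bsub>M\<^esub> = \<zero>\<^bsub>N\<^esub>"
  using assms by (meson Hom_lin kG_Mod_module lin_maps_zero_eq)

lemma projective_zero_rep: "projective K G zero_rep"
proof -
  have "\<exists>f'\<in>Hom K G zero_rep V. \<forall>x\<in>carrier zero_rep. q (f' x) = f x"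
    if "V \<in> kG_Mod K G" "Y \<in> kG_Mod K G" "q \<in> Hom K G V Y" "f \<in> Hom K G zero_rep Y" for V Y q f
    using Hom_zero_eq[OF that(1-3)] Hom_zero_eq[OF zero_rep that(2,4)] zero_Hom[OF zero_rep that(1)]
    by (intro bexI[of _ "\<lambda>_. \<zero>\<^bsub>V\<^esub>"]) auto
  then show ?thesis using zero_rep by (auto simp: projective_def)
qed

lemma st_null_zero:
  assumes "V \<in> kG_Mod K G" and "Y \<in> kG_Mod K G" and "\<And>x. x \<in> carrier V \<Longrightarrow> f x = \<zero>\<^bsub>Y\<^esub>"
  shows "st_null K G V Y f"
  unfolding st_null_def
  using projective_zero_rep zero_Hom[OF assms(1) zero_rep] zero_Hom[OF zero_rep assms(2)] assms(3)
  by (intro exI[of _ zero_rep] exI[of _ "\<lambda>_. \<zero>\<^bsub>zero_rep\<^esub>"] exI[of _ "\<lambda>_. \<zero>\<^bsub>Y\<^esub>"]) auto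

lemma minus_self:
  assumes "Y \<in> kG_Mod K G" and "x \<in> carrier Y"
  shows "x \<ominus>\<^bsub>Y\<^esub> x = \<zero>\<^bsub>Y\<^esub>"
proof -
  interpret Y: module K Y using assms(1) by (rule kG_Mod_module)
  show ?thesis using assms(2) by (simp add: Y.M.minus_eq Y.M.r_neg)
qed

lemma eq_mod_st_refl:
  assumes "V \<in> kG_Mod K G" and "Y \<in> kG_Mod K G"
    and "\<And>x. x \<in> carrier V \<Longrightarrow> g x \<in> carrier Y" and "\<And>x. x \<in> carrier V \<Longrightarrow> f x = g x"
  shows "eq_mod (st_null K G) V Y f g"
  unfolding eq_mod_def using assms by (auto intro!: st_null_zero minus_self)

lemma eq_mod_mod_null_refl:
  assumes "Y \<in> kG_Mod K G"
    and "\<And>x. x \<in> carrier V \<Longrightarrow> g x \<in> carrier Y" and "\<And>x. x \<in> carrier V \<Longrightarrow> f x = g x"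
  shows "eq_mod mod_null V Y f g"
  unfolding eq_mod_def mod_null_def using assms by (auto intro!: minus_self)

lemma biproduct_zero_rep:
  assumes "V \<in> kG_Mod K G"
  shows "is_biproduct K G mod_null V zero_rep V"
proof -
  interpret V: module K V using assms by (rule kG_Mod_module)
  show ?thesis
    unfolding is_biproduct_def
    using assms zero_rep zero_Hom[OF assms zero_rep] zero_Hom[OF zero_rep assms]
    by (intro conjI bexI[of _ "id :: 'v \<Rightarrow> 'v" "Hom K G V V"] bexI[of _ "\<lambda>_. \<zero>\<^bsub>V\<^esub>" "Hom K G zero_rep V"]
        bexI[of _ "\<lambda>_. \<zero>\<^bsub>zero_rep\<^esub>" "Hom K G V zero_rep"] eq_mod_mod_null_refl id_Hom)
      (auto simp: mod_null_def)
qed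

text \<open>This puts the zero module into P(w) for every w, so that maps vanishing on the nose
  factor through P(w).\<close>

lemma is_tensor_zero_rep:
  assumes "w \<in> kG_Mod K G"
  shows "is_tensor K G w zero_rep zero_rep (\<lambda>_ _. \<zero>\<^bsub>K\<^esub>)"
proof -
  interpret z: module K zero_rep using zero_rep by (rule kG_Mod_module)
  show ?thesis
    unfolding is_tensor_def
  proof (intro conjI allI impI ballI)
    show "bilinear K w zero_rep zero_rep (\<lambda>_ _. \<zero>\<^bsub>K\<^esub>)"
      by (auto simp: bilinear_def intro!: lin_mapsI)
  next
    fix U :: "('v, 'v) module" and b assume U: "module K U \<and> bilinear K w zero_rep U b"
    then interpret U: module K U by simp
    have "b x \<zero>\<^bsub>K\<^esub> = \<zero>\<^bsub>U\<^esub>" if "x \<in> carrier w" for x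
      using lin_maps_zero_eq[OF z.module_axioms U.module_axioms bilinear_lin2, of w b x] U that by simp
    then show "\<exists>h\<in>lin_maps K zero_rep U. \<forall>x\<in>carrier w. \<forall>y\<in>carrier zero_rep. h \<zero>\<^bsub>K\<^esub> = b x y"
      by (intro bexI[of _ "\<lambda>_. \<zero>\<^bsub>U\<^esub>"]) (auto intro!: lin_mapsI)
  next
    fix U :: "('v, 'v) module" and b h h' t
    assume U: "module K U \<and> bilinear K w zero_rep U b"
      and h: "h \<in> lin_maps K zero_rep U" "h' \<in> lin_maps K zero_rep U" "t \<in> carrier zero_rep"
    then interpret U: module K U by simp
    show "h t = h' t"
      using lin_maps_zero_eq[OF z.module_axioms U.module_axioms h(1)]
        lin_maps_zero_eq[OF z.module_axioms U.module_axioms h(2)] h(3) by simp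
  qed (use zero_rep in auto)
qed

lemma tensor_mem_Pcls:
  assumes "is_tensor K G w Y T \<beta>" and "Y \<in> kG_Mod K G"
  shows "T \<in> Pcls K G w"
proof -
  have T: "T \<in> kG_Mod K G" using assms(1) by (rule is_tensor_module)
  then show ?thesis unfolding Pcls_def using biproduct_zero_rep[OF T] assms by blast
qed

lemma zero_rep_Pcls: "w \<in> kG_Mod K G \<Longrightarrow> zero_rep \<in> Pcls K G w"
  using is_tensor_zero_rep zero_rep by (rule tensor_mem_Pcls)

lemma stw_null_zero:
  assumes "w \<in> kG_Mod K G" and "V \<in> kG_Mod K G" and "Y \<in> kG_Mod K G"
    and "\<And>x. x \<in> carrier V \<Longrightarrow> f x = \<zero>\<^bsub>Y\<^esub>"
  shows "stw_null K G w V Y f"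
proof -
  interpret Y: module K Y using assms(3) by (rule kG_Mod_module)
  have "eq_mod (st_null K G) V Y f ((\<lambda>_. \<zero>\<^bsub>Y\<^esub>) \<circ> (\<lambda>_. \<zero>\<^bsub>zero_rep\<^esub>))"
    using assms by (intro eq_mod_st_refl) auto
  then show ?thesis
    unfolding stw_null_def
    using zero_rep_Pcls[OF assms(1)] zero_Hom[OF assms(2) zero_rep] zero_Hom[OF zero_rep assms(3)] by blast
qed

text \<open>Every equality in the relatively stable category that has to be proved comes from an
  equality of module homomorphisms, so this is the only route to one.\<close>

lemma eq_mod_stw_refl:
  assumes "w \<in> kG_Mod K G" and "V \<in> kG_Mod K G" and "Y \<in> kG_Mod K G"
    and "\<And>x. x \<in> carrier V \<Longrightarrow> g x \<in> carrier Y" and "\<And>x. x \<in> carrier V \<Longrightarrow> f x = g x"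
  shows "eq_mod (stw_null K G w) V Y f g"
  unfolding eq_mod_def using assms by (auto intro!: stw_null_zero minus_self)

lemma is_iso_id_stw:
  assumes "w \<in> kG_Mod K G" and "V \<in> kG_Mod K G"
  shows "is_iso K G (stw_null K G w) V V id"
  unfolding is_iso_def using assms id_Hom by (auto intro!: bexI[of _ id] eq_mod_stw_refl)

lemma isomorphic_stwI:
  assumes "w \<in> kG_Mod K G" and V: "V \<in> kG_Mod K G" and Y: "Y \<in> kG_Mod K G"
    and f: "f \<in> Hom K G V Y" and g: "g \<in> Hom K G Y V"
    and "\<And>x. x \<in> carrier V \<Longrightarrow> g (f x) = x" and "\<And>y. y \<in> carrier Y \<Longrightarrow> f (g y) = y"
  shows "isomorphic K G (stw_null K G w) V Y"
  unfolding isomorphic_def is_iso_def using assms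
  by (auto intro!: exI[of _ f] bexI[of _ g] eq_mod_stw_refl)

section \<open>The trivial module as tensor unit\<close>

text \<open>Linearity in the second argument forces the lift of \<open>b\<close> to be its value at
  the scalar 1. The lemma serves twice: to compare any model of M \<otimes> k with \<open>M\<close>,
  and to let \<open>w\<close> be its own model of w \<otimes> k.\<close>

lemma is_tensor_unit_rep:
  assumes M: "M \<in> kG_Mod K G"
  shows "is_tensor K G M unit_rep M (\<lambda>x c. c \<odot>\<^bsub>M\<^esub> x)"
proof -
  interpret M: module K M using M by (rule kG_Mod_module)
  show ?thesis
    unfolding is_tensor_def
  proof (intro conjI allI impI ballI)
    have "c \<odot>\<^bsub>M\<^esub> (d \<odot>\<^bsub>M\<^esub> x) = d \<odot>\<^bsub>M\<^esub> (c \<odot>\<^bsub>M\<^esub> x)"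
      if "c \<in> carrier K" "d \<in> carrier K" "x \<in> carrier M" for c d x
      using that by (metis K.m_comm M.smult_assoc1)
    then show "bilinear K M unit_rep M (\<lambda>x c. c \<odot>\<^bsub>M\<^esub> x)"
      by (auto simp: bilinear_def M.smult_l_distr M.smult_r_distr M.smult_assoc1 intro!: lin_mapsI)
    show "act M g (c \<odot>\<^bsub>M\<^esub> x) = act unit_rep g c \<odot>\<^bsub>M\<^esub> act M g x"
      if "g \<in> carrier G" "x \<in> carrier M" "c \<in> carrier unit_rep" for g x c
      using lin_maps_smult[OF act_lin[OF M that(1)]] that by simp
  next
    fix U :: "('v, 'v) module" and b assume U: "module K U \<and> bilinear K M unit_rep U b"
    have eq: "c \<odot>\<^bsub>U\<^esub> b x \<one>\<^bsub>K\<^esub> = b x c" if "x \<in> carrier M" "c \<in> carrier K" for x c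
      using lin_maps_smult[OF bilinear_lin2[of K M unit_rep U b x], of c "\<one>\<^bsub>K\<^esub>"] U that by simp
    have lin: "(\<lambda>x. b x \<one>\<^bsub>K\<^esub>) \<in> lin_maps K M U"
      using U by (intro bilinear_lin1) auto
    then show "\<exists>h\<in>lin_maps K M U. \<forall>x\<in>carrier M. \<forall>c\<in>carrier unit_rep. h (c \<odot>\<^bsub>M\<^esub> x) = b x c"
      using eq lin_maps_smult[OF lin] by (intro bexI[of _ "\<lambda>x. b x \<one>\<^bsub>K\<^esub>"]) auto
  next
    fix U :: "('v, 'v) module" and b h h' t
    assume "\<forall>x\<in>carrier M. \<forall>c\<in>carrier unit_rep. h (c \<odot>\<^bsub>M\<^esub> x) = h' (c \<odot>\<^bsub>M\<^esub> x)" "t \<in> carrier M"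
    then show "h t = h' t"
      by (metis K.one_closed M.smult_one unit_rep_simps(1))
  qed (use M in auto)
qed

text \<open>\<open>T\<close> and \<open>M\<close> represent the same bilinear maps, which yields
  mutually inverse linear maps \<open>h\<close> and \<open>h'\<close>. The isomorphism is one of
  modules, stated in the weaker form in which it is combined with a triangle isomorphism.\<close>

lemma tensor_unit_rep_isomorphic:
  assumes w: "w \<in> kG_Mod K G" and M: "M \<in> kG_Mod K G" and T: "is_tensor K G M unit_rep T \<beta>"
  shows "isomorphic K G (stw_null K G w) T M"
proof -
  let ?b = "\<lambda>x c. c \<odot>\<^bsub>M\<^esub> x"
  note M' = is_tensor_unit_rep[OF M]
  interpret M: module K M using M by (rule kG_Mod_module)
  have TM: "T \<in> kG_Mod K G" using T by (rule is_tensor_module)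
  obtain h where h: "h \<in> lin_maps K T M"
      "\<And>x c. \<lbrakk>x \<in> carrier M; c \<in> carrier unit_rep\<rbrakk> \<Longrightarrow> h (\<beta> x c) = c \<odot>\<^bsub>M\<^esub> x"
    using is_tensor_lift[OF T M.module_axioms is_tensor_bilinear[OF M']] by blast
  obtain h' where h': "h' \<in> lin_maps K M T"
      "\<And>x c. \<lbrakk>x \<in> carrier M; c \<in> carrier unit_rep\<rbrakk> \<Longrightarrow> h' (c \<odot>\<^bsub>M\<^esub> x) = \<beta> x c"
    using is_tensor_lift[OF M' kG_Mod_module[OF TM] is_tensor_bilinear[OF T]] by blast
  have hh': "h (h' x) = x" if "x \<in> carrier M" for x
    using is_tensor_unique[OF M' M.module_axioms lin_maps_comp[OF h'(1) h(1)] _ _ that, of "\<lambda>x. x"] h(2) h'(2)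
    by (auto intro: lin_mapsI)
  have h'h: "h' (h t) = t" if "t \<in> carrier T" for t
    using is_tensor_unique[OF T kG_Mod_module[OF TM] lin_maps_comp[OF h(1) h'(1)] _ _ that, of "\<lambda>x. x"] h(2) h'(2)
    by (auto intro: lin_mapsI)
  \<comment> \<open>Equivariance of \<open>h\<close> is tested on the generators
    \<open>\<beta> x c\<close>; that of \<open>h'\<close> then follows because it is the
    inverse.\<close>
  have "h (act T g t) = act M g (h t)" if g: "g \<in> carrier G" and t: "t \<in> carrier T" for g t
  proof (rule is_tensor_unique[OF T M.module_axioms _ _ _ t])
    show "(\<lambda>t. h (act T g t)) \<in> lin_maps K T M" "(\<lambda>t. act M g (h t)) \<in> lin_maps K T M"
      using act_lin[OF TM g] act_lin[OF M g] h(1) by (auto intro: lin_maps_comp)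
    show "h (act T g (\<beta> x c)) = act M g (h (\<beta> x c))" if "x \<in> carrier M" "c \<in> carrier unit_rep" for x c
      using that g act_closed[OF M g] lin_maps_smult[OF act_lin[OF M g]]
      by (simp add: is_tensor_act[OF T] h(2))
  qed
  then have hom: "h \<in> Hom K G T M" using h(1) by (intro HomI)
  have "h' (act M g x) = act T g (h' x)" if g: "g \<in> carrier G" and x: "x \<in> carrier M" for g x
  proof -
    have "act M g x = h (act T g (h' x))"
      using Hom_act[OF hom g] lin_maps_closed[OF h'(1) x] hh'[OF x] by simp
    then show ?thesis using h'h act_closed[OF TM g] lin_maps_closed[OF h'(1) x] by simp
  qed
  then have "h' \<in> Hom K G M T" using h'(1) by (intro HomI)
  then show ?thesis using isomorphic_stwI[OF w TM M hom] hh' h'h by blast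
qed

end

section \<open>Finite dimensional modules and the identity triangle\<close>

definition span_of :: "('v, 'y) ring_scheme \<Rightarrow> ('v, 'v, 'a) module_scheme \<Rightarrow> 'v set \<Rightarrow> 'v set"
  where "span_of K M S = {(\<Oplus>\<^bsub>M\<^esub>s\<in>S. c s \<odot>\<^bsub>M\<^esub> s) | c. c \<in> S \<rightarrow> carrier K}"

lemma fin_dim_iff_span_of:
  "fin_dim K M \<longleftrightarrow> (\<exists>S. finite S \<and> S \<subseteq> carrier M \<and> carrier M \<subseteq> span_of K M S)"
proof -
  have "x \<in> span_of K M S \<longleftrightarrow> (\<exists>c\<in>S \<rightarrow> carrier K. x = (\<Oplus>\<^bsub>M\<^esub>s\<in>S. c s \<odot>\<^bsub>M\<^esub> s))" for x S
    unfolding span_of_def by blast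
  then show ?thesis
    by (simp only: fin_dim_def subset_eq[of "carrier M"])
qed

context
  fixes K :: "('v, 'y) ring_scheme" and M :: "('v, 'v, 'a) module_scheme" and S :: "'v set"
  assumes M: "module K M" and S: "finite S" "S \<subseteq> carrier M"
begin

interpretation M: module K M by (rule M)

lemma span_of_incl: "span_of K M S \<subseteq> carrier M"
  using S(2) by (auto simp: span_of_def intro!: M.M.finsum_closed)

lemma span_of_zero: "\<zero>\<^bsub>M\<^esub> \<in> span_of K M S"
proof -
  have "(\<Oplus>\<^bsub>M\<^esub>s\<in>S. \<zero>\<^bsub>K\<^esub> \<odot>\<^bsub>M\<^esub> s) = \<zero>\<^bsub>M\<^esub>"
    using S(2) by (intro M.M.add.finprod_one_eqI) auto
  then show ?thesis
    unfolding span_of_def by (intro CollectI exI[of _ "\<lambda>_. \<zero>\<^bsub>K\<^esub>"]) auto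
qed

lemma lincomb_add:
  assumes "c \<in> S \<rightarrow> carrier K" and "d \<in> S \<rightarrow> carrier K"
  shows "(\<Oplus>\<^bsub>M\<^esub>s\<in>S. c s \<odot>\<^bsub>M\<^esub> s) \<oplus>\<^bsub>M\<^esub> (\<Oplus>\<^bsub>M\<^esub>s\<in>S. d s \<odot>\<^bsub>M\<^esub> s) = (\<Oplus>\<^bsub>M\<^esub>s\<in>S. (c s \<oplus>\<^bsub>K\<^esub> d s) \<odot>\<^bsub>M\<^esub> s)"
proof -
  have "(\<Oplus>\<^bsub>M\<^esub>s\<in>S. c s \<odot>\<^bsub>M\<^esub> s) \<oplus>\<^bsub>M\<^esub> (\<Oplus>\<^bsub>M\<^esub>s\<in>S. d s \<odot>\<^bsub>M\<^esub> s) =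
      (\<Oplus>\<^bsub>M\<^esub>s\<in>S. c s \<odot>\<^bsub>M\<^esub> s \<oplus>\<^bsub>M\<^esub> d s \<odot>\<^bsub>M\<^esub> s)"
    using assms S(2) by (intro M.M.finsum_addf[symmetric]) auto
  also have "\<dots> = (\<Oplus>\<^bsub>M\<^esub>s\<in>S. (c s \<oplus>\<^bsub>K\<^esub> d s) \<odot>\<^bsub>M\<^esub> s)"
    using assms S(2) by (intro M.M.finsum_cong') (auto intro!: M.smult_l_distr[symmetric])
  finally show ?thesis .
qed

lemma lincomb_smult:
  assumes "a \<in> carrier K" and "c \<in> S \<rightarrow> carrier K"
  shows "a \<odot>\<^bsub>M\<^esub> (\<Oplus>\<^bsub>M\<^esub>s\<in>S. c s \<odot>\<^bsub>M\<^esub> s) = (\<Oplus>\<^bsub>M\<^esub>s\<in>S. (a \<otimes>\<^bsub>K\<^esub> c s) \<odot>\<^bsub>M\<^esub> s)"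
proof -
  have "a \<odot>\<^bsub>M\<^esub> (\<Oplus>\<^bsub>M\<^esub>s\<in>S. c s \<odot>\<^bsub>M\<^esub> s) = (\<Oplus>\<^bsub>M\<^esub>s\<in>S. a \<odot>\<^bsub>M\<^esub> (c s \<odot>\<^bsub>M\<^esub> s))"
    using assms S by (intro M.finsum_smult_ldistr) auto
  also have "\<dots> = (\<Oplus>\<^bsub>M\<^esub>s\<in>S. (a \<otimes>\<^bsub>K\<^esub> c s) \<odot>\<^bsub>M\<^esub> s)"
    using assms S(2) by (intro M.M.finsum_cong') (auto intro!: M.smult_assoc1[symmetric])
  finally show ?thesis .
qed

lemma span_of_add:
  assumes "x \<in> span_of K M S" and "y \<in> span_of K M S"
  shows "x \<oplus>\<^bsub>M\<^esub> y \<in> span_of K M S"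
proof -
  obtain c d where c: "c \<in> S \<rightarrow> carrier K" "x = (\<Oplus>\<^bsub>M\<^esub>s\<in>S. c s \<odot>\<^bsub>M\<^esub> s)"
    and d: "d \<in> S \<rightarrow> carrier K" "y = (\<Oplus>\<^bsub>M\<^esub>s\<in>S. d s \<odot>\<^bsub>M\<^esub> s)"
    using assms unfolding span_of_def by blast
  show ?thesis
    unfolding span_of_def c(2) d(2) lincomb_add[OF c(1) d(1)] using c(1) d(1)
    by (intro CollectI exI[of _ "\<lambda>s. c s \<oplus>\<^bsub>K\<^esub> d s"]) auto
qed

lemma span_of_smult:
  assumes "a \<in> carrier K" and "x \<in> span_of K M S"
  shows "a \<odot>\<^bsub>M\<^esub> x \<in> span_of K M S"
proof -
  obtain c where c: "c \<in> S \<rightarrow> carrier K" "x = (\<Oplus>\<^bsub>M\<^esub>s\<in>S. c s \<odot>\<^bsub>M\<^esub> s)"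
    using assms(2) unfolding span_of_def by blast
  show ?thesis
    unfolding span_of_def c(2) lincomb_smult[OF assms(1) c(1)] using c(1) assms(1)
    by (intro CollectI exI[of _ "\<lambda>s. a \<otimes>\<^bsub>K\<^esub> c s"]) auto
qed

lemma span_of_mem:
  assumes "s \<in> S"
  shows "s \<in> span_of K M S"
proof -
  let ?c = "\<lambda>t. if s = t then \<one>\<^bsub>K\<^esub> else \<zero>\<^bsub>K\<^esub>"
  have "(\<Oplus>\<^bsub>M\<^esub>t\<in>S. ?c t \<odot>\<^bsub>M\<^esub> t) = (\<Oplus>\<^bsub>M\<^esub>t\<in>S. if s = t then t else \<zero>\<^bsub>M\<^esub>)"
    using S(2) by (intro M.M.finsum_cong') auto
  also have "\<dots> = s"
    using M.M.finsum_singleton[of s S "\<lambda>t. t"] S assms by auto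
  finally show ?thesis
    unfolding span_of_def by (intro CollectI exI[of _ ?c]) auto
qed

lemma span_of_finsum:
  assumes "finite A" and "h \<in> A \<rightarrow> span_of K M S"
  shows "(\<Oplus>\<^bsub>M\<^esub>a\<in>A. h a) \<in> span_of K M S"
  by (rule M.finsum_in_submodule[OF span_of_zero span_of_add span_of_incl assms])

lemma module_span_of: "module K (M\<lparr>carrier := span_of K M S\<rparr>)"
proof -
  have neg: "\<ominus>\<^bsub>M\<^esub> x \<in> span_of K M S" if "x \<in> span_of K M S" for x
  proof -
    have "\<ominus>\<^bsub>M\<^esub> x = (\<ominus>\<^bsub>K\<^esub> \<one>\<^bsub>K\<^esub>) \<odot>\<^bsub>M\<^esub> x"
      using that span_of_incl by (subst M.smult_l_minus) auto
    then show ?thesis using span_of_smult[OF _ that] by simp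
  qed
  have "submodule (span_of K M S) K M"
    by (rule M.submoduleI[OF span_of_incl span_of_zero neg span_of_add span_of_smult])
  then show ?thesis using submodule.submodule_is_module M by blast
qed

end

context kG_modules
begin

text \<open>That elementary tensors span is not part of the definition. It comes from uniqueness:
  \<beta> takes values in the span of the tensors of generators, so it lifts to a map from
  \<open>T\<close> into that span, and this map fixes every \<open>\<beta> x y\<close>, hence is the
  identity.\<close>

lemma tensor_fin_dim:
  assumes T: "is_tensor K G M N T \<beta>" and M: "M \<in> fd_kG_Mod K G" and N: "N \<in> fd_kG_Mod K G"
  shows "T \<in> fd_kG_Mod K G"
proof -
  have TM: "T \<in> kG_Mod K G" using T by (rule is_tensor_module)
  interpret M: module K M using M kG_Mod_module by (auto simp: fd_kG_Mod_def)
  interpret N: module K N using N kG_Mod_module by (auto simp: fd_kG_Mod_def)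
  interpret T: module K T using TM by (rule kG_Mod_module)
  note b1 = bilinear_lin1[OF is_tensor_bilinear[OF T]] and b2 = bilinear_lin2[OF is_tensor_bilinear[OF T]]
  obtain A where A: "finite A" "A \<subseteq> carrier M" "carrier M \<subseteq> span_of K M A"
    using M by (auto simp: fd_kG_Mod_def fin_dim_iff_span_of)
  obtain B where B: "finite B" "B \<subseteq> carrier N" "carrier N \<subseteq> span_of K N B"
    using N by (auto simp: fd_kG_Mod_def fin_dim_iff_span_of)
  let ?S = "(\<lambda>(x, y). \<beta> x y) ` (A \<times> B)"
  have S: "finite ?S" "?S \<subseteq> carrier T"
    using A(1,2) B(1,2) lin_maps_closed[OF b2] by auto
  let ?H = "span_of K T ?S"
  note T' = T.module_axioms
  have 1: "\<beta> x y \<in> ?H" if x: "x \<in> A" and y: "y \<in> carrier N" for x y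
  proof -
    obtain c where c: "c \<in> B \<rightarrow> carrier K" "y = (\<Oplus>\<^bsub>N\<^esub>s\<in>B. c s \<odot>\<^bsub>N\<^esub> s)"
      using y B(3) unfolding span_of_def by blast
    have x': "x \<in> carrier M" using x A(2) by auto
    have "\<beta> x y = (\<Oplus>\<^bsub>T\<^esub>s\<in>B. \<beta> x (c s \<odot>\<^bsub>N\<^esub> s))"
      unfolding c(2) using c(1) B by (intro lin_maps_finsum[OF N.module_axioms T' b2[OF x']]) auto
    also have "\<dots> \<in> ?H"
    proof (rule span_of_finsum[OF T' S B(1)], rule funcsetI)
      fix s assume s: "s \<in> B"
      then have "\<beta> x (c s \<odot>\<^bsub>N\<^esub> s) = c s \<odot>\<^bsub>T\<^esub> \<beta> x s"
        using c(1) B(2) by (intro lin_maps_smult[OF b2[OF x']]) auto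
      moreover have "\<beta> x s \<in> ?H"
        using s x by (intro span_of_mem[OF T' S]) auto
      ultimately show "\<beta> x (c s \<odot>\<^bsub>N\<^esub> s) \<in> ?H"
        using s c(1) by (auto intro!: span_of_smult[OF T' S])
    qed
    finally show ?thesis .
  qed
  have 2: "\<beta> x y \<in> ?H" if x: "x \<in> carrier M" and y: "y \<in> carrier N" for x y
  proof -
    obtain c where c: "c \<in> A \<rightarrow> carrier K" "x = (\<Oplus>\<^bsub>M\<^esub>s\<in>A. c s \<odot>\<^bsub>M\<^esub> s)"
      using x A(3) unfolding span_of_def by blast
    have "\<beta> x y = (\<Oplus>\<^bsub>T\<^esub>s\<in>A. \<beta> (c s \<odot>\<^bsub>M\<^esub> s) y)"
      unfolding c(2) using c(1) A by (intro lin_maps_finsum[OF M.module_axioms T' b1[OF y]]) auto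
    also have "\<dots> \<in> ?H"
    proof (rule span_of_finsum[OF T' S A(1)], rule funcsetI)
      fix s assume s: "s \<in> A"
      then have "\<beta> (c s \<odot>\<^bsub>M\<^esub> s) y = c s \<odot>\<^bsub>T\<^esub> \<beta> s y"
        using c(1) A(2) by (intro lin_maps_smult[OF b1[OF y]]) auto
      then show "\<beta> (c s \<odot>\<^bsub>M\<^esub> s) y \<in> ?H"
        using 1[OF s y] s c(1) by (auto intro!: span_of_smult[OF T' S])
    qed
    finally show ?thesis .
  qed
  let ?T = "T\<lparr>carrier := ?H\<rparr>"
  have "\<beta> x \<in> lin_maps K N ?T" if "x \<in> carrier M" for x
    using that lin_maps_add[OF b2[OF that]] lin_maps_smult[OF b2[OF that]]
    by (intro lin_mapsI) (simp_all add: 2)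
  moreover have "(\<lambda>x. \<beta> x y) \<in> lin_maps K M ?T" if "y \<in> carrier N" for y
    using that lin_maps_add[OF b1[OF that]] lin_maps_smult[OF b1[OF that]]
    by (intro lin_mapsI) (simp_all add: 2)
  ultimately have "bilinear K M N ?T \<beta>"
    by (simp add: bilinear_def)
  then obtain h where h: "h \<in> lin_maps K T ?T" "\<And>x y. \<lbrakk>x \<in> carrier M; y \<in> carrier N\<rbrakk> \<Longrightarrow> h (\<beta> x y) = \<beta> x y"
    using is_tensor_lift[OF T module_span_of[OF T' S]] by blast
  have h': "h \<in> lin_maps K T T"
    using h(1) span_of_incl[OF T' S] by (auto simp: lin_maps_def)
  have "t \<in> ?H" if "t \<in> carrier T" for t
  proof -
    have "h t = t"
      using is_tensor_unique[OF T T' h' _ _ that, of "\<lambda>t. t"] h(2) by (auto intro: lin_mapsI)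
    then show ?thesis using lin_maps_closed[OF h(1) that] by simp
  qed
  then show ?thesis
    unfolding fd_kG_Mod_def fin_dim_iff_span_of using TM S by blast
qed

section \<open>The identity triangle, and reduction to a shift of the trivial module\<close>

lemma triangulated_subcat_whole: "\<A> \<noteq> {} \<Longrightarrow> triangulated_subcat K G w \<A> \<A>"
  by (auto simp: triangulated_subcat_def)

lemma localizing_kG_Mod: "localizing K G w (kG_Mod K G)"
  unfolding localizing_def using triangulated_subcat_whole unit_rep by (auto simp: is_coproduct_def)

text \<open>An intersection over no subcategories would be everything, even records that are not
  modules; the whole module category as a member prevents this.\<close>

lemma localizing_closure_fd_incl: "localizing_closure K G w (fd_kG_Mod K G) \<subseteq> kG_Mod K G"
  unfolding localizing_closure_def using localizing_kG_Mod by (auto simp: fd_kG_Mod_def)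

lemma thick_fd: "thick K G w (fd_kG_Mod K G) (fd_kG_Mod K G)"
  using triangulated_subcat_whole[of "fd_kG_Mod K G" w] unit_rep_fd by (auto simp: thick_def)

lemma tensor_closed_fd: "tensor_closed K G (fd_kG_Mod K G)"
  by (auto simp: tensor_closed_def intro: tensor_fin_dim)

text \<open>The given shift sequence of \<open>k\<close> is inserted unchanged. The sequence k
  \<rightarrow> k \<rightarrow> 0 is split, hence splits on tensoring with \<open>w\<close>, and its
  last term receives only zero maps.\<close>

lemma bousfield_triangle_unit_rep:
  assumes w: "w \<in> kG_Mod K G" and L: "unit_rep \<in> L" "L \<subseteq> kG_Mod K G"
    and P: "shift_model K G w unit_rep P S \<iota> \<pi>"
  defines "T \<equiv> \<lparr>obX = unit_rep, obY = unit_rep, obZ = zero_rep, obP = P, obS = S,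
    morXY = id, morYZ = (\<lambda>_. \<zero>\<^bsub>K\<^esub>), morZS = (\<lambda>_. \<zero>\<^bsub>S\<^esub>), inc = \<iota>, quo = \<pi>\<rparr>"
  shows "bousfield_triangle K G w L unit_rep T"
proof -
  have \<iota>: "ses K G unit_rep P S \<iota> \<pi>" using P by (simp add: shift_model_def)
  then have PS: "P \<in> kG_Mod K G" "S \<in> kG_Mod K G" "\<iota> \<in> Hom K G unit_rep P" "\<pi> \<in> Hom K G P S"
    and exact: "\<iota> ` carrier K = {y \<in> carrier P. \<pi> y = \<zero>\<^bsub>S\<^esub>}"
    by (auto simp: ses_def)
  note kz = zero_Hom[OF unit_rep zero_rep, simplified]
  have tri: "is_triangle K G w T"
    using unit_rep zero_rep kz zero_Hom[OF zero_rep PS(2)] P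
    by (simp add: T_def is_triangle_def id_Hom)
  have "ses K G unit_rep unit_rep zero_rep id (\<lambda>_. \<zero>\<^bsub>K\<^esub>)"
    using unit_rep zero_rep kz by (auto simp: ses_def id_Hom intro: K.zero_closed)
  moreover have "splits_on_tensoring K G w unit_rep unit_rep id"
    unfolding splits_on_tensoring_def
  proof (intro exI conjI bexI)
    \<comment> \<open>With \<open>w\<close> as model of w \<otimes> k at both ends the tensored
      first map is the identity.\<close>
    show "is_tensor K G w unit_rep w (\<lambda>x c. c \<odot>\<^bsub>w\<^esub> x)" "is_tensor K G w unit_rep w (\<lambda>x c. c \<odot>\<^bsub>w\<^esub> x)"
      by (rule is_tensor_unit_rep[OF w])+
    show "id \<in> Hom K G w w" "id \<in> Hom K G w w" by (rule id_Hom)+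
  qed (auto simp: is_tensor_map_def intro!: eq_mod_st_refl w)
  \<comment> \<open>The middle comparison map to k \<rightarrow> P \<rightarrow> S is \<iota>
    itself, so the zero third map is correct because \<pi> kills the image of \<iota>.\<close>
  moreover have "\<pi> (\<iota> y) = \<zero>\<^bsub>S\<^esub>" if "y \<in> carrier K" for y
    using exact that by blast
  ultimately have std: "standard_triangle K G w T"
    using tri PS(3) by (auto simp: T_def standard_triangle_def)
  have SM: "\<zero>\<^bsub>S\<^esub> \<in> carrier S"
    using kG_Mod_module[OF PS(2)] by (simp add: module_def abelian_group_def abelian_monoid.zero_closed)
  have "triangle_iso K G w T T"
    unfolding triangle_iso_def Let_def
  proof (intro conjI exI)
    show "is_triangle K G w T" "is_triangle K G w T" by (rule tri)+
    show "shift_map K G T T id id"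
      unfolding shift_map_def using id_Hom by (intro conjI bexI[of _ id]) simp_all
    show "is_iso K G (stw_null K G w) (obX T) (obX T) id"
      "is_iso K G (stw_null K G w) (obY T) (obY T) id" "is_iso K G (stw_null K G w) (obZ T) (obZ T) id"
      using unit_rep zero_rep by (auto simp: T_def intro!: is_iso_id_stw[OF w])
  qed (use unit_rep zero_rep PS(2) SM in \<open>auto simp: T_def intro!: eq_mod_stw_refl[OF w]\<close>)
  then have "dist_triangle K G w T" using std by (auto simp: dist_triangle_def)
  moreover have "stw_null K G w A zero_rep f" if "A \<in> L" "f \<in> Hom K G A zero_rep" for A f
    using lin_maps_closed[OF Hom_lin[OF that(2)]] that(1) L(2)
    by (intro stw_null_zero[OF w _ zero_rep]) auto
  then have "zero_rep \<in> right_orth K G (stw_null K G w) L"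
    unfolding right_orth_def using zero_rep by blast
  ultimately show ?thesis using L(1) by (simp add: bousfield_triangle_def T_def)
qed

text \<open>Of the isomorphism of triangles only the first component matters: it joins the first
  vertex of the Bousfield triangle of \<open>M\<close>, which lies in the closure, to M \<otimes>
  k.\<close>

lemma localizing_closure_fd_of_shift_model:
  assumes w: "w \<in> fd_kG_Mod K G"
    and P: "shift_model K G w unit_rep P S \<iota> \<pi>"
    and bousfield: "\<And>L' L M T. \<lbrakk>thick K G w (fd_kG_Mod K G) L'; tensor_closed K G L';
        L = localizing_closure K G w L'; M \<in> kG_Mod K G;
        bousfield_triangle K G w L unit_rep T\<rbrakk> \<Longrightarrow>
      \<exists>S T'. bousfield_triangle K G w L M S \<and> is_tensor_triangle K G M T T' \<and>
        triangle_iso K G w S T'"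
  shows "localizing_closure K G w (fd_kG_Mod K G) = kG_Mod K G"
proof
  let ?L = "localizing_closure K G w (fd_kG_Mod K G)"
  have w': "w \<in> kG_Mod K G" using w by (simp add: fd_kG_Mod_def)
  show incl: "?L \<subseteq> kG_Mod K G" by (rule localizing_closure_fd_incl)
  have k: "unit_rep \<in> ?L"
    using unit_rep_fd by (auto simp: localizing_closure_def)
  note T = bousfield_triangle_unit_rep[OF w' k incl P]
  show "kG_Mod K G \<subseteq> ?L"
  proof
    fix M assume M: "M \<in> kG_Mod K G"
    from bousfield[OF thick_fd tensor_closed_fd refl M T] obtain U T' \<beta> where
      U: "bousfield_triangle K G w ?L M U" and iso: "triangle_iso K G w U T'"
      and \<beta>: "is_tensor K G M unit_rep (obX T') \<beta>"
      by (fastforce simp: is_tensor_triangle_def)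
    have 1: "isomorphic K G (stw_null K G w) (obX U) (obX T')"
      using iso by (auto simp: triangle_iso_def is_triangle_def isomorphic_def Let_def)
    have 2: "isomorphic K G (stw_null K G w) (obX T') M"
      using w' M \<beta> by (rule tensor_unit_rep_isomorphic)
    \<comment> \<open>Closure under isomorphism is a property of each localizing subcategory, so
      membership is verified in every member of the intersection separately.\<close>
    have "M \<in> C" if C: "localizing K G w C" "fd_kG_Mod K G \<subseteq> C" for C
    proof -
      have closed: "Y \<in> C" if "V \<in> C" "isomorphic K G (stw_null K G w) V Y" for V Y
      proof -
        have "\<forall>V\<in>C. \<forall>Y\<in>kG_Mod K G. isomorphic K G (stw_null K G w) V Y \<longrightarrow> Y \<in> C"
          using C(1) unfolding localizing_def triangulated_subcat_def by (elim conjE)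
        then show ?thesis using that by (simp add: isomorphic_def)
      qed
      have "obX U \<in> C"
        using U C by (auto simp: bousfield_triangle_def localizing_closure_def)
      then show "M \<in> C" using closed 1 2 by blast
    qed
    then show "M \<in> ?L" by (auto simp: localizing_closure_def)
  qed
qed

end

section \<open>Modules of functions\<close>

context kG_modules
begin

section \<open>The quotient by an invariant vector\<close>

text \<open>The quotient of \<open>P\<close> by the line of \<open>e\<close> is realised on the
  kernel of \<tau>, a linear complement of that line, with \<pi> the projection along
  \<open>e\<close>. The complement need not be G-stable, so its action is that of \<open>P\<close>
  followed by \<pi>. The concrete description is exported because the lifting argument computes with
  it.\<close>

lemma invariant_vector_ses:
  assumes P: "P \<in> kG_Mod K G" and e: "e \<in> carrier P" "\<And>g. g \<in> carrier G \<Longrightarrow> act P g e = e"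
    and \<tau>: "\<tau> \<in> lin_maps K P unit_rep" "\<tau> e = \<one>\<^bsub>K\<^esub>"
  obtains S \<pi> where "ses K G unit_rep P S (\<lambda>c. c \<odot>\<^bsub>P\<^esub> e) \<pi>" and "carrier S \<subseteq> carrier P"
    and "add S = add P" and "smult S = smult P"
    and "\<And>g x. act S g x = \<pi> (act P g x)"
    and "\<And>x. \<pi> x = x \<ominus>\<^bsub>P\<^esub> \<tau> x \<odot>\<^bsub>P\<^esub> e" and "\<And>x. x \<in> carrier S \<Longrightarrow> \<pi> x = x"
    and "\<And>c x. \<lbrakk>c \<in> carrier K; x \<in> carrier P\<rbrakk> \<Longrightarrow> \<pi> (x \<oplus>\<^bsub>P\<^esub> c \<odot>\<^bsub>P\<^esub> e) = \<pi> x"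
proof -
  interpret P: module K P using P by (rule kG_Mod_module)
  interpret k: module K unit_rep by (rule module_unit_rep)
  define \<pi> where "\<pi> = (\<lambda>x. x \<ominus>\<^bsub>P\<^esub> \<tau> x \<odot>\<^bsub>P\<^esub> e)"
  define S where "S = P\<lparr>carrier := {x \<in> carrier P. \<tau> x = \<zero>\<^bsub>K\<^esub>}, act := (\<lambda>g x. \<pi> (act P g x))\<rparr>"
  have S_simps: "carrier S = {x \<in> carrier P. \<tau> x = \<zero>\<^bsub>K\<^esub>}" "add S = add P" "smult S = smult P"
    "\<zero>\<^bsub>S\<^esub> = \<zero>\<^bsub>P\<^esub>" "\<And>g x. act S g x = \<pi> (act P g x)"
    by (simp_all add: S_def)
  have \<tau>c: "\<tau> x \<in> carrier K" if "x \<in> carrier P" for x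
    using lin_maps_closed[OF \<tau>(1) that] by simp
  have \<tau>add: "\<tau> (x \<oplus>\<^bsub>P\<^esub> y) = \<tau> x \<oplus>\<^bsub>K\<^esub> \<tau> y" if "x \<in> carrier P" "y \<in> carrier P" for x y
    using lin_maps_add[OF \<tau>(1) that] by simp
  have \<tau>smult: "\<tau> (c \<odot>\<^bsub>P\<^esub> x) = c \<otimes>\<^bsub>K\<^esub> \<tau> x" if "c \<in> carrier K" "x \<in> carrier P" for c x
    using lin_maps_smult[OF \<tau>(1) that] by simp
  have \<tau>0: "\<tau> \<zero>\<^bsub>P\<^esub> = \<zero>\<^bsub>K\<^esub>"
    using lin_maps_zero_eq[OF P.module_axioms k.module_axioms \<tau>(1)] by simp
  have \<pi>: "\<pi> x = x \<oplus>\<^bsub>P\<^esub> (\<ominus>\<^bsub>K\<^esub> \<tau> x) \<odot>\<^bsub>P\<^esub> e" if "x \<in> carrier P" for x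
    using that e(1) \<tau>c by (simp add: \<pi>_def P.M.minus_eq P.smult_l_minus)
  have \<pi>c: "\<pi> x \<in> carrier P" and \<tau>\<pi>: "\<tau> (\<pi> x) = \<zero>\<^bsub>K\<^esub>" if "x \<in> carrier P" for x
    using that e(1) \<tau>c by (simp_all add: \<pi> \<tau>add \<tau>smult \<tau>(2) K.r_neg)
  have \<pi>S: "\<pi> x = x" if "x \<in> carrier S" for x
    using that e(1) by (simp add: \<pi> S_simps)
  have \<pi>lin: "\<pi> \<in> lin_maps K P S"
  proof (rule lin_mapsI)
    fix x y assume xy: "x \<in> carrier P" "y \<in> carrier P"
    then show "\<pi> (x \<oplus>\<^bsub>P\<^esub> y) = \<pi> x \<oplus>\<^bsub>S\<^esub> \<pi> y"
      using e(1) \<tau>c by (simp add: \<pi> \<tau>add S_simps K.minus_add P.smult_l_distr P.M.a_ac)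
  next
    fix c x assume cx: "c \<in> carrier K" "x \<in> carrier P"
    then show "\<pi> (c \<odot>\<^bsub>P\<^esub> x) = c \<odot>\<^bsub>S\<^esub> \<pi> x"
      using e(1) \<tau>c by (simp add: \<pi> \<tau>smult S_simps P.smult_r_distr K.r_minus flip: P.smult_assoc1)
  qed (simp add: S_simps \<pi>c \<tau>\<pi>)
  have \<pi>e: "\<pi> (x \<oplus>\<^bsub>P\<^esub> c \<odot>\<^bsub>P\<^esub> e) = \<pi> x" if "c \<in> carrier K" "x \<in> carrier P" for c x
  proof -
    have "\<pi> (c \<odot>\<^bsub>P\<^esub> e) = \<zero>\<^bsub>P\<^esub>"
      using that e(1) by (simp add: \<pi>_def \<tau>smult \<tau>(2) P.M.minus_eq P.M.r_neg)
    then show ?thesis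
      using that e(1) \<pi>c lin_maps_add[OF \<pi>lin, of x "c \<odot>\<^bsub>P\<^esub> e"] by (simp add: S_simps)
  qed
  \<comment> \<open>\<pi> forgets multiples of \<open>e\<close>, and G preserves them. This makes
    the corrected action multiplicative and \<pi> equivariant.\<close>
  have \<pi>act: "\<pi> (act P g (\<pi> x)) = \<pi> (act P g x)" if g: "g \<in> carrier G" and x: "x \<in> carrier P" for g x
  proof -
    have "act P g (\<pi> x) = act P g x \<oplus>\<^bsub>P\<^esub> (\<ominus>\<^bsub>K\<^esub> \<tau> x) \<odot>\<^bsub>P\<^esub> e"
      using x e(1) \<tau>c lin_maps_add[OF act_lin[OF P g]] lin_maps_smult[OF act_lin[OF P g]]
      by (simp add: \<pi> e(2)[OF g])
    then show ?thesis using x act_closed[OF P g] \<tau>c by (simp add: \<pi>e)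
  qed
  have "module K (P\<lparr>carrier := {x \<in> carrier P. \<tau> x = \<zero>\<^bsub>K\<^esub>}\<rparr>)"
  proof (intro submodule.submodule_is_module[OF _ P.module_axioms] P.submoduleI)
    fix x assume x: "x \<in> {x \<in> carrier P. \<tau> x = \<zero>\<^bsub>K\<^esub>}"
    then have "\<ominus>\<^bsub>P\<^esub> x = (\<ominus>\<^bsub>K\<^esub> \<one>\<^bsub>K\<^esub>) \<odot>\<^bsub>P\<^esub> x"
      by (subst P.smult_l_minus) auto
    then show "\<ominus>\<^bsub>P\<^esub> x \<in> {x \<in> carrier P. \<tau> x = \<zero>\<^bsub>K\<^esub>}"
      using x by (simp add: \<tau>smult)
  qed (auto simp: \<tau>0 \<tau>add \<tau>smult)
  then have S: "module K S"
    by (rule module_cong) (simp_all add: S_def)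
  have SM: "S \<in> kG_Mod K G"
    unfolding kG_Mod_def
  proof (intro CollectI conjI ballI)
    show "act S g \<in> lin_maps K S S" if g: "g \<in> carrier G" for g
    proof -
      have "(\<lambda>x. \<pi> (act P g x)) \<in> lin_maps K P S"
        using lin_maps_comp[OF act_lin[OF P g] \<pi>lin] .
      then show ?thesis
        by (auto simp: lin_maps_def S_simps)
    qed
    show "act S \<one>\<^bsub>G\<^esub> x = x" if "x \<in> carrier S" for x
      using that act_one[OF P] \<pi>S by (simp add: S_simps)
    show "act S (g \<otimes>\<^bsub>G\<^esub> h) x = act S g (act S h x)"
      if "g \<in> carrier G" "h \<in> carrier G" "x \<in> carrier S" for g h x
      using that \<pi>act act_closed[OF P] by (simp add: S_simps act_mult[OF P])
  qed (rule S)
  have "ses K G unit_rep P S (\<lambda>c. c \<odot>\<^bsub>P\<^esub> e) \<pi>"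
    unfolding ses_def
  proof (intro conjI)
    show "(\<lambda>c. c \<odot>\<^bsub>P\<^esub> e) \<in> Hom K G unit_rep P"
      using e lin_maps_smult[OF act_lin[OF P]]
      by (auto intro!: HomI lin_mapsI simp: P.smult_l_distr P.smult_assoc1)
    show "\<pi> \<in> Hom K G P S"
      using \<pi>lin \<pi>act by (intro HomI) (simp_all add: S_simps)
    show "inj_on (\<lambda>c. c \<odot>\<^bsub>P\<^esub> e) (carrier unit_rep)"
    proof (rule inj_onI)
      fix c d assume cd: "c \<in> carrier unit_rep" "d \<in> carrier unit_rep" "c \<odot>\<^bsub>P\<^esub> e = d \<odot>\<^bsub>P\<^esub> e"
      then have "\<tau> (c \<odot>\<^bsub>P\<^esub> e) = \<tau> (d \<odot>\<^bsub>P\<^esub> e)" by simp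
      then show "c = d" using cd(1,2) e(1) by (simp add: \<tau>smult \<tau>(2))
    qed
    show "(\<lambda>c. c \<odot>\<^bsub>P\<^esub> e) ` carrier unit_rep = {y \<in> carrier P. \<pi> y = \<zero>\<^bsub>S\<^esub>}"
    proof (intro equalityI subsetI)
      fix y assume "y \<in> (\<lambda>c. c \<odot>\<^bsub>P\<^esub> e) ` carrier unit_rep"
      then show "y \<in> {y \<in> carrier P. \<pi> y = \<zero>\<^bsub>S\<^esub>}"
        using e(1) by (auto simp: \<pi>_def \<tau>smult \<tau>(2) S_simps P.M.minus_eq P.M.r_neg)
    next
      fix y assume "y \<in> {y \<in> carrier P. \<pi> y = \<zero>\<^bsub>S\<^esub>}"
      then have y: "y \<in> carrier P" "y \<ominus>\<^bsub>P\<^esub> \<tau> y \<odot>\<^bsub>P\<^esub> e = \<zero>\<^bsub>P\<^esub>"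
        by (auto simp: S_simps \<pi>_def)
      then have "y = \<tau> y \<odot>\<^bsub>P\<^esub> e"
        using P.M.minus_equality[of y "\<ominus>\<^bsub>P\<^esub> (\<tau> y \<odot>\<^bsub>P\<^esub> e)"] \<tau>c e(1) by (simp add: P.M.minus_eq)
      then show "y \<in> (\<lambda>c. c \<odot>\<^bsub>P\<^esub> e) ` carrier unit_rep"
        using \<tau>c y(1) by auto
    qed
    show "\<pi> ` carrier P = carrier S"
      using \<pi>S \<pi>c \<tau>\<pi> by (force simp: S_simps)
  qed (use unit_rep P SM in auto)
  then show ?thesis
    using that[of S \<pi>] S_simps \<pi>_def \<pi>S \<pi>e by auto
qed

text \<open>\<open>ev\<close> decodes the elements of \<open>P\<close>, which live in \<open>'v\<close>, as members of \<open>\<F>\<close>, where functions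
  that agree on \<open>D\<close> are identified; \<open>\<delta> g\<close> is the action of the inverse of \<open>g\<close> on \<open>D\<close>.\<close>

definition is_function_rep ::
  "'d set \<Rightarrow> ('d \<Rightarrow> 'v) set \<Rightarrow> ('v, 'g) rep \<Rightarrow> ('g \<Rightarrow> 'd \<Rightarrow> 'd) \<Rightarrow> ('v, 'g) rep \<Rightarrow> ('v \<Rightarrow> 'd \<Rightarrow> 'v) \<Rightarrow> bool"
  where "is_function_rep D \<F> N \<delta> P ev \<longleftrightarrow> P \<in> kG_Mod K G \<and> ev ` carrier P \<subseteq> \<F> \<and>
    (\<forall>F\<in>\<F>. \<exists>x\<in>carrier P. \<forall>d\<in>D. ev x d = F d) \<and>
    (\<forall>x\<in>carrier P. \<forall>y\<in>carrier P. (\<forall>d\<in>D. ev x d = ev y d) \<longrightarrow> x = y) \<and>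
    (\<forall>d\<in>D. (\<lambda>x. ev x d) \<in> lin_maps K P N) \<and>
    (\<forall>g\<in>carrier G. \<forall>x\<in>carrier P. \<forall>d\<in>D. ev (act P g x) d = act N g (ev x (\<delta> g d)))"

text \<open>All operations are transported along the code \<open>enc\<close>, which has to separate
  functions only by their values on \<open>D\<close>. The law for \<delta> reverses the order of
  factors, as inverses do, so that acting on arguments by \<delta> and on values by \<open>N\<close>
  gives a left action.\<close>

lemma function_rep_exists:
  fixes D :: "'d set" and enc :: "('d \<Rightarrow> 'v) \<Rightarrow> 'v"
  assumes N: "N \<in> kG_Mod K G" and \<F>: "\<F> \<subseteq> D \<rightarrow> carrier N"
    and zero: "(\<lambda>_. \<zero>\<^bsub>N\<^esub>) \<in> \<F>"
    and add: "\<And>F F'. \<lbrakk>F \<in> \<F>; F' \<in> \<F>\<rbrakk> \<Longrightarrow> (\<lambda>d. F d \<oplus>\<^bsub>N\<^esub> F' d) \<in> \<F>"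
    and smult: "\<And>c F. \<lbrakk>c \<in> carrier K; F \<in> \<F>\<rbrakk> \<Longrightarrow> (\<lambda>d. c \<odot>\<^bsub>N\<^esub> F d) \<in> \<F>"
    and act: "\<And>g F. \<lbrakk>g \<in> carrier G; F \<in> \<F>\<rbrakk> \<Longrightarrow> (\<lambda>d. act N g (F (\<delta> g d))) \<in> \<F>"
    and \<delta>: "\<And>g d. \<lbrakk>g \<in> carrier G; d \<in> D\<rbrakk> \<Longrightarrow> \<delta> g d \<in> D" "\<And>d. d \<in> D \<Longrightarrow> \<delta> \<one>\<^bsub>G\<^esub> d = d"
      "\<And>g h d. \<lbrakk>g \<in> carrier G; h \<in> carrier G; d \<in> D\<rbrakk> \<Longrightarrow> \<delta> (g \<otimes>\<^bsub>G\<^esub> h) d = \<delta> h (\<delta> g d)"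
    and enc: "\<And>F F'. \<lbrakk>F \<in> \<F>; F' \<in> \<F>\<rbrakk> \<Longrightarrow> enc F = enc F' \<longleftrightarrow> (\<forall>d\<in>D. F d = F' d)"
  obtains P ev where "is_function_rep D \<F> N \<delta> P ev"
proof -
  interpret N: module K N using N by (rule kG_Mod_module)
  define ev where "ev = inv_into \<F> enc"
  define P :: "('v, 'g) rep" where "P = \<lparr>carrier = enc ` \<F>, monoid.mult = undefined, one = undefined,
    ring.zero = enc (\<lambda>_. \<zero>\<^bsub>N\<^esub>), ring.add = (\<lambda>x y. enc (\<lambda>d. ev x d \<oplus>\<^bsub>N\<^esub> ev y d)),
    smult = (\<lambda>c x. enc (\<lambda>d. c \<odot>\<^bsub>N\<^esub> ev x d)), act = (\<lambda>g x. enc (\<lambda>d. act N g (ev x (\<delta> g d))))\<rparr>"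
  have ev: "ev x \<in> \<F>" if "x \<in> carrier P" for x
    using that by (auto simp: P_def ev_def intro: inv_into_into)
  have encP: "enc F \<in> carrier P" if "F \<in> \<F>" for F
    using that by (simp add: P_def)
  \<comment> \<open>Decoding may return another representative than \<open>F\<close>; only the
    values on \<open>D\<close> are recovered.\<close>
  have ev_enc: "ev (enc F) d = F d" if "F \<in> \<F>" "d \<in> D" for F d
  proof -
    have "enc (ev (enc F)) = enc F"
      unfolding ev_def by (rule f_inv_into_f[OF imageI[OF that(1)]])
    then show ?thesis using enc[OF ev[OF encP]] that by blast
  qed
  have ext: "x = y" if "x \<in> carrier P" "y \<in> carrier P" "\<And>d. d \<in> D \<Longrightarrow> ev x d = ev y d" for x y
  proof -
    have "enc (ev x) = x" "enc (ev y) = y"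
      using that(1,2) by (auto simp: P_def ev_def f_inv_into_f)
    moreover have "enc (ev x) = enc (ev y)"
      using enc[OF ev ev] that by blast
    ultimately show ?thesis by metis
  qed
  have evN: "ev x d \<in> carrier N" if "x \<in> carrier P" "d \<in> D" for x d
    using ev[OF that(1)] \<F> that(2) by auto
  have zP: "\<zero>\<^bsub>P\<^esub> \<in> carrier P" and ev_zero: "\<And>d. d \<in> D \<Longrightarrow> ev \<zero>\<^bsub>P\<^esub> d = \<zero>\<^bsub>N\<^esub>"
    using encP[OF zero] ev_enc[OF zero] by (simp_all add: P_def)
  have aP: "x \<oplus>\<^bsub>P\<^esub> y \<in> carrier P"
    and ev_add: "\<And>d. d \<in> D \<Longrightarrow> ev (x \<oplus>\<^bsub>P\<^esub> y) d = ev x d \<oplus>\<^bsub>N\<^esub> ev y d"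
    if "x \<in> carrier P" "y \<in> carrier P" for x y
    using encP[OF add[OF ev ev, OF that]] ev_enc[OF add[OF ev ev, OF that]] by (simp_all add: P_def)
  have sP: "c \<odot>\<^bsub>P\<^esub> x \<in> carrier P"
    and ev_smult: "\<And>d. d \<in> D \<Longrightarrow> ev (c \<odot>\<^bsub>P\<^esub> x) d = c \<odot>\<^bsub>N\<^esub> ev x d"
    if "c \<in> carrier K" "x \<in> carrier P" for c x
    using encP[OF smult[OF that(1) ev[OF that(2)]]] ev_enc[OF smult[OF that(1) ev[OF that(2)]]]
    by (simp_all add: P_def)
  have gP: "act P g x \<in> carrier P"
    and ev_act: "\<And>d. d \<in> D \<Longrightarrow> ev (act P g x) d = act N g (ev x (\<delta> g d))"
    if "g \<in> carrier G" "x \<in> carrier P" for g x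
    using encP[OF act[OF that(1) ev[OF that(2)]]] ev_enc[OF act[OF that(1) ev[OF that(2)]]]
    by (simp_all add: P_def)
  have eq_iff: "x = y \<longleftrightarrow> (\<forall>d\<in>D. ev x d = ev y d)" if "x \<in> carrier P" "y \<in> carrier P" for x y
    using ext[OF that] by metis
  note ev_simps = eq_iff zP aP sP gP ev_zero ev_add ev_smult ev_act evN \<delta>
  have P: "module K P"
  proof (intro moduleI abelian_groupI)
    \<comment> \<open>The inverse is the multiple by -1, so closure of \<F> under scalars is
      enough.\<close>
    show "\<exists>y\<in>carrier P. y \<oplus>\<^bsub>P\<^esub> x = \<zero>\<^bsub>P\<^esub>" if "x \<in> carrier P" for x
      using that by (intro bexI[of _ "(\<ominus>\<^bsub>K\<^esub> \<one>\<^bsub>K\<^esub>) \<odot>\<^bsub>P\<^esub> x"])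
        (simp_all add: ev_simps N.smult_l_minus N.M.l_neg)
  qed (auto simp: ev_simps K.is_cring N.M.a_ac N.smult_l_distr N.smult_r_distr N.smult_assoc1)
  have "P \<in> kG_Mod K G"
    unfolding kG_Mod_def
  proof (intro CollectI conjI ballI)
    fix g assume g: "g \<in> carrier G"
    show "act P g \<in> lin_maps K P P"
      using g lin_maps_add[OF act_lin[OF N g]] lin_maps_smult[OF act_lin[OF N g]]
      by (intro lin_mapsI) (simp_all add: ev_simps)
  qed (auto simp: ev_simps act_one[OF N] act_mult[OF N] P)
  moreover have "(\<lambda>x. ev x d) \<in> lin_maps K P N" if "d \<in> D" for d
    using that by (intro lin_mapsI) (simp_all add: ev_simps)
  moreover have "\<exists>x\<in>carrier P. \<forall>d\<in>D. ev x d = F d" if "F \<in> \<F>" for F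
    using encP ev_enc that by blast
  ultimately have "is_function_rep D \<F> N \<delta> P ev"
    unfolding is_function_rep_def using ev ext ev_act by blast
  then show ?thesis by (rule that)
qed

lemma function_repD:
  assumes "is_function_rep D \<F> N \<delta> P ev"
  shows function_rep_module: "P \<in> kG_Mod K G"
    and function_rep_mem: "x \<in> carrier P \<Longrightarrow> ev x \<in> \<F>"
    and function_rep_lin: "d \<in> D \<Longrightarrow> (\<lambda>x. ev x d) \<in> lin_maps K P N"
    and function_rep_act: "\<lbrakk>g \<in> carrier G; x \<in> carrier P; d \<in> D\<rbrakk> \<Longrightarrow> ev (act P g x) d = act N g (ev x (\<delta> g d))"
    and function_rep_ext: "\<lbrakk>x \<in> carrier P; y \<in> carrier P; \<And>d. d \<in> D \<Longrightarrow> ev x d = ev y d\<rbrakk> \<Longrightarrow> x = y"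
    and function_rep_ex: "F \<in> \<F> \<Longrightarrow> \<exists>x\<in>carrier P. \<forall>d\<in>D. ev x d = F d"
  using assms unfolding is_function_rep_def by blast+

text \<open>Biproducts modulo \<open>mod_null\<close> are honest ones, so \<open>Q\<close> is a
  retract of w \<otimes> Y as a module. A lifting problem for \<open>Q\<close> is thereby solved on
  w \<otimes> Y by composing with \<open>p\<close> and restricting along \<open>i\<close>.\<close>

lemma Pcls_retract:
  assumes "Q \<in> Pcls K G w"
  obtains Y T \<beta> i p where "Q \<in> kG_Mod K G" "Y \<in> kG_Mod K G" "is_tensor K G w Y T \<beta>"
    "i \<in> Hom K G Q T" "p \<in> Hom K G T Q" "\<And>x. x \<in> carrier Q \<Longrightarrow> p (i x) = x"
proof -
  obtain Y T \<beta> Z i p where Q: "Q \<in> kG_Mod K G" "Y \<in> kG_Mod K G" "is_tensor K G w Y T \<beta>"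
    "i \<in> Hom K G Q T" "p \<in> Hom K G T Q" and "eq_mod mod_null Q Q (p \<circ> i) id"
    using assms unfolding Pcls_def is_biproduct_def by blast
  then have 0: "p (i x) \<ominus>\<^bsub>Q\<^esub> x = \<zero>\<^bsub>Q\<^esub>" if "x \<in> carrier Q" for x
    using that by (simp add: eq_mod_def mod_null_def)
  interpret Q: module K Q using Q(1) by (rule kG_Mod_module)
  have "p (i x) = x" if x: "x \<in> carrier Q" for x
  proof -
    have "p (i x) \<in> carrier Q"
      using lin_maps_closed[OF Hom_lin[OF Q(5)]] lin_maps_closed[OF Hom_lin[OF Q(4)]] x by blast
    then show ?thesis
      using Q.M.minus_equality[of "p (i x)" "\<ominus>\<^bsub>Q\<^esub> x"] 0[OF x] x by (simp add: Q.M.minus_eq)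
  qed
  then show ?thesis using that Q by blast
qed

section \<open>The regular representation and the case of zero \<open>w\<close>\<close>

lemma regular_rep_exists:
  assumes "finite (carrier G)"
  obtains P ev where "is_function_rep (carrier G) (carrier G \<rightarrow> carrier K) unit_rep (\<lambda>g h. inv\<^bsub>G\<^esub> g \<otimes>\<^bsub>G\<^esub> h) P ev"
proof -
  obtain e :: "('g \<Rightarrow> 'v) \<Rightarrow> 'v" where e: "inj_on e (carrier G \<rightarrow>\<^sub>E carrier K)"
    using embed_funcset[OF K.infinite_carrier assms] by blast
  have enc: "e (restrict F (carrier G)) = e (restrict F' (carrier G)) \<longleftrightarrow> (\<forall>g\<in>carrier G. F g = F' g)"
    if "F \<in> carrier G \<rightarrow> carrier K" "F' \<in> carrier G \<rightarrow> carrier K" for F F'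
  proof
    assume "e (restrict F (carrier G)) = e (restrict F' (carrier G))"
    then have "restrict F (carrier G) = restrict F' (carrier G)"
      using that by (intro inj_onD[OF e]) auto
    then show "\<forall>g\<in>carrier G. F g = F' g" by (metis restrict_apply')
  next
    assume "\<forall>g\<in>carrier G. F g = F' g"
    then have "restrict F (carrier G) = restrict F' (carrier G)" by (intro restrict_ext) auto
    then show "e (restrict F (carrier G)) = e (restrict F' (carrier G))" by simp
  qed
  show ?thesis
  proof (rule function_rep_exists[OF unit_rep, where enc = "\<lambda>F. e (restrict F (carrier G))"
        and \<F> = "carrier G \<rightarrow> carrier K" and D = "carrier G" and \<delta> = "\<lambda>g h. inv\<^bsub>G\<^esub> g \<otimes>\<^bsub>G\<^esub> h"])
    show "inv\<^bsub>G\<^esub> (g \<otimes>\<^bsub>G\<^esub> h) \<otimes>\<^bsub>G\<^esub> d = inv\<^bsub>G\<^esub> h \<otimes>\<^bsub>G\<^esub> (inv\<^bsub>G\<^esub> g \<otimes>\<^bsub>G\<^esub> d)"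
      if "g \<in> carrier G" "h \<in> carrier G" "d \<in> carrier G" for g h d
      using that by (simp add: G.inv_mult_group G.m_assoc)
  qed (use enc that in auto)
qed

text \<open>The module is free on the indicator function \<open>x1\<close> of the identity: x is the
  sum of x(g) g x1. A lift is therefore obtained by choosing \<open>v\<close> above
  \<open>f x1\<close> and sending x to the sum of x(g) g v.\<close>

lemma regular_rep_projective:
  assumes fin: "finite (carrier G)"
    and P: "is_function_rep (carrier G) (carrier G \<rightarrow> carrier K) unit_rep (\<lambda>g h. inv\<^bsub>G\<^esub> g \<otimes>\<^bsub>G\<^esub> h) P ev"
  shows "projective K G P"
proof -
  note PM = function_rep_module[OF P]
  interpret P: module K P using PM by (rule kG_Mod_module)
  interpret k: module K unit_rep by (rule module_unit_rep)
  have "(\<lambda>g. if g = \<one>\<^bsub>G\<^esub> then \<one>\<^bsub>K\<^esub> else \<zero>\<^bsub>K\<^esub>) \<in> carrier G \<rightarrow> carrier K" by auto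
  from function_rep_ex[OF P this] obtain x1 where
    x1: "x1 \<in> carrier P" "\<And>g. g \<in> carrier G \<Longrightarrow> ev x1 g = (if g = \<one>\<^bsub>G\<^esub> then \<one>\<^bsub>K\<^esub> else \<zero>\<^bsub>K\<^esub>)"
    by blast
  have evK: "ev x g \<in> carrier K" if "x \<in> carrier P" "g \<in> carrier G" for x g
    using function_rep_mem[OF P that(1)] that(2) by auto
  have ev_add: "ev (x \<oplus>\<^bsub>P\<^esub> y) g = ev x g \<oplus>\<^bsub>K\<^esub> ev y g"
    if "x \<in> carrier P" "y \<in> carrier P" "g \<in> carrier G" for x y g
    using lin_maps_add[OF function_rep_lin[OF P that(3)] that(1,2)] by simp
  have ev_smult: "ev (c \<odot>\<^bsub>P\<^esub> x) g = c \<otimes>\<^bsub>K\<^esub> ev x g"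
    if "c \<in> carrier K" "x \<in> carrier P" "g \<in> carrier G" for c x g
    using lin_maps_smult[OF function_rep_lin[OF P that(3)] that(1,2)] by simp
  have ev_act: "ev (act P a x) g = ev x (inv\<^bsub>G\<^esub> a \<otimes>\<^bsub>G\<^esub> g)"
    if "a \<in> carrier G" "x \<in> carrier P" "g \<in> carrier G" for a x g
    using function_rep_act[OF P that] by simp
  have gx1: "act P g x1 \<in> carrier P" if "g \<in> carrier G" for g
    using act_closed[OF PM that x1(1)] .
  have expand: "(\<Oplus>\<^bsub>P\<^esub>g\<in>carrier G. ev x g \<odot>\<^bsub>P\<^esub> act P g x1) = x" if x: "x \<in> carrier P" for x
  proof (rule function_rep_ext[OF P _ x])
    show "(\<Oplus>\<^bsub>P\<^esub>g\<in>carrier G. ev x g \<odot>\<^bsub>P\<^esub> act P g x1) \<in> carrier P"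
      using evK[OF x] gx1 by (intro P.M.finsum_closed) auto
    fix h assume h: "h \<in> carrier G"
    have "ev (\<Oplus>\<^bsub>P\<^esub>g\<in>carrier G. ev x g \<odot>\<^bsub>P\<^esub> act P g x1) h =
        (\<Oplus>\<^bsub>unit_rep\<^esub>g\<in>carrier G. ev (ev x g \<odot>\<^bsub>P\<^esub> act P g x1) h)"
      using evK[OF x] gx1 fin
      by (intro lin_maps_finsum[OF P.module_axioms k.module_axioms function_rep_lin[OF P h]]) auto
    also have "\<dots> = (\<Oplus>\<^bsub>unit_rep\<^esub>g\<in>carrier G. if h = g then ev x g else \<zero>\<^bsub>unit_rep\<^esub>)"
    proof (intro k.M.finsum_cong' refl)
      fix g assume g: "g \<in> carrier G"
      \<comment> \<open>The translate of \<open>x1\<close> by g is the indicator function of g,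
        which leaves one term of the sum.\<close>
      have "inv\<^bsub>G\<^esub> g \<otimes>\<^bsub>G\<^esub> h = \<one>\<^bsub>G\<^esub> \<longleftrightarrow> h = g"
        using g h by (metis G.inv_closed G.inv_equality G.inv_inv G.l_inv)
      then show "ev (ev x g \<odot>\<^bsub>P\<^esub> act P g x1) h = (if h = g then ev x g else \<zero>\<^bsub>unit_rep\<^esub>)"
        using g h evK[OF x] gx1 x1 by (simp add: ev_smult ev_act)
    qed (use evK[OF x] in auto)
    also have "\<dots> = ev x h"
      using k.M.finsum_singleton[of h "carrier G" "ev x"] h fin evK[OF x] by simp
    finally show "ev (\<Oplus>\<^bsub>P\<^esub>g\<in>carrier G. ev x g \<odot>\<^bsub>P\<^esub> act P g x1) h = ev x h" .
  qed
  have "\<exists>f'\<in>Hom K G P V. \<forall>x\<in>carrier P. q (f' x) = f x"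
    if V: "V \<in> kG_Mod K G" and Y: "Y \<in> kG_Mod K G" and q: "q \<in> Hom K G V Y"
      and f: "f \<in> Hom K G P Y" and surj: "q ` carrier V = carrier Y" for V Y q f
  proof -
    interpret V: module K V using V by (rule kG_Mod_module)
    interpret Y: module K Y using Y by (rule kG_Mod_module)
    obtain v where v: "v \<in> carrier V" "q v = f x1"
      using surj lin_maps_closed[OF Hom_lin[OF f] x1(1)] by (metis imageE)
    have gv: "act V g v \<in> carrier V" if "g \<in> carrier G" for g
      using act_closed[OF V that v(1)] .
    define f' where "f' = (\<lambda>x. \<Oplus>\<^bsub>V\<^esub>g\<in>carrier G. ev x g \<odot>\<^bsub>V\<^esub> act V g v)"
    have "f' \<in> Hom K G P V"
    proof (intro HomI lin_mapsI)
      show "f' x \<in> carrier V" if "x \<in> carrier P" for x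
        unfolding f'_def using evK[OF that] gv by (intro V.M.finsum_closed) auto
      show "f' (x \<oplus>\<^bsub>P\<^esub> y) = f' x \<oplus>\<^bsub>V\<^esub> f' y" if "x \<in> carrier P" "y \<in> carrier P" for x y
      proof -
        have "f' (x \<oplus>\<^bsub>P\<^esub> y) = (\<Oplus>\<^bsub>V\<^esub>g\<in>carrier G. ev x g \<odot>\<^bsub>V\<^esub> act V g v \<oplus>\<^bsub>V\<^esub> ev y g \<odot>\<^bsub>V\<^esub> act V g v)"
          unfolding f'_def using that evK gv
          by (intro V.M.finsum_cong') (auto simp: ev_add V.smult_l_distr)
        also have "\<dots> = f' x \<oplus>\<^bsub>V\<^esub> f' y"
          unfolding f'_def using that evK gv by (intro V.M.finsum_addf) auto
        finally show ?thesis .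
      qed
      show "f' (c \<odot>\<^bsub>P\<^esub> x) = c \<odot>\<^bsub>V\<^esub> f' x" if "c \<in> carrier K" "x \<in> carrier P" for c x
      proof -
        have "c \<odot>\<^bsub>V\<^esub> f' x = (\<Oplus>\<^bsub>V\<^esub>g\<in>carrier G. c \<odot>\<^bsub>V\<^esub> (ev x g \<odot>\<^bsub>V\<^esub> act V g v))"
          unfolding f'_def using that evK gv fin by (intro V.finsum_smult_ldistr) auto
        also have "\<dots> = f' (c \<odot>\<^bsub>P\<^esub> x)"
          unfolding f'_def using that evK gv
          by (intro V.M.finsum_cong') (auto simp: ev_smult V.smult_assoc1)
        finally show ?thesis ..
      qed
      show "f' (act P a x) = act V a (f' x)" if a: "a \<in> carrier G" and x: "x \<in> carrier P" for a x
      proof -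
        \<comment> \<open>Equivariance is the substitution of a g for the summation index.\<close>
        have img: "(\<otimes>\<^bsub>G\<^esub>) a ` carrier G = carrier G"
          using G.surj_const_mult[OF a] .
        have ag: "act V (a \<otimes>\<^bsub>G\<^esub> g) v \<in> carrier V" if "g \<in> carrier G" for g
          using gv a that by simp
        have "f' (act P a x) = (\<Oplus>\<^bsub>V\<^esub>g\<in>(\<otimes>\<^bsub>G\<^esub>) a ` carrier G. ev x (inv\<^bsub>G\<^esub> a \<otimes>\<^bsub>G\<^esub> g) \<odot>\<^bsub>V\<^esub> act V g v)"
          unfolding f'_def img using a x evK gv by (intro V.M.finsum_cong') (auto simp: ev_act)
        also have "\<dots> = (\<Oplus>\<^bsub>V\<^esub>g\<in>carrier G. ev x (inv\<^bsub>G\<^esub> a \<otimes>\<^bsub>G\<^esub> (a \<otimes>\<^bsub>G\<^esub> g)) \<odot>\<^bsub>V\<^esub> act V (a \<otimes>\<^bsub>G\<^esub> g) v)"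
          using a x evK ag by (intro V.M.finsum_reindex G.inj_on_cmult) auto
        also have "\<dots> = (\<Oplus>\<^bsub>V\<^esub>g\<in>carrier G. act V a (ev x g \<odot>\<^bsub>V\<^esub> act V g v))"
          using a x evK gv v act_closed[OF V a] lin_maps_smult[OF act_lin[OF V a]]
          by (intro V.M.finsum_cong') (auto simp: act_mult[OF V] simp flip: G.m_assoc)
        also have "\<dots> = act V a (f' x)"
          unfolding f'_def using x evK gv fin
          by (intro lin_maps_finsum[symmetric, OF V.module_axioms V.module_axioms act_lin[OF V a]]) auto
        finally show ?thesis .
      qed
    qed
    moreover have "q (f' x) = f x" if x: "x \<in> carrier P" for x
    proof -
      have "q (f' x) = (\<Oplus>\<^bsub>Y\<^esub>g\<in>carrier G. q (ev x g \<odot>\<^bsub>V\<^esub> act V g v))"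
        unfolding f'_def using x evK gv fin
        by (intro lin_maps_finsum[OF V.module_axioms Y.module_axioms Hom_lin[OF q]]) auto
      also have "\<dots> = (\<Oplus>\<^bsub>Y\<^esub>g\<in>carrier G. f (ev x g \<odot>\<^bsub>P\<^esub> act P g x1))"
      proof (intro Y.M.finsum_cong' refl)
        fix g assume g: "g \<in> carrier G"
        show "q (ev x g \<odot>\<^bsub>V\<^esub> act V g v) = f (ev x g \<odot>\<^bsub>P\<^esub> act P g x1)"
          using evK[OF x g] gv[OF g] gx1[OF g] v x1(1) g
          by (simp add: lin_maps_smult[OF Hom_lin[OF q]] lin_maps_smult[OF Hom_lin[OF f]]
              Hom_act[OF q] Hom_act[OF f])
      qed (use evK[OF x] gx1 lin_maps_closed[OF Hom_lin[OF f]] in auto)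
      also have "\<dots> = f (\<Oplus>\<^bsub>P\<^esub>g\<in>carrier G. ev x g \<odot>\<^bsub>P\<^esub> act P g x1)"
        using x evK gx1 fin
        by (intro lin_maps_finsum[symmetric, OF P.module_axioms Y.module_axioms Hom_lin[OF f]]) auto
      finally show ?thesis using expand[OF x] by simp
    qed
    ultimately show ?thesis by blast
  qed
  then show ?thesis using PM by (auto simp: projective_def)
qed

lemma projective_isomorphic_zero_rep:
  assumes P: "projective K G P"
  shows "isomorphic K G (st_null K G) P zero_rep"
proof -
  have PM: "P \<in> kG_Mod K G" using P by (simp add: projective_def)
  interpret P: module K P using PM by (rule kG_Mod_module)
  \<comment> \<open>The difference tested by \<open>eq_mod\<close> is zero minus the identity, so
    the factorisation through \<open>P\<close> itself has to carry the sign.\<close>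
  have neg: "\<zero>\<^bsub>P\<^esub> \<ominus>\<^bsub>P\<^esub> x = (\<ominus>\<^bsub>K\<^esub> \<one>\<^bsub>K\<^esub>) \<odot>\<^bsub>P\<^esub> x" if "x \<in> carrier P" for x
    using that by (simp add: P.M.minus_eq P.smult_l_minus)
  have "(\<lambda>x. (\<ominus>\<^bsub>K\<^esub> \<one>\<^bsub>K\<^esub>) \<odot>\<^bsub>P\<^esub> x) \<in> Hom K G P P"
    using lin_maps_smult[OF act_lin[OF PM]]
    by (intro HomI lin_mapsI) (simp_all add: P.smult_r_distr K.l_minus K.r_minus flip: P.smult_assoc1)
  then have "eq_mod (st_null K G) P P ((\<lambda>_. \<zero>\<^bsub>P\<^esub>) \<circ> (\<lambda>_. \<zero>\<^bsub>K\<^esub>)) id"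
    unfolding eq_mod_def st_null_def using P id_Hom[of K G P] neg
    by (intro exI[of _ P] exI[of _ id] exI[of _ "\<lambda>x. (\<ominus>\<^bsub>K\<^esub> \<one>\<^bsub>K\<^esub>) \<odot>\<^bsub>P\<^esub> x"]) simp
  moreover have "eq_mod (st_null K G) zero_rep zero_rep ((\<lambda>_. \<zero>\<^bsub>K\<^esub>) \<circ> (\<lambda>_. \<zero>\<^bsub>P\<^esub>)) id"
    by (intro eq_mod_st_refl zero_rep) auto
  ultimately show ?thesis
    unfolding isomorphic_def is_iso_def
    using PM zero_rep zero_Hom[OF PM zero_rep] zero_Hom[OF zero_rep PM] by auto
qed

text \<open>Members of P(w) are zero modules here, so lifting is trivial. What has to be arranged is
  that the middle term is stably zero and contains k, and a projective module containing k does
  both.\<close>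

lemma shift_model_zero:
  assumes fin: "finite (carrier G)" and w: "w \<in> kG_Mod K G" "carrier w = {\<zero>\<^bsub>w\<^esub>}"
  obtains P S \<iota> \<pi> where "shift_model K G w unit_rep P S \<iota> \<pi>"
proof -
  obtain P ev where P: "is_function_rep (carrier G) (carrier G \<rightarrow> carrier K) unit_rep (\<lambda>g h. inv\<^bsub>G\<^esub> g \<otimes>\<^bsub>G\<^esub> h) P ev"
    using regular_rep_exists[OF fin] by blast
  note PM = function_rep_module[OF P]
  \<comment> \<open>The constant function 1 spans the copy of k, and evaluation at the identity of G
    is the functional sending it to 1.\<close>
  have "(\<lambda>_. \<one>\<^bsub>K\<^esub>) \<in> carrier G \<rightarrow> carrier K" by auto
  from function_rep_ex[OF P this] obtain e where
    e: "e \<in> carrier P" "\<And>g. g \<in> carrier G \<Longrightarrow> ev e g = \<one>\<^bsub>K\<^esub>" by blast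
  have inv: "act P g e = e" if "g \<in> carrier G" for g
    using that e act_closed[OF PM]
    by (auto simp: function_rep_act[OF P] intro: function_rep_ext[OF P, of "act P g e"])
  obtain S \<pi> where S: "ses K G unit_rep P S (\<lambda>c. c \<odot>\<^bsub>P\<^esub> e) \<pi>"
    by (rule invariant_vector_ses[OF PM e(1) inv function_rep_lin[OF P G.one_closed] e(2)[OF G.one_closed]])
      (assumption, rule that, assumption)
  then have SM: "S \<in> kG_Mod K G" and \<pi>: "\<pi> \<in> Hom K G P S" by (auto simp: ses_def)
  have "\<exists>f'\<in>Hom K G Q P. eq_mod (st_null K G) Q S (\<pi> \<circ> f') f"
    if "Q \<in> Pcls K G w" and f: "f \<in> Hom K G Q S" for Q f
  proof -
    obtain Y T \<beta> i p where Q: "Q \<in> kG_Mod K G" "Y \<in> kG_Mod K G" "is_tensor K G w Y T \<beta>"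
      "i \<in> Hom K G Q T" "p \<in> Hom K G T Q" "\<And>x. x \<in> carrier Q \<Longrightarrow> p (i x) = x"
      using Pcls_retract[OF \<open>Q \<in> Pcls K G w\<close>] by blast
    have TM: "T \<in> kG_Mod K G" using Q(3) by (rule is_tensor_module)
    interpret T: module K T using TM by (rule kG_Mod_module)
    \<comment> \<open>The identity and the zero map of \<open>T\<close> agree on all
      \<open>\<beta> x y\<close>, as x can only be zero.\<close>
    have "t = \<zero>\<^bsub>T\<^esub>" if "t \<in> carrier T" for t
    proof (rule is_tensor_unique[OF Q(3) T.module_axioms _ _ _ that, where h = "\<lambda>t. t" and h' = "\<lambda>_. \<zero>\<^bsub>T\<^esub>"])
      fix x y assume x: "x \<in> carrier w" and y: "y \<in> carrier Y"
      have "\<beta> \<zero>\<^bsub>w\<^esub> y = \<zero>\<^bsub>T\<^esub>"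
        by (rule lin_maps_zero_eq[OF kG_Mod_module[OF w(1)] T.module_axioms
              bilinear_lin1[OF is_tensor_bilinear[OF Q(3)] y]])
      then show "\<beta> x y = \<zero>\<^bsub>T\<^esub>" using x w(2) by simp
    qed (auto intro: lin_mapsI)
    then have Q0: "x = \<zero>\<^bsub>Q\<^esub>" if "x \<in> carrier Q" for x
      using Q(6)[OF that] lin_maps_closed[OF Hom_lin[OF Q(4)] that] Hom_zero_eq[OF TM Q(1,5)] by metis
    have "eq_mod (st_null K G) Q S (\<pi> \<circ> (\<lambda>_. \<zero>\<^bsub>P\<^esub>)) f"
    proof (rule eq_mod_st_refl[OF Q(1) SM])
      fix x assume x: "x \<in> carrier Q"
      show "f x \<in> carrier S" using lin_maps_closed[OF Hom_lin[OF f] x] .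
      have "f x = \<zero>\<^bsub>S\<^esub>" using Hom_zero_eq[OF Q(1) SM f] Q0[OF x] by simp
      then show "(\<pi> \<circ> (\<lambda>_. \<zero>\<^bsub>P\<^esub>)) x = f x" using Hom_zero_eq[OF PM SM \<pi>] by simp
    qed
    then show ?thesis using zero_Hom[OF Q(1) PM] by blast
  qed
  moreover have "isomorphic K G (st_null K G) P zero_rep"
    using regular_rep_projective[OF fin P] by (rule projective_isomorphic_zero_rep)
  ultimately have "right_approx K G w P S \<pi>"
    unfolding right_approx_def using SM \<pi> zero_rep_Pcls[OF w(1)] by blast
  then show ?thesis using that S by (auto simp: shift_model_def)
qed

section \<open>Dual bases and modules of linear maps\<close>

text \<open>Multiples of \<open>v\<close> by distinct scalars are distinct, the difference of the
  scalars being invertible. This makes room inside \<open>w\<close> for codes of its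
  endomorphisms.\<close>

lemma infinite_module:
  assumes "module K M" and "v \<in> carrier M" and "v \<noteq> \<zero>\<^bsub>M\<^esub>"
  shows "infinite (carrier M)"
proof -
  interpret M: module K M by fact
  have "inj_on (\<lambda>c. c \<odot>\<^bsub>M\<^esub> v) (carrier K)"
  proof (rule inj_onI, rule ccontr)
    fix c d assume c: "c \<in> carrier K" and d: "d \<in> carrier K" and eq: "c \<odot>\<^bsub>M\<^esub> v = d \<odot>\<^bsub>M\<^esub> v" and "c \<noteq> d"
    let ?a = "c \<ominus>\<^bsub>K\<^esub> d"
    have a: "?a \<in> Units K"
      using c d \<open>c \<noteq> d\<close> by (simp add: K.field_Units)
    have "?a \<odot>\<^bsub>M\<^esub> v = \<zero>\<^bsub>M\<^esub>"
      using c d assms(2) by (simp add: K.minus_eq M.smult_l_distr M.smult_l_minus eq M.M.r_neg)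
    then have "(inv\<^bsub>K\<^esub> ?a \<otimes>\<^bsub>K\<^esub> ?a) \<odot>\<^bsub>M\<^esub> v = \<zero>\<^bsub>M\<^esub>"
      using a assms(2) by (subst M.smult_assoc1) auto
    then show False using a assms(2,3) by simp
  qed
  moreover have "(\<lambda>c. c \<odot>\<^bsub>M\<^esub> v) ` carrier K \<subseteq> carrier M" using assms(2) by auto
  ultimately show ?thesis
    using K.infinite_carrier by (meson finite_imageD finite_subset)
qed

text \<open>A spanning set of least cardinality is independent, so coefficients are unique;
  uniqueness makes any choice of them linear in the vector.\<close>

lemma dual_basis:
  assumes M: "module K M" and "fin_dim K M"
  obtains S d where "finite S" and "S \<subseteq> carrier M"
    and "\<And>s. s \<in> S \<Longrightarrow> d s \<in> lin_maps K M unit_rep"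
    and "\<And>x. x \<in> carrier M \<Longrightarrow> (\<Oplus>\<^bsub>M\<^esub>s\<in>S. d s x \<odot>\<^bsub>M\<^esub> s) = x"
proof -
  interpret M: module K M by fact
  let ?P = "\<lambda>S. finite S \<and> S \<subseteq> carrier M \<and> carrier M \<subseteq> span_of K M S"
  obtain S where "?P S" and min: "\<And>S'. ?P S' \<Longrightarrow> card S \<le> card S'"
    using assms(2) ex_has_least_nat[of ?P _ card] unfolding fin_dim_iff_span_of by metis
  then have S: "finite S" "S \<subseteq> carrier M" "carrier M \<subseteq> span_of K M S" by auto
  \<comment> \<open>A relation with an invertible coefficient at \<open>t\<close> expresses
    \<open>t\<close> through the other elements, which would then span as well.\<close>
  have indep: "c t = \<zero>\<^bsub>K\<^esub>"
    if c: "c \<in> S \<rightarrow> carrier K" and sum: "(\<Oplus>\<^bsub>M\<^esub>s\<in>S. c s \<odot>\<^bsub>M\<^esub> s) = \<zero>\<^bsub>M\<^esub>" and t: "t \<in> S" for c t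
  proof (rule ccontr)
    assume "c t \<noteq> \<zero>\<^bsub>K\<^esub>"
    then have u: "c t \<in> Units K" using c t by (auto simp: K.field_Units)
    let ?S = "S - {t}"
    note S' = finite_Diff[OF S(1), of "{t}"] order_trans[OF Diff_subset S(2), of "{t}"]
    have tM: "t \<in> carrier M" and cM: "c \<in> ?S \<rightarrow> carrier K" using t S(2) c by auto
    let ?r = "\<Oplus>\<^bsub>M\<^esub>s\<in>?S. c s \<odot>\<^bsub>M\<^esub> s"
    have r: "?r \<in> span_of K M ?S" using cM by (auto simp: span_of_def)
    then have rM: "?r \<in> carrier M" using span_of_incl[OF M S'] by blast
    have "(\<Oplus>\<^bsub>M\<^esub>s\<in>insert t ?S. c s \<odot>\<^bsub>M\<^esub> s) = c t \<odot>\<^bsub>M\<^esub> t \<oplus>\<^bsub>M\<^esub> ?r"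
      using S' tM cM u by (intro M.M.finsum_insert) auto
    then have "c t \<odot>\<^bsub>M\<^esub> t \<oplus>\<^bsub>M\<^esub> ?r = \<zero>\<^bsub>M\<^esub>"
      using sum t by (simp add: insert_absorb)
    then have "c t \<odot>\<^bsub>M\<^esub> t = \<ominus>\<^bsub>M\<^esub> ?r"
      using M.M.minus_equality tM rM u by (metis K.Units_closed M.smult_closed)
    moreover have "(inv\<^bsub>K\<^esub> (c t) \<otimes>\<^bsub>K\<^esub> c t) \<odot>\<^bsub>M\<^esub> t = inv\<^bsub>K\<^esub> (c t) \<odot>\<^bsub>M\<^esub> (c t \<odot>\<^bsub>M\<^esub> t)"
      using u tM by (intro M.smult_assoc1) auto
    ultimately have "t = inv\<^bsub>K\<^esub> (c t) \<odot>\<^bsub>M\<^esub> (\<ominus>\<^bsub>M\<^esub> ?r)"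
      using u tM by simp
    also have "\<dots> = (\<ominus>\<^bsub>K\<^esub> (inv\<^bsub>K\<^esub> (c t))) \<odot>\<^bsub>M\<^esub> ?r"
      using u rM by (simp add: M.smult_l_minus M.smult_r_minus)
    also have "\<dots> \<in> span_of K M ?S"
      using u by (intro span_of_smult[OF M S' _ r]) auto
    finally have "S \<subseteq> span_of K M ?S"
      using span_of_mem[OF M S'] by blast
    then have "(\<Oplus>\<^bsub>M\<^esub>s\<in>S. a s \<odot>\<^bsub>M\<^esub> s) \<in> span_of K M ?S" if "a \<in> S \<rightarrow> carrier K" for a
      using that by (intro span_of_finsum[OF M S' S(1)]) (auto intro!: span_of_smult[OF M S'])
    then have "span_of K M S \<subseteq> span_of K M ?S"
      unfolding span_of_def[of K M S] by blast
    then have "card S \<le> card ?S" using S S' by (intro min) blast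
    then show False using card_Diff1_less[OF S(1) t] by simp
  qed
  have unique: "c t = c' t"
    if c: "c \<in> S \<rightarrow> carrier K" "c' \<in> S \<rightarrow> carrier K"
      and eq: "(\<Oplus>\<^bsub>M\<^esub>s\<in>S. c s \<odot>\<^bsub>M\<^esub> s) = (\<Oplus>\<^bsub>M\<^esub>s\<in>S. c' s \<odot>\<^bsub>M\<^esub> s)" and t: "t \<in> S" for c c' t
  proof -
    let ?c = "\<lambda>s. (\<ominus>\<^bsub>K\<^esub> \<one>\<^bsub>K\<^esub>) \<otimes>\<^bsub>K\<^esub> c' s" and ?x = "\<Oplus>\<^bsub>M\<^esub>s\<in>S. c' s \<odot>\<^bsub>M\<^esub> s"
    have x: "?x \<in> carrier M" using c S(2) by (intro M.M.finsum_closed) auto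
    have c'': "?c \<in> S \<rightarrow> carrier K" using c(2) by auto
    have "(\<Oplus>\<^bsub>M\<^esub>s\<in>S. (c s \<oplus>\<^bsub>K\<^esub> ?c s) \<odot>\<^bsub>M\<^esub> s) = ?x \<oplus>\<^bsub>M\<^esub> (\<ominus>\<^bsub>K\<^esub> \<one>\<^bsub>K\<^esub>) \<odot>\<^bsub>M\<^esub> ?x"
      using lincomb_add[OF M S(1,2) c(1) c''] lincomb_smult[OF M S(1,2) _ c(2), of "\<ominus>\<^bsub>K\<^esub> \<one>\<^bsub>K\<^esub>"] eq by simp
    also have "\<dots> = \<zero>\<^bsub>M\<^esub>" using x by (simp add: M.smult_l_minus M.M.r_neg)
    finally have "c t \<oplus>\<^bsub>K\<^esub> ?c t = \<zero>\<^bsub>K\<^esub>" using c c'' t by (intro indep) auto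
    moreover have "c t \<in> carrier K" "c' t \<in> carrier K" using c t by auto
    ultimately show ?thesis by (simp add: K.l_minus K.r_right_minus_eq flip: K.minus_eq)
  qed
  have "\<exists>c. c \<in> S \<rightarrow> carrier K \<and> (\<Oplus>\<^bsub>M\<^esub>s\<in>S. c s \<odot>\<^bsub>M\<^esub> s) = x" if "x \<in> carrier M" for x
    using S(3) that by (auto simp: span_of_def)
  then obtain c where c: "\<And>x. x \<in> carrier M \<Longrightarrow> c x \<in> S \<rightarrow> carrier K"
    and sum: "\<And>x. x \<in> carrier M \<Longrightarrow> (\<Oplus>\<^bsub>M\<^esub>s\<in>S. c x s \<odot>\<^bsub>M\<^esub> s) = x"
    by metis
  have cK: "c x s \<in> carrier K" if "x \<in> carrier M" "s \<in> S" for x s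
    using c[OF that(1)] that(2) by auto
  have "(\<lambda>x. c x s) \<in> lin_maps K M unit_rep" if s: "s \<in> S" for s
  proof (rule lin_mapsI)
    fix x y assume xy: "x \<in> carrier M" "y \<in> carrier M"
    have "c (x \<oplus>\<^bsub>M\<^esub> y) s = c x s \<oplus>\<^bsub>K\<^esub> c y s"
    proof (rule unique[OF _ _ _ s])
      show "(\<Oplus>\<^bsub>M\<^esub>s\<in>S. c (x \<oplus>\<^bsub>M\<^esub> y) s \<odot>\<^bsub>M\<^esub> s) = (\<Oplus>\<^bsub>M\<^esub>s\<in>S. (c x s \<oplus>\<^bsub>K\<^esub> c y s) \<odot>\<^bsub>M\<^esub> s)"
        unfolding lincomb_add[OF M S(1,2) c[OF xy(1)] c[OF xy(2)], symmetric] using xy by (simp add: sum)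
    qed (use xy cK in auto)
    then show "c (x \<oplus>\<^bsub>M\<^esub> y) s = c x s \<oplus>\<^bsub>unit_rep\<^esub> c y s" by simp
  next
    fix a x assume ax: "a \<in> carrier K" "x \<in> carrier M"
    have "c (a \<odot>\<^bsub>M\<^esub> x) s = a \<otimes>\<^bsub>K\<^esub> c x s"
    proof (rule unique[OF _ _ _ s])
      show "(\<Oplus>\<^bsub>M\<^esub>s\<in>S. c (a \<odot>\<^bsub>M\<^esub> x) s \<odot>\<^bsub>M\<^esub> s) = (\<Oplus>\<^bsub>M\<^esub>s\<in>S. (a \<otimes>\<^bsub>K\<^esub> c x s) \<odot>\<^bsub>M\<^esub> s)"
        unfolding lincomb_smult[OF M S(1,2) ax(1) c[OF ax(2)], symmetric] using ax by (simp add: sum)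
    qed (use ax cK in auto)
    then show "c (a \<odot>\<^bsub>M\<^esub> x) s = a \<odot>\<^bsub>unit_rep\<^esub> c x s" by simp
  qed (use s cK in simp)
  then show ?thesis using that[OF S(1,2), of "\<lambda>s x. c x s"] sum by blast
qed

text \<open>The internal Hom with the conjugation action F \<mapsto> g F g^(-1): for the trivial
  target the dual of \<open>V\<close>, for \<open>N = V\<close> the endomorphisms.\<close>

abbreviation is_hom_rep ::
  "('v, 'g) rep \<Rightarrow> ('v, 'g) rep \<Rightarrow> ('v, 'g) rep \<Rightarrow> ('v \<Rightarrow> 'v \<Rightarrow> 'v) \<Rightarrow> bool"
  where "is_hom_rep V N P ev \<equiv>
    is_function_rep (carrier V) (lin_maps K V N) N (\<lambda>g. act V (inv\<^bsub>G\<^esub> g)) P ev"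

text \<open>A linear map is determined by its values on a finite spanning set \<open>S\<close>, and
  only these are encoded, although \<open>D\<close> is all of \<open>V\<close>.\<close>

lemma hom_rep_exists:
  assumes V: "V \<in> fd_kG_Mod K G" and N: "N \<in> kG_Mod K G" and inf: "infinite (carrier N)"
  obtains P ev where "is_hom_rep V N P ev"
proof -
  have VM: "V \<in> kG_Mod K G" using V by (simp add: fd_kG_Mod_def)
  interpret V: module K V using VM by (rule kG_Mod_module)
  interpret N: module K N using N by (rule kG_Mod_module)
  obtain S where S: "finite S" "S \<subseteq> carrier V" "carrier V \<subseteq> span_of K V S"
    using V by (auto simp: fd_kG_Mod_def fin_dim_iff_span_of)
  obtain e :: "('v \<Rightarrow> 'v) \<Rightarrow> 'v" where e: "inj_on e (S \<rightarrow>\<^sub>E carrier N)"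
    using embed_funcset[OF inf S(1)] by blast
  have enc: "e (restrict F S) = e (restrict F' S) \<longleftrightarrow> (\<forall>v\<in>carrier V. F v = F' v)"
    if F: "F \<in> lin_maps K V N" "F' \<in> lin_maps K V N" for F F'
  proof
    assume "e (restrict F S) = e (restrict F' S)"
    then have "restrict F S = restrict F' S"
      using F S(2) by (intro inj_onD[OF e]) (auto simp: lin_maps_def)
    then have eq: "F s = F' s" if "s \<in> S" for s using that by (metis restrict_apply')
    show "\<forall>v\<in>carrier V. F v = F' v"
    proof
      fix v assume "v \<in> carrier V"
      then obtain c where c: "c \<in> S \<rightarrow> carrier K" "v = (\<Oplus>\<^bsub>V\<^esub>s\<in>S. c s \<odot>\<^bsub>V\<^esub> s)"
        using S(3) unfolding span_of_def by blast
      have cS: "c s \<in> carrier K" "s \<in> carrier V" if "s \<in> S" for s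
        using that c(1) S(2) by auto
      have "H v = (\<Oplus>\<^bsub>N\<^esub>s\<in>S. c s \<odot>\<^bsub>N\<^esub> H s)" if H: "H \<in> lin_maps K V N" for H
      proof -
        have "H v = (\<Oplus>\<^bsub>N\<^esub>s\<in>S. H (c s \<odot>\<^bsub>V\<^esub> s))"
          unfolding c(2) using c(1) S by (intro lin_maps_finsum[OF V.module_axioms N.module_axioms H]) auto
        also have "\<dots> = (\<Oplus>\<^bsub>N\<^esub>s\<in>S. c s \<odot>\<^bsub>N\<^esub> H s)"
          by (intro N.M.finsum_cong') (auto simp: cS lin_maps_smult[OF H] lin_maps_closed[OF H])
        finally show ?thesis .
      qed
      moreover have "(\<Oplus>\<^bsub>N\<^esub>s\<in>S. c s \<odot>\<^bsub>N\<^esub> F s) = (\<Oplus>\<^bsub>N\<^esub>s\<in>S. c s \<odot>\<^bsub>N\<^esub> F' s)"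
        by (intro N.M.finsum_cong') (auto simp: eq cS lin_maps_closed[OF F(2)])
      ultimately show "F v = F' v" using F by simp
    qed
  next
    assume "\<forall>v\<in>carrier V. F v = F' v"
    then have "restrict F S = restrict F' S" using S(2) by (intro restrict_ext) auto
    then show "e (restrict F S) = e (restrict F' S)" by simp
  qed
  have comm: "c \<odot>\<^bsub>N\<^esub> (d \<odot>\<^bsub>N\<^esub> x) = d \<odot>\<^bsub>N\<^esub> (c \<odot>\<^bsub>N\<^esub> x)"
    if "c \<in> carrier K" "d \<in> carrier K" "x \<in> carrier N" for c d x
    using that by (metis K.m_comm N.smult_assoc1)
  show ?thesis
  proof (rule function_rep_exists[OF N, where enc = "\<lambda>F. e (restrict F S)"
        and \<F> = "lin_maps K V N" and D = "carrier V" and \<delta> = "\<lambda>g. act V (inv\<^bsub>G\<^esub> g)"])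
    show "lin_maps K V N \<subseteq> carrier V \<rightarrow> carrier N" by (auto simp: lin_maps_def)
    show "(\<lambda>_. \<zero>\<^bsub>N\<^esub>) \<in> lin_maps K V N" by (auto intro: lin_mapsI)
    show "(\<lambda>v. F v \<oplus>\<^bsub>N\<^esub> F' v) \<in> lin_maps K V N" if F: "F \<in> lin_maps K V N" "F' \<in> lin_maps K V N" for F F'
      using lin_maps_closed[OF F(1)] lin_maps_closed[OF F(2)]
      by (intro lin_mapsI) (simp_all add: lin_maps_add[OF F(1)] lin_maps_add[OF F(2)]
          lin_maps_smult[OF F(1)] lin_maps_smult[OF F(2)] N.smult_r_distr N.M.a_ac)
    show "(\<lambda>v. c \<odot>\<^bsub>N\<^esub> F v) \<in> lin_maps K V N" if c: "c \<in> carrier K" and F: "F \<in> lin_maps K V N" for c F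
      using lin_maps_closed[OF F] c
      by (intro lin_mapsI) (simp_all add: lin_maps_add[OF F] lin_maps_smult[OF F] N.smult_r_distr comm)
    show "(\<lambda>v. act N g (F (act V (inv\<^bsub>G\<^esub> g) v))) \<in> lin_maps K V N"
      if "g \<in> carrier G" "F \<in> lin_maps K V N" for g F
      using that by (intro lin_maps_comp[OF lin_maps_comp[OF act_lin[OF VM] that(2)] act_lin[OF N]]) auto
    show "act V (inv\<^bsub>G\<^esub> g) v \<in> carrier V" if "g \<in> carrier G" "v \<in> carrier V" for g v
      using that act_closed[OF VM] by simp
    show "act V (inv\<^bsub>G\<^esub> \<one>\<^bsub>G\<^esub>) v = v" if "v \<in> carrier V" for v
      using that act_one[OF VM] by simp
    show "act V (inv\<^bsub>G\<^esub> (g \<otimes>\<^bsub>G\<^esub> h)) v = act V (inv\<^bsub>G\<^esub> h) (act V (inv\<^bsub>G\<^esub> g) v)"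
      if "g \<in> carrier G" "h \<in> carrier G" "v \<in> carrier V" for g h v
      using that by (simp add: G.inv_mult_group act_mult[OF VM])
  qed (use enc that in auto)
qed

end

section \<open>Endomorphisms of a finite dimensional module\<close>

text \<open>\<open>D\<close> is the dual of \<open>w\<close> and \<open>P\<close> its endomorphism
  module, decoded by \<phi> and \<open>ev\<close>. \<open>mk\<close> picks a code for each linear
  map and is unconstrained on other functions.\<close>

locale endomorphism_rep = kG_modules K G
  for K :: "('v, 'y) ring_scheme" and G :: "('g, 'z) monoid_scheme" +
  fixes w D P :: "('v, 'g) rep" and \<phi> ev :: "'v \<Rightarrow> 'v \<Rightarrow> 'v" and mk :: "('v \<Rightarrow> 'v) \<Rightarrow> 'v"
  assumes w: "w \<in> kG_Mod K G" and fd: "fin_dim K w"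
    and dual: "is_hom_rep w unit_rep D \<phi>"
    and endo: "is_hom_rep w w P ev"
    and mk: "A \<in> lin_maps K w w \<Longrightarrow> mk A \<in> carrier P"
    and ev_mk: "\<lbrakk>A \<in> lin_maps K w w; v \<in> carrier w\<rbrakk> \<Longrightarrow> ev (mk A) v = A v"
begin

text \<open>The canonical map from w \<otimes> D to End(w).\<close>

definition rank_one :: "'v \<Rightarrow> 'v \<Rightarrow> 'v"
  where "rank_one v \<mu> = mk (\<lambda>u. \<phi> \<mu> u \<odot>\<^bsub>w\<^esub> v)"

lemmas DM = function_rep_module[OF dual]
lemmas PM = function_rep_module[OF endo]

sublocale k: module K unit_rep by (rule module_unit_rep)
sublocale W: module K w using w by (rule kG_Mod_module)
sublocale D: module K D using DM by (rule kG_Mod_module)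
sublocale P: module K P using PM by (rule kG_Mod_module)

lemma \<phi>_simps:
  assumes "\<mu> \<in> carrier D"
  shows "u \<in> carrier w \<Longrightarrow> \<phi> \<mu> u \<in> carrier K"
    and "\<lbrakk>u \<in> carrier w; u' \<in> carrier w\<rbrakk> \<Longrightarrow> \<phi> \<mu> (u \<oplus>\<^bsub>w\<^esub> u') = \<phi> \<mu> u \<oplus>\<^bsub>K\<^esub> \<phi> \<mu> u'"
    and "\<lbrakk>c \<in> carrier K; u \<in> carrier w\<rbrakk> \<Longrightarrow> \<phi> \<mu> (c \<odot>\<^bsub>w\<^esub> u) = c \<otimes>\<^bsub>K\<^esub> \<phi> \<mu> u"
  using lin_mapsD[OF function_rep_mem[OF dual assms]] by simp_all

lemma \<phi>_lin:
  assumes "u \<in> carrier w"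
  shows "\<lbrakk>\<mu> \<in> carrier D; \<nu> \<in> carrier D\<rbrakk> \<Longrightarrow> \<phi> (\<mu> \<oplus>\<^bsub>D\<^esub> \<nu>) u = \<phi> \<mu> u \<oplus>\<^bsub>K\<^esub> \<phi> \<nu> u"
    and "\<lbrakk>c \<in> carrier K; \<mu> \<in> carrier D\<rbrakk> \<Longrightarrow> \<phi> (c \<odot>\<^bsub>D\<^esub> \<mu>) u = c \<otimes>\<^bsub>K\<^esub> \<phi> \<mu> u"
  using lin_mapsD[OF function_rep_lin[OF dual assms]] by simp_all

lemma ev_simps:
  assumes "x \<in> carrier P"
  shows "u \<in> carrier w \<Longrightarrow> ev x u \<in> carrier w"
    and "\<lbrakk>u \<in> carrier w; u' \<in> carrier w\<rbrakk> \<Longrightarrow> ev x (u \<oplus>\<^bsub>w\<^esub> u') = ev x u \<oplus>\<^bsub>w\<^esub> ev x u'"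
    and "\<lbrakk>c \<in> carrier K; u \<in> carrier w\<rbrakk> \<Longrightarrow> ev x (c \<odot>\<^bsub>w\<^esub> u) = c \<odot>\<^bsub>w\<^esub> ev x u"
  using lin_mapsD[OF function_rep_mem[OF endo assms]] by simp_all

lemma ev_lin:
  assumes "u \<in> carrier w"
  shows "\<lbrakk>x \<in> carrier P; y \<in> carrier P\<rbrakk> \<Longrightarrow> ev (x \<oplus>\<^bsub>P\<^esub> y) u = ev x u \<oplus>\<^bsub>w\<^esub> ev y u"
    and "\<lbrakk>c \<in> carrier K; x \<in> carrier P\<rbrakk> \<Longrightarrow> ev (c \<odot>\<^bsub>P\<^esub> x) u = c \<odot>\<^bsub>w\<^esub> ev x u"
  using lin_mapsD[OF function_rep_lin[OF endo assms]] by simp_all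

lemma smult_comm:
  "\<lbrakk>c \<in> carrier K; d \<in> carrier K; x \<in> carrier w\<rbrakk> \<Longrightarrow> c \<odot>\<^bsub>w\<^esub> (d \<odot>\<^bsub>w\<^esub> x) = d \<odot>\<^bsub>w\<^esub> (c \<odot>\<^bsub>w\<^esub> x)"
  by (metis K.m_comm W.smult_assoc1)

lemma rank_one_lin:
  assumes "v \<in> carrier w" and "\<mu> \<in> carrier D"
  shows "(\<lambda>u. \<phi> \<mu> u \<odot>\<^bsub>w\<^esub> v) \<in> lin_maps K w w"
  using assms by (intro lin_mapsI) (simp_all add: \<phi>_simps W.smult_l_distr W.smult_assoc1)

lemma rank_one_closed: "\<lbrakk>v \<in> carrier w; \<mu> \<in> carrier D\<rbrakk> \<Longrightarrow> rank_one v \<mu> \<in> carrier P"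
  unfolding rank_one_def using rank_one_lin by (rule mk)

lemma ev_rank_one:
  "\<lbrakk>v \<in> carrier w; \<mu> \<in> carrier D; u \<in> carrier w\<rbrakk> \<Longrightarrow> ev (rank_one v \<mu>) u = \<phi> \<mu> u \<odot>\<^bsub>w\<^esub> v"
  unfolding rank_one_def using rank_one_lin by (rule ev_mk)

lemma P_eq_iff: "\<lbrakk>x \<in> carrier P; y \<in> carrier P\<rbrakk> \<Longrightarrow> x = y \<longleftrightarrow> (\<forall>u\<in>carrier w. ev x u = ev y u)"
  using function_rep_ext[OF endo, of x y] by auto

lemma rank_one_bilinear: "bilinear K w D P rank_one"
proof -
  have "rank_one v \<in> lin_maps K D P" if "v \<in> carrier w" for v
    using that
    by (intro lin_mapsI) (simp_all add: rank_one_closed P_eq_iff ev_rank_one ev_lin \<phi>_lin \<phi>_simps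
        W.smult_l_distr W.smult_assoc1)
  moreover have "(\<lambda>v. rank_one v \<mu>) \<in> lin_maps K w P" if "\<mu> \<in> carrier D" for \<mu>
    using that
    by (intro lin_mapsI) (simp_all add: rank_one_closed P_eq_iff ev_rank_one ev_lin \<phi>_simps
        W.smult_r_distr smult_comm)
  ultimately show ?thesis by (simp add: bilinear_def)
qed

lemma ev_act: "\<lbrakk>g \<in> carrier G; x \<in> carrier P; u \<in> carrier w\<rbrakk> \<Longrightarrow>
    ev (act P g x) u = act w g (ev x (act w (inv\<^bsub>G\<^esub> g) u))"
  by (rule function_rep_act[OF endo])

lemma \<phi>_act: "\<lbrakk>g \<in> carrier G; \<mu> \<in> carrier D; u \<in> carrier w\<rbrakk> \<Longrightarrow>
    \<phi> (act D g \<mu>) u = \<phi> \<mu> (act w (inv\<^bsub>G\<^esub> g) u)"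
  using function_rep_act[OF dual] by simp

text \<open>Take a basis s with dual basis \<open>\<mu> s\<close>. Each endomorphism x is the sum of
  the \<open>rank_one (ev x s) (\<mu> s)\<close>, which dictates the lift and proves it unique; each
  functional \<nu> is the sum of \<nu>(s) \<open>\<mu> s\<close>, which confirms the lift on rank
  one maps. In particular \<open>P\<close> lies in P(w).\<close>

lemma is_tensor_endo: "is_tensor K G w D P rank_one"
proof -
  obtain S d where S: "finite S" "S \<subseteq> carrier w"
    and d: "\<And>s. s \<in> S \<Longrightarrow> d s \<in> lin_maps K w unit_rep"
    and sum: "\<And>x. x \<in> carrier w \<Longrightarrow> (\<Oplus>\<^bsub>w\<^esub>s\<in>S. d s x \<odot>\<^bsub>w\<^esub> s) = x"
    using dual_basis[OF W.module_axioms fd] by blast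
  have "\<exists>\<mu>. \<mu> \<in> carrier D \<and> (\<forall>u\<in>carrier w. \<phi> \<mu> u = d s u)" if "s \<in> S" for s
    using function_rep_ex[OF dual d[OF that]] by blast
  then obtain \<mu> where \<mu>: "\<And>s. s \<in> S \<Longrightarrow> \<mu> s \<in> carrier D"
    and \<phi>\<mu>: "\<And>s u. \<lbrakk>s \<in> S; u \<in> carrier w\<rbrakk> \<Longrightarrow> \<phi> (\<mu> s) u = d s u"
    by metis
  have sM: "s \<in> carrier w" if "s \<in> S" for s using that S(2) by auto
  have dK: "d s u \<in> carrier K" if "s \<in> S" "u \<in> carrier w" for s u
    using lin_maps_closed[OF d[OF that(1)] that(2)] by simp
  have expand_D: "(\<Oplus>\<^bsub>D\<^esub>s\<in>S. \<phi> \<nu> s \<odot>\<^bsub>D\<^esub> \<mu> s) = \<nu>" if \<nu>: "\<nu> \<in> carrier D" for \<nu>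
  proof (rule function_rep_ext[OF dual _ \<nu>])
    show "(\<Oplus>\<^bsub>D\<^esub>s\<in>S. \<phi> \<nu> s \<odot>\<^bsub>D\<^esub> \<mu> s) \<in> carrier D"
      using \<nu> by (intro D.M.finsum_closed) (auto simp: \<phi>_simps sM \<mu>)
    fix u assume u: "u \<in> carrier w"
    have "\<phi> (\<Oplus>\<^bsub>D\<^esub>s\<in>S. \<phi> \<nu> s \<odot>\<^bsub>D\<^esub> \<mu> s) u = (\<Oplus>\<^bsub>unit_rep\<^esub>s\<in>S. \<phi> (\<phi> \<nu> s \<odot>\<^bsub>D\<^esub> \<mu> s) u)"
      using S(1) \<nu> by (intro lin_maps_finsum[OF D.module_axioms k.module_axioms function_rep_lin[OF dual u]])
        (auto simp: \<phi>_simps sM \<mu>)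
    also have "\<dots> = (\<Oplus>\<^bsub>unit_rep\<^esub>s\<in>S. \<phi> \<nu> (d s u \<odot>\<^bsub>w\<^esub> s))"
      using u \<nu> by (intro k.M.finsum_cong') (auto simp: \<phi>_simps \<phi>_lin sM \<mu> \<phi>\<mu> dK K.m_comm)
    also have "\<dots> = \<phi> \<nu> (\<Oplus>\<^bsub>w\<^esub>s\<in>S. d s u \<odot>\<^bsub>w\<^esub> s)"
      using S(1) u by (intro lin_maps_finsum[symmetric, OF W.module_axioms k.module_axioms
            function_rep_mem[OF dual \<nu>]]) (auto simp: sM dK)
    finally show "\<phi> (\<Oplus>\<^bsub>D\<^esub>s\<in>S. \<phi> \<nu> s \<odot>\<^bsub>D\<^esub> \<mu> s) u = \<phi> \<nu> u" using sum[OF u] by simp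
  qed
  have expand_P: "(\<Oplus>\<^bsub>P\<^esub>s\<in>S. rank_one (ev x s) (\<mu> s)) = x" if x: "x \<in> carrier P" for x
  proof (rule function_rep_ext[OF endo _ x])
    show "(\<Oplus>\<^bsub>P\<^esub>s\<in>S. rank_one (ev x s) (\<mu> s)) \<in> carrier P"
      using x by (intro P.M.finsum_closed) (auto simp: rank_one_closed ev_simps sM \<mu>)
    fix u assume u: "u \<in> carrier w"
    have "ev (\<Oplus>\<^bsub>P\<^esub>s\<in>S. rank_one (ev x s) (\<mu> s)) u = (\<Oplus>\<^bsub>w\<^esub>s\<in>S. ev (rank_one (ev x s) (\<mu> s)) u)"
      using S(1) x by (intro lin_maps_finsum[OF P.module_axioms W.module_axioms function_rep_lin[OF endo u]])
        (auto simp: rank_one_closed ev_simps sM \<mu>)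
    also have "\<dots> = (\<Oplus>\<^bsub>w\<^esub>s\<in>S. ev x (d s u \<odot>\<^bsub>w\<^esub> s))"
      using u x by (intro W.M.finsum_cong') (auto simp: ev_rank_one ev_simps sM \<mu> \<phi>\<mu> dK)
    also have "\<dots> = ev x (\<Oplus>\<^bsub>w\<^esub>s\<in>S. d s u \<odot>\<^bsub>w\<^esub> s)"
      using S(1) u by (intro lin_maps_finsum[symmetric, OF W.module_axioms W.module_axioms
            function_rep_mem[OF endo x]]) (auto simp: sM dK)
    finally show "ev (\<Oplus>\<^bsub>P\<^esub>s\<in>S. rank_one (ev x s) (\<mu> s)) u = ev x u" using sum[OF u] by simp
  qed
  show ?thesis
    unfolding is_tensor_def
  proof (intro conjI allI impI ballI)
    show "act P g (rank_one v \<nu>) = rank_one (act w g v) (act D g \<nu>)"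
      if g: "g \<in> carrier G" and "v \<in> carrier w" "\<nu> \<in> carrier D" for g v \<nu>
      using that act_closed[OF w] act_closed[OF DM] act_closed[OF PM] lin_maps_smult[OF act_lin[OF w g]]
      by (simp add: P_eq_iff rank_one_closed ev_act ev_rank_one \<phi>_act \<phi>_simps)
  next
    fix U :: "('v, 'v) module" and b assume U: "module K U \<and> bilinear K w D U b"
    then interpret U: module K U by simp
    have b1: "(\<lambda>v. b v \<nu>) \<in> lin_maps K w U" if "\<nu> \<in> carrier D" for \<nu>
      using U that by (auto intro: bilinear_lin1)
    have b2: "b v \<in> lin_maps K D U" if "v \<in> carrier w" for v
      using U that by (auto intro: bilinear_lin2)
    note bU = lin_maps_closed[OF b2]
    let ?h = "\<lambda>x. \<Oplus>\<^bsub>U\<^esub>s\<in>S. b (ev x s) (\<mu> s)"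
    have "?h \<in> lin_maps K P U"
    proof (rule lin_mapsI)
      show "?h x \<in> carrier U" if "x \<in> carrier P" for x
        using that by (intro U.M.finsum_closed) (auto simp: bU ev_simps sM \<mu>)
      show "?h (x \<oplus>\<^bsub>P\<^esub> y) = ?h x \<oplus>\<^bsub>U\<^esub> ?h y" if "x \<in> carrier P" "y \<in> carrier P" for x y
      proof -
        have "?h (x \<oplus>\<^bsub>P\<^esub> y) = (\<Oplus>\<^bsub>U\<^esub>s\<in>S. b (ev x s) (\<mu> s) \<oplus>\<^bsub>U\<^esub> b (ev y s) (\<mu> s))"
          using that by (intro U.M.finsum_cong') (auto simp: bU ev_simps sM \<mu> ev_lin lin_maps_add[OF b1])
        also have "\<dots> = ?h x \<oplus>\<^bsub>U\<^esub> ?h y"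
          using that by (intro U.M.finsum_addf) (auto simp: bU ev_simps sM \<mu>)
        finally show ?thesis .
      qed
      show "?h (c \<odot>\<^bsub>P\<^esub> x) = c \<odot>\<^bsub>U\<^esub> ?h x" if "c \<in> carrier K" "x \<in> carrier P" for c x
      proof -
        have "?h (c \<odot>\<^bsub>P\<^esub> x) = (\<Oplus>\<^bsub>U\<^esub>s\<in>S. c \<odot>\<^bsub>U\<^esub> b (ev x s) (\<mu> s))"
          using that by (intro U.M.finsum_cong') (auto simp: bU ev_simps sM \<mu> ev_lin lin_maps_smult[OF b1])
        also have "\<dots> = c \<odot>\<^bsub>U\<^esub> ?h x"
          using that S(1) by (intro U.finsum_smult_ldistr[symmetric]) (auto simp: bU ev_simps sM \<mu>)
        finally show ?thesis .
      qed
    qed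
    moreover have "?h (rank_one v \<nu>) = b v \<nu>" if v: "v \<in> carrier w" and \<nu>: "\<nu> \<in> carrier D" for v \<nu>
    proof -
      have "?h (rank_one v \<nu>) = (\<Oplus>\<^bsub>U\<^esub>s\<in>S. b v (\<phi> \<nu> s \<odot>\<^bsub>D\<^esub> \<mu> s))"
        using v \<nu> by (intro U.M.finsum_cong')
          (auto simp: bU sM \<mu> ev_rank_one \<phi>_simps lin_maps_smult[OF b1] lin_maps_smult[OF b2])
      also have "\<dots> = b v (\<Oplus>\<^bsub>D\<^esub>s\<in>S. \<phi> \<nu> s \<odot>\<^bsub>D\<^esub> \<mu> s)"
        using S(1) \<nu> by (intro lin_maps_finsum[symmetric, OF D.module_axioms U.module_axioms b2[OF v]])
          (auto simp: \<phi>_simps sM \<mu>)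
      finally show ?thesis using expand_D[OF \<nu>] by simp
    qed
    ultimately show "\<exists>h\<in>lin_maps K P U. \<forall>v\<in>carrier w. \<forall>\<nu>\<in>carrier D. h (rank_one v \<nu>) = b v \<nu>"
      by (intro bexI[of _ ?h]) auto
  next
    fix U :: "('v, 'v) module" and b h h' x
    assume U: "module K U \<and> bilinear K w D U b" and h: "h \<in> lin_maps K P U" "h' \<in> lin_maps K P U"
      and eq: "\<forall>v\<in>carrier w. \<forall>\<nu>\<in>carrier D. h (rank_one v \<nu>) = h' (rank_one v \<nu>)" and x: "x \<in> carrier P"
    interpret U: module K U using U by simp
    have *: "f x = (\<Oplus>\<^bsub>U\<^esub>s\<in>S. f (rank_one (ev x s) (\<mu> s)))" if f: "f \<in> lin_maps K P U" for f
      using lin_maps_finsum[OF P.module_axioms U.module_axioms f S(1), of "\<lambda>s. rank_one (ev x s) (\<mu> s)"]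
        expand_P[OF x] x by (auto simp: rank_one_closed ev_simps sM \<mu>)
    have "(\<Oplus>\<^bsub>U\<^esub>s\<in>S. h (rank_one (ev x s) (\<mu> s))) = (\<Oplus>\<^bsub>U\<^esub>s\<in>S. h' (rank_one (ev x s) (\<mu> s)))"
      using x eq by (intro U.M.finsum_cong')
        (auto simp: lin_maps_closed[OF h(2)] rank_one_closed ev_simps sM \<mu>)
    then show "h x = h' x" using *[OF h(1)] *[OF h(2)] by simp
  qed (use PM rank_one_bilinear in auto)
qed

section \<open>The trace and lifting along the quotient by the identity\<close>

text \<open>The trace is the lift of the evaluation pairing, so no basis enters, and invariance
  under conjugation follows from invariance of the pairing.\<close>

lemma trace_exists:
  obtains tr where "tr \<in> lin_maps K P unit_rep"
    and "\<And>v \<mu>. \<lbrakk>v \<in> carrier w; \<mu> \<in> carrier D\<rbrakk> \<Longrightarrow> tr (rank_one v \<mu>) = \<phi> \<mu> v"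
    and "\<And>g x. \<lbrakk>g \<in> carrier G; x \<in> carrier P\<rbrakk> \<Longrightarrow> tr (act P g x) = tr x"
proof -
  have "bilinear K w D unit_rep (\<lambda>v \<mu>. \<phi> \<mu> v)"
    by (auto simp: bilinear_def \<phi>_simps \<phi>_lin intro!: lin_mapsI)
  then obtain tr where tr: "tr \<in> lin_maps K P unit_rep"
    "\<And>v \<mu>. \<lbrakk>v \<in> carrier w; \<mu> \<in> carrier D\<rbrakk> \<Longrightarrow> tr (rank_one v \<mu>) = \<phi> \<mu> v"
    using is_tensor_lift[OF is_tensor_endo k.module_axioms] by blast
  have "tr (act P g x) = tr x" if g: "g \<in> carrier G" and x: "x \<in> carrier P" for g x
  proof (rule is_tensor_unique[OF is_tensor_endo k.module_axioms _ tr(1) _ x])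
    show "(\<lambda>x. tr (act P g x)) \<in> lin_maps K P unit_rep"
      using lin_maps_comp[OF act_lin[OF PM g] tr(1)] .
    fix v \<mu> assume "v \<in> carrier w" "\<mu> \<in> carrier D"
    then show "tr (act P g (rank_one v \<mu>)) = tr (rank_one v \<mu>)"
      using g by (simp add: is_tensor_act[OF is_tensor_endo] tr(2) act_closed[OF w] act_closed[OF DM]
          \<phi>_act act_inv[OF w])
  qed
  then show ?thesis using that tr by blast
qed

text \<open>Two lifts of \<open>f\<close> along \<open>\<pi>\<close> differ by multiples of the identity endomorphism \<open>e\<close>, so for
  fixed \<open>y\<close> there is exactly one lift \<open>h\<close> for which \<open>u \<mapsto> h (u \<otimes> y) v\<close> has trace zero for all \<open>v\<close>.
  Subtracting \<open>\<rho> v y\<close> times \<open>e\<close> achieves this, and uniqueness makes \<open>h\<close> equivariant.\<close>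

lemma lift_along_identity_quotient:
  assumes e: "e \<in> carrier P" "\<And>u. u \<in> carrier w \<Longrightarrow> ev e u = u"
    and \<tau>: "\<tau> \<in> lin_maps K P unit_rep"
    and SM: "S \<in> kG_Mod K G" and \<pi>hom: "\<pi> \<in> Hom K G P S"
    and S: "carrier S \<subseteq> carrier P" "add S = add P" "smult S = smult P"
      "\<And>g x. act S g x = \<pi> (act P g x)"
    and \<pi>: "\<And>x. \<pi> x = x \<ominus>\<^bsub>P\<^esub> \<tau> x \<odot>\<^bsub>P\<^esub> e" "\<And>x. x \<in> carrier S \<Longrightarrow> \<pi> x = x"
      "\<And>c x. \<lbrakk>c \<in> carrier K; x \<in> carrier P\<rbrakk> \<Longrightarrow> \<pi> (x \<oplus>\<^bsub>P\<^esub> c \<odot>\<^bsub>P\<^esub> e) = \<pi> x"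
    and T: "is_tensor K G w Y T \<beta>" and Y: "Y \<in> kG_Mod K G" and f: "f \<in> Hom K G T S"
  obtains h where "h \<in> Hom K G T P" "\<And>t. t \<in> carrier T \<Longrightarrow> \<pi> (h t) = f t"
proof -
  have TM: "T \<in> kG_Mod K G" using T by (rule is_tensor_module)
  interpret S: module K S using SM by (rule kG_Mod_module)
  note b1 = bilinear_lin1[OF is_tensor_bilinear[OF T]] and b2 = bilinear_lin2[OF is_tensor_bilinear[OF T]]
  obtain tr where tr: "tr \<in> lin_maps K P unit_rep"
    and tr_rank_one: "\<And>v \<mu>. \<lbrakk>v \<in> carrier w; \<mu> \<in> carrier D\<rbrakk> \<Longrightarrow> tr (rank_one v \<mu>) = \<phi> \<mu> v"
    and tr_act: "\<And>g x. \<lbrakk>g \<in> carrier G; x \<in> carrier P\<rbrakk> \<Longrightarrow> tr (act P g x) = tr x"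
    using trace_exists by blast
  define Tr where "Tr = (\<lambda>A. tr (mk A))"
  have Tr_closed: "Tr A \<in> carrier K" if "A \<in> lin_maps K w w" for A
    using lin_maps_closed[OF tr mk[OF that]] by (simp add: Tr_def)
  have Tr_add: "Tr C = Tr A \<oplus>\<^bsub>K\<^esub> Tr B"
    if "A \<in> lin_maps K w w" "B \<in> lin_maps K w w" "C \<in> lin_maps K w w"
      "\<And>u. u \<in> carrier w \<Longrightarrow> C u = A u \<oplus>\<^bsub>w\<^esub> B u" for A B C
  proof -
    have "mk C = mk A \<oplus>\<^bsub>P\<^esub> mk B" using that by (simp add: P_eq_iff mk ev_mk ev_lin)
    then show ?thesis using lin_maps_add[OF tr] that(1,2) mk by (simp add: Tr_def)
  qed
  have Tr_smult: "Tr C = c \<otimes>\<^bsub>K\<^esub> Tr A"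
    if "c \<in> carrier K" "A \<in> lin_maps K w w" "C \<in> lin_maps K w w"
      "\<And>u. u \<in> carrier w \<Longrightarrow> C u = c \<odot>\<^bsub>w\<^esub> A u" for c A C
  proof -
    have "mk C = c \<odot>\<^bsub>P\<^esub> mk A" using that by (simp add: P_eq_iff mk ev_mk ev_lin)
    then show ?thesis using lin_maps_smult[OF tr] that(1,2) mk by (simp add: Tr_def)
  qed
  have Tr_conj: "Tr C = Tr A"
    if "g \<in> carrier G" "A \<in> lin_maps K w w" "C \<in> lin_maps K w w"
      "\<And>u. u \<in> carrier w \<Longrightarrow> C u = act w g (A (act w (inv\<^bsub>G\<^esub> g) u))" for g A C
  proof -
    have "mk C = act P g (mk A)"
      using that act_closed[OF w] act_closed[OF PM] by (simp add: P_eq_iff mk ev_mk ev_act)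
    then show ?thesis using tr_act that(1,2) mk by (simp add: Tr_def)
  qed
  have Tr_rank_one: "Tr C = l v"
    if l: "l \<in> lin_maps K w unit_rep" and v: "v \<in> carrier w" and C: "C \<in> lin_maps K w w"
      "\<And>u. u \<in> carrier w \<Longrightarrow> C u = l u \<odot>\<^bsub>w\<^esub> v" for l v C
  proof -
    obtain \<mu> where \<mu>: "\<mu> \<in> carrier D" "\<And>u. u \<in> carrier w \<Longrightarrow> \<phi> \<mu> u = l u"
      using function_rep_ex[OF dual l] by blast
    have "mk C = rank_one v \<mu>"
      using C v \<mu> by (simp add: P_eq_iff mk ev_mk rank_one_closed ev_rank_one)
    then show ?thesis using tr_rank_one v \<mu> by (simp add: Tr_def)
  qed
  have F_closed: "f t \<in> carrier P" if "t \<in> carrier T" for t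
    using lin_maps_closed[OF Hom_lin[OF f] that] S(1) by auto
  \<comment> \<open>Seen as a map into \<open>P\<close>, \<open>f\<close> is only linear: the action
    on \<open>S\<close> differs from that on \<open>P\<close> by multiples of
    \<open>e\<close>.\<close>
  have f_lin: "f \<in> lin_maps K T P"
    using Hom_lin[OF f] S by (auto simp: lin_maps_def)
  define F where "F = (\<lambda>v y. f (\<beta> v y))"
  have F1: "(\<lambda>v. F v y) \<in> lin_maps K w P" if "y \<in> carrier Y" for y
    unfolding F_def using lin_maps_comp[OF b1[OF that] f_lin] .
  have F2: "F v \<in> lin_maps K Y P" if "v \<in> carrier w" for v
    unfolding F_def using lin_maps_comp[OF b2[OF that] f_lin] .
  note FP = lin_maps_closed[OF F2]
  \<comment> \<open>The variable is the tensor factor u, while \<open>v\<close> is fed to the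
    resulting endomorphism \<open>F u y\<close>.\<close>
  define A where "A = (\<lambda>v y u. ev (F u y) v)"
  have A: "A v y \<in> lin_maps K w w" if "v \<in> carrier w" "y \<in> carrier Y" for v y
    unfolding A_def using lin_maps_comp[OF F1[OF that(2)] function_rep_lin[OF endo that(1)]] .
  define \<rho> where "\<rho> = (\<lambda>v y. Tr (A v y))"
  have \<rho>K: "\<rho> v y \<in> carrier K" if "v \<in> carrier w" "y \<in> carrier Y" for v y
    unfolding \<rho>_def by (rule Tr_closed[OF A[OF that]])
  interpret Y: module K Y using Y by (rule kG_Mod_module)
  have \<rho>1: "(\<lambda>v. \<rho> v y) \<in> lin_maps K w unit_rep" if y: "y \<in> carrier Y" for y
  proof (rule lin_mapsI)
    fix v v' assume v: "v \<in> carrier w" "v' \<in> carrier w"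
    have "Tr (A (v \<oplus>\<^bsub>w\<^esub> v') y) = Tr (A v y) \<oplus>\<^bsub>K\<^esub> Tr (A v' y)"
      using v y by (intro Tr_add A) (auto simp: A_def ev_simps FP)
    then show "\<rho> (v \<oplus>\<^bsub>w\<^esub> v') y = \<rho> v y \<oplus>\<^bsub>unit_rep\<^esub> \<rho> v' y" by (simp add: \<rho>_def)
  next
    fix c v assume v: "c \<in> carrier K" "v \<in> carrier w"
    have "Tr (A (c \<odot>\<^bsub>w\<^esub> v) y) = c \<otimes>\<^bsub>K\<^esub> Tr (A v y)"
      using v y by (intro Tr_smult A) (auto simp: A_def ev_simps FP)
    then show "\<rho> (c \<odot>\<^bsub>w\<^esub> v) y = c \<odot>\<^bsub>unit_rep\<^esub> \<rho> v y" by (simp add: \<rho>_def)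
  qed (use \<rho>K y in simp)
  have \<rho>2: "\<rho> v \<in> lin_maps K Y unit_rep" if v: "v \<in> carrier w" for v
  proof (rule lin_mapsI)
    fix y y' assume y: "y \<in> carrier Y" "y' \<in> carrier Y"
    have "Tr (A v (y \<oplus>\<^bsub>Y\<^esub> y')) = Tr (A v y) \<oplus>\<^bsub>K\<^esub> Tr (A v y')"
      using v y by (intro Tr_add A) (auto simp: A_def lin_maps_add[OF F2] ev_lin FP)
    then show "\<rho> v (y \<oplus>\<^bsub>Y\<^esub> y') = \<rho> v y \<oplus>\<^bsub>unit_rep\<^esub> \<rho> v y'" by (simp add: \<rho>_def)
  next
    fix c y assume y: "c \<in> carrier K" "y \<in> carrier Y"
    have "Tr (A v (c \<odot>\<^bsub>Y\<^esub> y)) = c \<otimes>\<^bsub>K\<^esub> Tr (A v y)"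
      using v y by (intro Tr_smult A) (auto simp: A_def lin_maps_smult[OF F2] ev_lin FP)
    then show "\<rho> v (c \<odot>\<^bsub>Y\<^esub> y) = c \<odot>\<^bsub>unit_rep\<^esub> \<rho> v y" by (simp add: \<rho>_def)
  qed (use \<rho>K v in simp)
  let ?sub = "\<lambda>x c. x \<oplus>\<^bsub>P\<^esub> (\<ominus>\<^bsub>K\<^esub> c) \<odot>\<^bsub>P\<^esub> e"
  have sub_lin: "(\<lambda>x. ?sub (p x) (r x)) \<in> lin_maps K N P"
    if p: "p \<in> lin_maps K N P" and r: "r \<in> lin_maps K N unit_rep" for p r and N :: "('v, 'g) rep"
  proof (rule lin_mapsI)
    have pr: "p x \<in> carrier P" "r x \<in> carrier K" if "x \<in> carrier N" for x
      using lin_maps_closed[OF p that] lin_maps_closed[OF r that] by simp_all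
    show "?sub (p x) (r x) \<in> carrier P" if "x \<in> carrier N" for x
      using pr[OF that] e(1) by simp
    show "?sub (p (x \<oplus>\<^bsub>N\<^esub> y)) (r (x \<oplus>\<^bsub>N\<^esub> y)) = ?sub (p x) (r x) \<oplus>\<^bsub>P\<^esub> ?sub (p y) (r y)"
      if "x \<in> carrier N" "y \<in> carrier N" for x y
      using pr that e(1) lin_maps_add[OF r that]
      by (simp add: lin_maps_add[OF p that] K.minus_add P.smult_l_distr P.M.a_ac)
    show "?sub (p (c \<odot>\<^bsub>N\<^esub> x)) (r (c \<odot>\<^bsub>N\<^esub> x)) = c \<odot>\<^bsub>P\<^esub> ?sub (p x) (r x)"
      if "c \<in> carrier K" "x \<in> carrier N" for c x
      using pr that e(1) lin_maps_smult[OF r that]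
      by (simp add: lin_maps_smult[OF p that] P.smult_r_distr K.r_minus flip: P.smult_assoc1)
  qed
  have "bilinear K w Y P (\<lambda>v y. ?sub (F v y) (\<rho> v y))"
    unfolding bilinear_def using sub_lin[OF F1 \<rho>1] sub_lin[OF F2 \<rho>2] by blast
  then obtain h where h: "h \<in> lin_maps K T P"
    "\<And>v y. \<lbrakk>v \<in> carrier w; y \<in> carrier Y\<rbrakk> \<Longrightarrow> h (\<beta> v y) = ?sub (F v y) (\<rho> v y)"
    using is_tensor_lift[OF T P.module_axioms] by blast
  have "\<pi> (h t) = f t" if t: "t \<in> carrier T" for t
  proof (rule is_tensor_unique[OF T S.module_axioms _ Hom_lin[OF f] _ t])
    show "(\<lambda>t. \<pi> (h t)) \<in> lin_maps K T S" using lin_maps_comp[OF h(1) Hom_lin[OF \<pi>hom]] .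
    fix v y assume vy: "v \<in> carrier w" "y \<in> carrier Y"
    have "\<beta> v y \<in> carrier T" using lin_maps_closed[OF b2] vy by blast
    then have "\<pi> (F v y) = f (\<beta> v y)"
      unfolding F_def using lin_maps_closed[OF Hom_lin[OF f]] by (intro \<pi>(2)) blast
    then show "\<pi> (h (\<beta> v y)) = f (\<beta> v y)"
      using vy FP \<rho>K by (simp add: h(2) \<pi>(3))
  qed
  moreover have "h (act T g t) = act P g (h t)" if g: "g \<in> carrier G" and t: "t \<in> carrier T" for g t
  proof (rule is_tensor_unique[OF T P.module_axioms _ _ _ t])
    show "(\<lambda>t. h (act T g t)) \<in> lin_maps K T P" "(\<lambda>t. act P g (h t)) \<in> lin_maps K T P"
      using lin_maps_comp[OF act_lin[OF TM g] h(1)] lin_maps_comp[OF h(1) act_lin[OF PM g]] by auto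
    fix v y assume v: "v \<in> carrier w" and y: "y \<in> carrier Y"
    let ?z = "\<lambda>u. act P g (F u y)"
    have z: "?z \<in> lin_maps K w P" using lin_maps_comp[OF F1[OF y] act_lin[OF PM g]] .
    have l: "(\<lambda>u. \<tau> (?z u)) \<in> lin_maps K w unit_rep" using lin_maps_comp[OF z \<tau>] .
    have zP: "?z u \<in> carrier P" and lK: "\<tau> (?z u) \<in> carrier K" if "u \<in> carrier w" for u
      using lin_maps_closed[OF z that] lin_maps_closed[OF l that] by simp_all
    have gy: "act Y g y \<in> carrier Y" using act_closed[OF Y g y] .
    have gw: "act w g u \<in> carrier w" "act w (inv\<^bsub>G\<^esub> g) u \<in> carrier w" if "u \<in> carrier w" for u
      using act_closed[OF w] g that by simp_all
    \<comment> \<open>Equivariance of \<open>f\<close> for the corrected action of \<open>S\<close>,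
      with the \<tau> term as its defect in \<open>P\<close>.\<close>
    have Fg: "F (act w g u) (act Y g y) = ?sub (?z u) (\<tau> (?z u))" if u: "u \<in> carrier w" for u
    proof -
      have "\<beta> u y \<in> carrier T" using lin_maps_closed[OF b2[OF u] y] .
      then have "F (act w g u) (act Y g y) = \<pi> (?z u)"
        using Hom_act[OF f g, of "\<beta> u y"] is_tensor_act[OF T g u y] S(4) by (simp add: F_def)
      also have "\<dots> = ?sub (?z u) (\<tau> (?z u))"
        using zP[OF u] lK[OF u] e(1) by (simp add: \<pi>(1) P.M.minus_eq P.smult_l_minus)
      finally show ?thesis .
    qed
    let ?L = "\<lambda>u. (\<ominus>\<^bsub>K\<^esub> \<tau> (?z u)) \<odot>\<^bsub>w\<^esub> v"
    have negl: "(\<lambda>u. \<ominus>\<^bsub>K\<^esub> \<tau> (?z u)) \<in> lin_maps K w unit_rep"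
    proof (rule lin_mapsI)
      show "\<ominus>\<^bsub>K\<^esub> \<tau> (?z (u \<oplus>\<^bsub>w\<^esub> u')) = \<ominus>\<^bsub>K\<^esub> \<tau> (?z u) \<oplus>\<^bsub>unit_rep\<^esub> \<ominus>\<^bsub>K\<^esub> \<tau> (?z u')"
        if "u \<in> carrier w" "u' \<in> carrier w" for u u'
        using lin_maps_add[OF l that] lK that by (simp add: K.minus_add)
      show "\<ominus>\<^bsub>K\<^esub> \<tau> (?z (c \<odot>\<^bsub>w\<^esub> u)) = c \<odot>\<^bsub>unit_rep\<^esub> (\<ominus>\<^bsub>K\<^esub> \<tau> (?z u))"
        if "c \<in> carrier K" "u \<in> carrier w" for c u
        using lin_maps_smult[OF l that] lK that by (simp add: K.r_minus)
    qed (use lK in simp)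
    note negl_simps = lin_mapsD[OF negl, simplified]
    have L: "?L \<in> lin_maps K w w"
      using v lK
      by (intro lin_mapsI) (simp_all add: negl_simps W.smult_l_distr W.smult_assoc1)
    \<comment> \<open>\<open>A\<close> at (g v, g y) is the conjugate by g of \<open>B\<close>, in
      which the defect of \<open>F\<close> appears as the rank one map \<open>?L\<close>.\<close>
    define B where "B = (\<lambda>u. A v y u \<oplus>\<^bsub>w\<^esub> ?L u)"
    have Av: "A v y u \<in> carrier w" and Lv: "?L u \<in> carrier w" if "u \<in> carrier w" for u
      using lin_maps_closed[OF A[OF v y] that] lin_maps_closed[OF L that] by simp_all
    have B: "B \<in> lin_maps K w w"
      unfolding B_def using v y Av Lv
      by (intro lin_mapsI) (simp_all add: lin_maps_add[OF A] lin_maps_smult[OF A] lin_maps_add[OF L]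
          lin_maps_smult[OF L] W.smult_r_distr W.M.a_ac)
    have "A (act w g v) (act Y g y) u = act w g (B (act w (inv\<^bsub>G\<^esub> g) u))" if u: "u \<in> carrier w" for u
    proof -
      let ?u = "act w (inv\<^bsub>G\<^esub> g) u"
      note u' = gw(2)[OF u]
      have "A (act w g v) (act Y g y) u = ev (F (act w g ?u) (act Y g y)) (act w g v)"
        using act_inv(1)[OF w g u] by (simp add: A_def)
      also have "\<dots> = ev (?z ?u) (act w g v) \<oplus>\<^bsub>w\<^esub> (\<ominus>\<^bsub>K\<^esub> \<tau> (?z ?u)) \<odot>\<^bsub>w\<^esub> act w g v"
        using u' zP lK gw(1)[OF v] e by (simp add: Fg ev_lin)
      also have "\<dots> = act w g (A v y ?u) \<oplus>\<^bsub>w\<^esub> act w g (?L ?u)"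
        using u' v y g FP lK gw lin_maps_smult[OF act_lin[OF w g]]
        by (simp add: ev_act act_inv[OF w] A_def)
      also have "\<dots> = act w g (B ?u)"
        unfolding B_def using lin_maps_add[OF act_lin[OF w g] Av[OF u'] Lv[OF u']] by simp
      finally show ?thesis .
    qed
    then have "\<rho> (act w g v) (act Y g y) = Tr B"
      unfolding \<rho>_def using gw(1)[OF v] gy by (intro Tr_conj[OF g B A])
    also have "\<dots> = \<rho> v y \<oplus>\<^bsub>K\<^esub> Tr ?L"
      unfolding \<rho>_def by (rule Tr_add[OF A[OF v y] L B]) (simp add: B_def)
    \<comment> \<open>A rank one map has as trace its functional at its vector, so the defect
      returns evaluated at \<open>v\<close>.\<close>
    also have "Tr ?L = \<ominus>\<^bsub>K\<^esub> \<tau> (?z v)"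
      by (rule Tr_rank_one[OF negl v L]) simp
    finally have \<rho>g: "\<rho> (act w g v) (act Y g y) = \<rho> v y \<oplus>\<^bsub>K\<^esub> \<ominus>\<^bsub>K\<^esub> \<tau> (?z v)" .
    have ge: "act P g e = e"
      using g gw e act_closed[OF PM g e(1)] by (simp add: P_eq_iff ev_act act_inv[OF w])
    have "h (act T g (\<beta> v y)) = ?sub (?sub (?z v) (\<tau> (?z v))) (\<rho> v y \<oplus>\<^bsub>K\<^esub> \<ominus>\<^bsub>K\<^esub> \<tau> (?z v))"
      using g v y gw gy by (simp add: is_tensor_act[OF T] h(2) Fg \<rho>g)
    \<comment> \<open>The \<tau> term from \<open>F\<close> cancels against the one from \<rho>,
      which is what makes \<open>h\<close> equivariant.\<close>
    also have "\<dots> = ?sub (?z v) (\<rho> v y)"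
    proof -
      note K = lK[OF v] \<rho>K[OF v y]
      have "(\<ominus>\<^bsub>K\<^esub> \<tau> (?z v)) \<oplus>\<^bsub>K\<^esub> (\<ominus>\<^bsub>K\<^esub> (\<rho> v y \<oplus>\<^bsub>K\<^esub> \<ominus>\<^bsub>K\<^esub> \<tau> (?z v))) = \<ominus>\<^bsub>K\<^esub> \<rho> v y"
        using K by (simp add: K.minus_add K.a_lcomm K.l_neg)
      moreover have "?sub (?sub (?z v) (\<tau> (?z v))) (\<rho> v y \<oplus>\<^bsub>K\<^esub> \<ominus>\<^bsub>K\<^esub> \<tau> (?z v)) =
          ?z v \<oplus>\<^bsub>P\<^esub> ((\<ominus>\<^bsub>K\<^esub> \<tau> (?z v)) \<oplus>\<^bsub>K\<^esub> (\<ominus>\<^bsub>K\<^esub> (\<rho> v y \<oplus>\<^bsub>K\<^esub> \<ominus>\<^bsub>K\<^esub> \<tau> (?z v)))) \<odot>\<^bsub>P\<^esub> e"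
        using K zP[OF v] e(1) by (simp add: P.smult_l_distr P.M.a_assoc del: K.minus_add)
      ultimately show ?thesis by simp
    qed
    also have "\<dots> = act P g (h (\<beta> v y))"
      using v y FP \<rho>K e(1) lin_maps_add[OF act_lin[OF PM g]] lin_maps_smult[OF act_lin[OF PM g]]
      by (simp add: h(2) ge)
    finally show "h (act T g (\<beta> v y)) = act P g (h (\<beta> v y))" .
  qed
  ultimately show ?thesis using that HomI[OF h(1)] by blast
qed

section \<open>A shift of the trivial module for every finite dimensional \<open>w\<close>\<close>

text \<open>A linear functional with value 1 at the identity endomorphism is needed. A multiple of
  the trace will not do when dim w vanishes in the field, so a matrix entry is used; it need not be
  G-invariant.\<close>

lemma shift_model_endo:
  assumes v: "v \<in> carrier w" "v \<noteq> \<zero>\<^bsub>w\<^esub>"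
  obtains S \<iota> \<pi> where "shift_model K G w unit_rep P S \<iota> \<pi>"
proof -
  define e where "e = mk id"
  have idl: "id \<in> lin_maps K w w" by (auto intro: lin_mapsI)
  have e: "e \<in> carrier P" "\<And>u. u \<in> carrier w \<Longrightarrow> ev e u = u"
    using mk[OF idl] ev_mk[OF idl] by (simp_all add: e_def)
  have ge: "act P g e = e" if "g \<in> carrier G" for g
    using that e act_closed[OF PM that e(1)] act_closed[OF w] by (simp add: P_eq_iff ev_act act_inv[OF w])
  obtain S d where S: "finite S" "S \<subseteq> carrier w"
    and d: "\<And>s. s \<in> S \<Longrightarrow> d s \<in> lin_maps K w unit_rep"
    and sum: "\<And>x. x \<in> carrier w \<Longrightarrow> (\<Oplus>\<^bsub>w\<^esub>s\<in>S. d s x \<odot>\<^bsub>w\<^esub> s) = x"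
    using dual_basis[OF W.module_axioms fd] by blast
  have "\<exists>s\<in>S. d s v \<noteq> \<zero>\<^bsub>K\<^esub>"
  proof (rule ccontr)
    assume "\<not> (\<exists>s\<in>S. d s v \<noteq> \<zero>\<^bsub>K\<^esub>)"
    then have "(\<Oplus>\<^bsub>w\<^esub>s\<in>S. d s v \<odot>\<^bsub>w\<^esub> s) = \<zero>\<^bsub>w\<^esub>"
      using S(2) by (intro W.M.add.finprod_one_eqI) auto
    then show False using sum[OF v(1)] v(2) by simp
  qed
  then obtain s where s: "s \<in> S" "d s v \<noteq> \<zero>\<^bsub>K\<^esub>" by blast
  have dK: "d s u \<in> carrier K" if "u \<in> carrier w" for u
    using lin_maps_closed[OF d[OF s(1)] that] by simp
  have unit: "d s v \<in> Units K" using s(2) dK[OF v(1)] by (simp add: K.field_Units)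
  \<comment> \<open>A coordinate of the image of \<open>v\<close>, scaled by the nonzero coordinate
    of \<open>v\<close> itself.\<close>
  define \<tau> where "\<tau> = (\<lambda>x. inv\<^bsub>K\<^esub> (d s v) \<otimes>\<^bsub>K\<^esub> d s (ev x v))"
  have "(\<lambda>c. inv\<^bsub>K\<^esub> (d s v) \<otimes>\<^bsub>K\<^esub> c) \<in> lin_maps K unit_rep unit_rep"
    using unit by (intro lin_mapsI) (simp_all add: K.r_distr K.m_lcomm)
  from lin_maps_comp[OF lin_maps_comp[OF function_rep_lin[OF endo v(1)] d[OF s(1)]] this]
  have \<tau>: "\<tau> \<in> lin_maps K P unit_rep" by (simp add: \<tau>_def)
  have \<tau>e: "\<tau> e = \<one>\<^bsub>K\<^esub>" using e(2)[OF v(1)] unit by (simp add: \<tau>_def)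
  obtain Q \<pi> where ses: "ses K G unit_rep P Q (\<lambda>c. c \<odot>\<^bsub>P\<^esub> e) \<pi>" and Q: "carrier Q \<subseteq> carrier P"
    "add Q = add P" "smult Q = smult P" "\<And>g x. act Q g x = \<pi> (act P g x)"
    and \<pi>: "\<And>x. \<pi> x = x \<ominus>\<^bsub>P\<^esub> \<tau> x \<odot>\<^bsub>P\<^esub> e" "\<And>x. x \<in> carrier Q \<Longrightarrow> \<pi> x = x"
      "\<And>c x. \<lbrakk>c \<in> carrier K; x \<in> carrier P\<rbrakk> \<Longrightarrow> \<pi> (x \<oplus>\<^bsub>P\<^esub> c \<odot>\<^bsub>P\<^esub> e) = \<pi> x"
    by (rule invariant_vector_ses[OF PM e(1) ge \<tau> \<tau>e]) (assumption, rule that, assumption+)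
  have QM: "Q \<in> kG_Mod K G" and \<pi>hom: "\<pi> \<in> Hom K G P Q" using ses by (auto simp: ses_def)
  have "\<exists>f'\<in>Hom K G V P. eq_mod (st_null K G) V Q (\<pi> \<circ> f') f"
    if V: "V \<in> Pcls K G w" and f: "f \<in> Hom K G V Q" for V f
  proof -
    obtain Y T \<beta> i p where VM: "V \<in> kG_Mod K G" and Y: "Y \<in> kG_Mod K G" and T: "is_tensor K G w Y T \<beta>"
      and i: "i \<in> Hom K G V T" and p: "p \<in> Hom K G T V" and pi: "\<And>x. x \<in> carrier V \<Longrightarrow> p (i x) = x"
      using Pcls_retract[OF V] by blast
    \<comment> \<open>The map \<open>f\<close> on the summand is extended over w \<otimes> Y by
      \<open>p\<close>, lifted there, and restricted by \<open>i\<close>.\<close>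
    obtain h where h: "h \<in> Hom K G T P" "\<And>t. t \<in> carrier T \<Longrightarrow> \<pi> (h t) = f (p t)"
      using lift_along_identity_quotient[OF e \<tau> QM \<pi>hom Q \<pi> T Y Hom_comp[OF p f]] by blast
    have "eq_mod (st_null K G) V Q (\<pi> \<circ> (\<lambda>x. h (i x))) f"
      using lin_maps_closed[OF Hom_lin[OF i]] lin_maps_closed[OF Hom_lin[OF f]]
      by (intro eq_mod_st_refl[OF VM QM]) (simp_all add: h(2) pi)
    then show ?thesis using Hom_comp[OF i h(1)] by blast
  qed
  moreover have "P \<in> Pcls K G w" using is_tensor_endo DM by (rule tensor_mem_Pcls)
  moreover have "isomorphic K G (st_null K G) P P"
    unfolding isomorphic_def is_iso_def using PM id_Hom
    by (auto intro!: exI[of _ id] bexI[of _ id] eq_mod_st_refl)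
  ultimately have "right_approx K G w P Q \<pi>"
    unfolding right_approx_def using QM \<pi>hom by blast
  then show ?thesis using that ses by (auto simp: shift_model_def)
qed

end

text \<open>A nonzero \<open>w\<close> is infinite, so its endomorphisms can be coded in
  \<open>'v\<close>. For zero \<open>w\<close> the endomorphism module is zero and contains no copy
  of k, which forces the separate construction.\<close>

lemma (in kG_modules) shift_model_exists:
  assumes "finite (carrier G)" and w: "w \<in> fd_kG_Mod K G"
  obtains P S \<iota> \<pi> where "shift_model K G w unit_rep P S \<iota> \<pi>"
proof (cases "carrier w = {\<zero>\<^bsub>w\<^esub>}")
  case True
  then show ?thesis using shift_model_zero assms that by (auto simp: fd_kG_Mod_def)
next
  case False
  have wM: "w \<in> kG_Mod K G" and fd: "fin_dim K w" using w by (auto simp: fd_kG_Mod_def)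
  interpret w: module K w using wM by (rule kG_Mod_module)
  obtain v where v: "v \<in> carrier w" "v \<noteq> \<zero>\<^bsub>w\<^esub>" using False w.M.zero_closed by blast
  obtain D \<phi> where D: "is_hom_rep w unit_rep D \<phi>"
    using hom_rep_exists[OF w unit_rep] K.infinite_carrier by auto
  obtain P ev where P: "is_hom_rep w w P ev"
    using hom_rep_exists[OF w wM infinite_module[OF w.module_axioms v]] by blast
  have "\<exists>x. A \<in> lin_maps K w w \<longrightarrow> x \<in> carrier P \<and> (\<forall>u\<in>carrier w. ev x u = A u)" for A
    using function_rep_ex[OF P, of A] by blast
  then obtain mk where mk: "\<And>A. A \<in> lin_maps K w w \<Longrightarrow> mk A \<in> carrier P \<and> (\<forall>u\<in>carrier w. ev (mk A) u = A u)"
    by metis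
  interpret endomorphism_rep K G w D P \<phi> ev mk
    by (intro endomorphism_rep.intro endomorphism_rep_axioms.intro kG_modules_axioms wM fd D P)
      (use mk in blast)+
  show ?thesis by (rule shift_model_endo[OF v]) (erule that)
qed

theorem proposition4p1:
  fixes K :: "('v, 'y) ring_scheme" and G :: "('g, 'z) monoid_scheme"
    and w :: "('v, 'g) rep" and p :: nat
  assumes "algebraically_closed K" and "has_char K p"
    and "group G" and "finite (carrier G)" and "p dvd order G"
    and "w \<in> fd_kG_Mod K G"
    and "\<And>L' L M T. \<lbrakk>thick K G w (fd_kG_Mod K G) L'; tensor_closed K G L';
        L = localizing_closure K G w L'; M \<in> kG_Mod K G;
        bousfield_triangle K G w L (trivial_module K) T\<rbrakk> \<Longrightarrow>
      \<exists>S T'. bousfield_triangle K G w L M S \<and> is_tensor_triangle K G M T T' \<and>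
        triangle_iso K G w S T'"
  shows "localizing_closure K G w (fd_kG_Mod K G) = kG_Mod K G"
proof -
  interpret kG_modules K G using assms(1,3) by (rule kG_modules.intro)
  obtain P S \<iota> \<pi> where "shift_model K G w (trivial_module K) P S \<iota> \<pi>"
    using shift_model_exists[OF assms(4,6)] by blast
  then show ?thesis using assms(7) by (rule localizing_closure_fd_of_shift_model[OF assms(6)])
qed

end
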